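(* The functor $F$ induces an equivalence of categories $F:\mathrm{rep}(A)\to\mathcal{C}$. In particular, the category $\mathcal{C}$ is abelian.
   Context: $\mathbb{K}$ is an algebraically closed field, $m\ge 1$, and $A=A_1*\cdots*A_m$ is the free product (coproduct in associative unital $\mathbb{K}$-algebras) of finite dimensional semisimple $\mathbb{K}$-algebras $A_i$, none of which is one-dimensional. Write $A_i=A_{i1}\times\cdots\times A_{ir_i}$ with $A_{ij}=\mathrm{Mat}_{w_{ij}}(\mathbb{K})$, and let $e_{ij}^{pq}\in A_{ij}$ be the matrix units ($1\le p,q\le w_{ij}$). $\mathrm{rep}(A)$ is the category of finite dimensional left $A$-modules. The quiver $\Gamma=\Gamma_A$ has one sink $v_0$, a source $v_{ij}$ for each $1\le i\le m$, $1\le j\le r_i$, and $w_{ij}$ arrows $\alpha_{ij}^1,\dots,\alpha_{ij}^{w_{ij}}$ from $v_{ij}$ to $v_0$. $\mathrm{rep}(\Gamma)$ is the category of finite dimensional representations of $\Gamma$ over $\mathbb{K}$. For $X\in\mathrm{rep}(\Gamma)$ write $X_0=X(v_0)$, $X_{ij}=X(v_{ij})$. The $\mathbb{K}$-linear functor $F:\mathrm{rep}(A)\to\mathrm{rep}(\Gamma)$ sends $M$ to the representation with $F(M)_0=M$, $F(M)_{ij}=e_{ij}^{11}M$, and $F(M)(\alpha_{ij}^k):e_{ij}^{11}M\to M$ equal to left multiplication by $e_{ij}^{k1}$ (followed by inclusion of $e_{ij}^{kk}M$ into $M$); it sends $f:M\to N$ to the morphism with $F(f)_0=f$ and $F(f)_{ij}$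 the restriction $e_{ij}^{11}M\to e_{ij}^{11}N$ of $f$. A representation $X$ of $\Gamma$ is balanced if for each $1\le i\le m$ the map $$\Psi(X,i)=\bigoplus_{j=1}^{r_i}\bigoplus_{k=1}^{w_{ij}}X(\alpha_{ij}^k):\bigoplus_{j=1}^{r_i}\bigoplus_{k=1}^{w_{ij}}X_{ij}\to X_0$$ is invertible. $\mathcal{C}$ is the full subcategory of $\mathrm{rep}(\Gamma)$ consisting of the balanced representations. *)

theory Defs
  imports
    "Jordan_Normal_Form.VS_Connect"
    "Graph_Theory.Digraph"
    "HOL-Algebra.QuotRing"
begin

section \<open>Categories, functors, equivalences\<close>

text \<open>Hom-sets need not be disjoint, so composition, like every operation on morphisms below,
  takes the objects as arguments: for \<open>f : X \<rightarrow> Y\<close> and \<open>g : Y \<rightarrow> Z\<close> the composite is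
  \<open>Comp C X Y Z g f : X \<rightarrow> Z\<close>.\<close>

record ('o, 'm) category =
  Obj :: "'o set"
  Hom :: "'o \<Rightarrow> 'o \<Rightarrow> 'm set"
  Idt :: "'o \<Rightarrow> 'm"
  Comp :: "'o \<Rightarrow> 'o \<Rightarrow> 'o \<Rightarrow> 'm \<Rightarrow> 'm \<Rightarrow> 'm"

locale category =
  fixes C :: "('o, 'm, 'x) category_scheme"
  assumes Idt_in: "X \<in> Obj C \<Longrightarrow> Idt C X \<in> Hom C X X"
    and Comp_in: "\<lbrakk>X \<in> Obj C; Y \<in> Obj C; Z \<in> Obj C; f \<in> Hom C X Y; g \<in> Hom C Y Z\<rbrakk>
      \<Longrightarrow> Comp C X Y Z g f \<in> Hom C X Z"
    and Comp_Idt_left: "\<lbrakk>X \<in> Obj C; Y \<in> Obj C; f \<in> Hom C X Y\<rbrakk>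
      \<Longrightarrow> Comp C X Y Y (Idt C Y) f = f"
    and Comp_Idt_right: "\<lbrakk>X \<in> Obj C; Y \<in> Obj C; f \<in> Hom C X Y\<rbrakk>
      \<Longrightarrow> Comp C X X Y f (Idt C X) = f"
    and Comp_assoc: "\<lbrakk>W \<in> Obj C; X \<in> Obj C; Y \<in> Obj C; Z \<in> Obj C;
        f \<in> Hom C W X; g \<in> Hom C X Y; h \<in> Hom C Y Z\<rbrakk>
      \<Longrightarrow> Comp C W Y Z h (Comp C W X Y g f) = Comp C W X Z (Comp C X Y Z h g) f"

definition full_subcategory ::
    "('o, 'm, 'x) category_scheme \<Rightarrow> ('o \<Rightarrow> bool) \<Rightarrow> ('o, 'm, 'x) category_scheme" where
  "full_subcategory C P = C\<lparr>Obj := {X \<in> Obj C. P X}\<rparr>"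

record ('o1, 'm1, 'o2, 'm2) functor_data =
  fobj :: "'o1 \<Rightarrow> 'o2"
  farr :: "'o1 \<Rightarrow> 'o1 \<Rightarrow> 'm1 \<Rightarrow> 'm2"

definition is_functor :: "('o1, 'm1, 'x1) category_scheme \<Rightarrow> ('o2, 'm2, 'x2) category_scheme \<Rightarrow>
    ('o1, 'm1, 'o2, 'm2) functor_data \<Rightarrow> bool" where
  "is_functor C D F \<longleftrightarrow> category C \<and> category D \<and>
    (\<forall>X\<in>Obj C. fobj F X \<in> Obj D) \<and>
    (\<forall>X\<in>Obj C. \<forall>Y\<in>Obj C. \<forall>f\<in>Hom C X Y. farr F X Y f \<in> Hom D (fobj F X) (fobj F Y)) \<and>
    (\<forall>X\<in>Obj C. farr F X X (Idt C X) = Idt D (fobj F X)) \<and>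
    (\<forall>X\<in>Obj C. \<forall>Y\<in>Obj C. \<forall>Z\<in>Obj C. \<forall>f\<in>Hom C X Y. \<forall>g\<in>Hom C Y Z.
      farr F X Z (Comp C X Y Z g f) =
      Comp D (fobj F X) (fobj F Y) (fobj F Z) (farr F Y Z g) (farr F X Y f))"

definition id_functor :: "('o, 'm, 'o, 'm) functor_data" where
  "id_functor = \<lparr>fobj = (\<lambda>X. X), farr = (\<lambda>X Y f. f)\<rparr>"

definition comp_functor :: "('o2, 'm2, 'o3, 'm3) functor_data \<Rightarrow>
    ('o1, 'm1, 'o2, 'm2) functor_data \<Rightarrow> ('o1, 'm1, 'o3, 'm3) functor_data" where
  "comp_functor G F =
    \<lparr>fobj = (\<lambda>X. fobj G (fobj F X)),
     farr = (\<lambda>X Y f. farr G (fobj F X) (fobj F Y) (farr F X Y f))\<rparr>"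

definition is_iso :: "('o, 'm, 'x) category_scheme \<Rightarrow> 'o \<Rightarrow> 'o \<Rightarrow> 'm \<Rightarrow> bool" where
  "is_iso C X Y f \<longleftrightarrow> f \<in> Hom C X Y \<and>
    (\<exists>g\<in>Hom C Y X. Comp C X Y X g f = Idt C X \<and> Comp C Y X Y f g = Idt C Y)"

definition natural_iso :: "('o1, 'm1, 'x1) category_scheme \<Rightarrow> ('o2, 'm2, 'x2) category_scheme \<Rightarrow>
    ('o1, 'm1, 'o2, 'm2) functor_data \<Rightarrow> ('o1, 'm1, 'o2, 'm2) functor_data \<Rightarrow>
    ('o1 \<Rightarrow> 'm2) \<Rightarrow> bool" where
  "natural_iso C D F G \<eta> \<longleftrightarrow>
    (\<forall>X\<in>Obj C. is_iso D (fobj F X) (fobj G X) (\<eta> X)) \<and>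
    (\<forall>X\<in>Obj C. \<forall>Y\<in>Obj C. \<forall>f\<in>Hom C X Y.
      Comp D (fobj F X) (fobj F Y) (fobj G Y) (\<eta> Y) (farr F X Y f) =
      Comp D (fobj F X) (fobj G X) (fobj G Y) (farr G X Y f) (\<eta> X))"

definition equivalence_of_categories :: "('o1, 'm1, 'x1) category_scheme \<Rightarrow>
    ('o2, 'm2, 'x2) category_scheme \<Rightarrow> ('o1, 'm1, 'o2, 'm2) functor_data \<Rightarrow> bool" where
  "equivalence_of_categories C D F \<longleftrightarrow> is_functor C D F \<and>
    (\<exists>G \<eta> \<epsilon>. is_functor D C G \<and>
      natural_iso C C id_functor (comp_functor G F) \<eta> \<and>
      natural_iso D D (comp_functor F G) id_functor \<epsilon>)"

section \<open>Abelian categories\<close>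

record ('o, 'm) preadditive_category = "('o, 'm) category" +
  Hom_add :: "'o \<Rightarrow> 'o \<Rightarrow> 'm \<Rightarrow> 'm \<Rightarrow> 'm"
  Hom_zero :: "'o \<Rightarrow> 'o \<Rightarrow> 'm"

locale preadditive_category = category C
  for C :: "('o, 'm, 'x) preadditive_category_scheme" +
  assumes Hom_group: "\<lbrakk>X \<in> Obj C; Y \<in> Obj C\<rbrakk>
      \<Longrightarrow> comm_group \<lparr>carrier = Hom C X Y, mult = Hom_add C X Y, one = Hom_zero C X Y\<rparr>"
    and Comp_add_right: "\<lbrakk>X \<in> Obj C; Y \<in> Obj C; Z \<in> Obj C;
        f \<in> Hom C X Y; f' \<in> Hom C X Y; g \<in> Hom C Y Z\<rbrakk>
      \<Longrightarrow> Comp C X Y Z g (Hom_add C X Y f f') =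
          Hom_add C X Z (Comp C X Y Z g f) (Comp C X Y Z g f')"
    and Comp_add_left: "\<lbrakk>X \<in> Obj C; Y \<in> Obj C; Z \<in> Obj C;
        f \<in> Hom C X Y; g \<in> Hom C Y Z; g' \<in> Hom C Y Z\<rbrakk>
      \<Longrightarrow> Comp C X Y Z (Hom_add C Y Z g g') f =
          Hom_add C X Z (Comp C X Y Z g f) (Comp C X Y Z g' f)"

definition is_mono :: "('o, 'm, 'x) category_scheme \<Rightarrow> 'o \<Rightarrow> 'o \<Rightarrow> 'm \<Rightarrow> bool" where
  "is_mono C X Y f \<longleftrightarrow> f \<in> Hom C X Y \<and>
    (\<forall>Z\<in>Obj C. \<forall>g\<in>Hom C Z X. \<forall>h\<in>Hom C Z X. Comp C Z X Y f g = Comp C Z X Y f h \<longrightarrow> g = h)"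

definition is_epi :: "('o, 'm, 'x) category_scheme \<Rightarrow> 'o \<Rightarrow> 'o \<Rightarrow> 'm \<Rightarrow> bool" where
  "is_epi C X Y f \<longleftrightarrow> f \<in> Hom C X Y \<and>
    (\<forall>Z\<in>Obj C. \<forall>g\<in>Hom C Y Z. \<forall>h\<in>Hom C Y Z. Comp C X Y Z g f = Comp C X Y Z h f \<longrightarrow> g = h)"

definition is_zero_object :: "('o, 'm, 'x) category_scheme \<Rightarrow> 'o \<Rightarrow> bool" where
  "is_zero_object C Z \<longleftrightarrow> Z \<in> Obj C \<and>
    (\<forall>X\<in>Obj C. (\<exists>!f. f \<in> Hom C X Z) \<and> (\<exists>!f. f \<in> Hom C Z X))"

definition is_biproduct :: "('o, 'm, 'x) preadditive_category_scheme \<Rightarrow> 'o \<Rightarrow> 'o \<Rightarrow> 'o \<Rightarrow>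
    'm \<Rightarrow> 'm \<Rightarrow> 'm \<Rightarrow> 'm \<Rightarrow> bool" where
  "is_biproduct C X Y B inX inY prX prY \<longleftrightarrow> B \<in> Obj C \<and>
    inX \<in> Hom C X B \<and> inY \<in> Hom C Y B \<and> prX \<in> Hom C B X \<and> prY \<in> Hom C B Y \<and>
    Comp C X B X prX inX = Idt C X \<and> Comp C Y B Y prY inY = Idt C Y \<and>
    Comp C Y B X prX inY = Hom_zero C Y X \<and> Comp C X B Y prY inX = Hom_zero C X Y \<and>
    Hom_add C B B (Comp C B X B inX prX) (Comp C B Y B inY prY) = Idt C B"

definition is_kernel :: "('o, 'm, 'x) preadditive_category_scheme \<Rightarrow> 'o \<Rightarrow> 'o \<Rightarrow> 'm \<Rightarrow>
    'o \<Rightarrow> 'm \<Rightarrow> bool" where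
  "is_kernel C X Y f K k \<longleftrightarrow> K \<in> Obj C \<and> k \<in> Hom C K X \<and>
    Comp C K X Y f k = Hom_zero C K Y \<and>
    (\<forall>Z\<in>Obj C. \<forall>g\<in>Hom C Z X. Comp C Z X Y f g = Hom_zero C Z Y \<longrightarrow>
      (\<exists>!h. h \<in> Hom C Z K \<and> Comp C Z K X k h = g))"

definition is_cokernel :: "('o, 'm, 'x) preadditive_category_scheme \<Rightarrow> 'o \<Rightarrow> 'o \<Rightarrow> 'm \<Rightarrow>
    'o \<Rightarrow> 'm \<Rightarrow> bool" where
  "is_cokernel C X Y f Q q \<longleftrightarrow> Q \<in> Obj C \<and> q \<in> Hom C Y Q \<and>
    Comp C X Y Q q f = Hom_zero C X Q \<and>
    (\<forall>Z\<in>Obj C. \<forall>g\<in>Hom C Y Z. Comp C X Y Z g f = Hom_zero C X Z \<longrightarrow>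
      (\<exists>!h. h \<in> Hom C Q Z \<and> Comp C Y Q Z h q = g))"

definition abelian_category :: "('o, 'm, 'x) preadditive_category_scheme \<Rightarrow> bool" where
  "abelian_category C \<longleftrightarrow> preadditive_category C \<and>
    (\<exists>Z. is_zero_object C Z) \<and>
    (\<forall>X\<in>Obj C. \<forall>Y\<in>Obj C. \<exists>B inX inY prX prY. is_biproduct C X Y B inX inY prX prY) \<and>
    (\<forall>X\<in>Obj C. \<forall>Y\<in>Obj C. \<forall>f\<in>Hom C X Y. \<exists>K k. is_kernel C X Y f K k) \<and>
    (\<forall>X\<in>Obj C. \<forall>Y\<in>Obj C. \<forall>f\<in>Hom C X Y. \<exists>Q q. is_cokernel C X Y f Q q) \<and>
    (\<forall>X\<in>Obj C. \<forall>Y\<in>Obj C. \<forall>f. is_mono C X Y f \<longrightarrow>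
      (\<exists>Z\<in>Obj C. \<exists>g\<in>Hom C Y Z. is_kernel C Y Z g X f)) \<and>
    (\<forall>X\<in>Obj C. \<forall>Y\<in>Obj C. \<forall>f. is_epi C X Y f \<longrightarrow>
      (\<exists>Z\<in>Obj C. \<exists>g\<in>Hom C Z X. is_cokernel C Z X g Y f))"

section \<open>Vector spaces, algebras and modules\<close>

text \<open>The ground field is a type, viewed as a ring by \<^const>\<open>class_ring\<close>. The record
  \<^typ>\<open>('k, 'a) module\<close> carries a multiplication besides addition and scalar multiplication; it
  serves for \<open>\<bbbK>\<close>-algebras, and also for vector spaces and modules, where the multiplicative fields
  are never looked at.\<close>

definition fd_space :: "('k::field, 'v) module \<Rightarrow> bool" where
  "fd_space V \<longleftrightarrow> vectorspace class_ring V \<and> vectorspace.fin_dim class_ring V"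

text \<open>Maps are extensional (\<^const>\<open>undefined\<close> outside their domain), so that two of them are
  equal iff they agree on the domain.\<close>

definition lin_maps :: "('r, 'x) ring_scheme \<Rightarrow> ('r, 'v, 'y) module_scheme \<Rightarrow>
    ('r, 'u, 'z) module_scheme \<Rightarrow> ('v \<Rightarrow> 'u) set" where
  "lin_maps R V W = LinearCombinations.module_hom R V W \<inter> extensional (carrier V)"

definition invertible_lin_map :: "('r, 'x) ring_scheme \<Rightarrow> ('r, 'v, 'y) module_scheme \<Rightarrow>
    ('r, 'u, 'z) module_scheme \<Rightarrow> ('v \<Rightarrow> 'u) \<Rightarrow> bool" where
  "invertible_lin_map R V W f \<longleftrightarrow> f \<in> lin_maps R V W \<and>
    (\<exists>g\<in>lin_maps R W V. (\<forall>x\<in>carrier V. g (f x) = x) \<and> (\<forall>y\<in>carrier W. f (g y) = y))"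

text \<open>Used both as a product of algebras and, the index set being finite, as a direct sum of
  vector spaces.\<close>

definition dprod :: "'i set \<Rightarrow> ('i \<Rightarrow> ('k, 'a) module) \<Rightarrow> ('k, 'i \<Rightarrow> 'a) module" where
  "dprod I V =
    \<lparr>carrier = (\<Pi>\<^sub>E i\<in>I. carrier (V i)),
     mult = (\<lambda>x y. \<lambda>i\<in>I. x i \<otimes>\<^bsub>V i\<^esub> y i),
     one = (\<lambda>i\<in>I. \<one>\<^bsub>V i\<^esub>),
     zero = (\<lambda>i\<in>I. \<zero>\<^bsub>V i\<^esub>),
     add = (\<lambda>x y. \<lambda>i\<in>I. x i \<oplus>\<^bsub>V i\<^esub> y i),
     smult = (\<lambda>c x. \<lambda>i\<in>I. c \<odot>\<^bsub>V i\<^esub> x i)\<rparr>"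

text \<open>The library locale \<^locale>\<open>Module.algebra\<close> is about commutative algebras only.\<close>

locale assoc_algebra = Module.module K A + ring A for K and A +
  assumes smult_mult_left: "\<lbrakk>c \<in> carrier K; a \<in> carrier A; b \<in> carrier A\<rbrakk>
      \<Longrightarrow> (c \<odot>\<^bsub>A\<^esub> a) \<otimes>\<^bsub>A\<^esub> b = c \<odot>\<^bsub>A\<^esub> (a \<otimes>\<^bsub>A\<^esub> b)"
    and smult_mult_right: "\<lbrakk>c \<in> carrier K; a \<in> carrier A; b \<in> carrier A\<rbrakk>
      \<Longrightarrow> a \<otimes>\<^bsub>A\<^esub> (c \<odot>\<^bsub>A\<^esub> b) = c \<odot>\<^bsub>A\<^esub> (a \<otimes>\<^bsub>A\<^esub> b)"

definition alg_hom :: "('r, 'x) ring_scheme \<Rightarrow> ('r, 'a, 'y) module_scheme \<Rightarrow>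
    ('r, 'b, 'z) module_scheme \<Rightarrow> ('a \<Rightarrow> 'b) set" where
  "alg_hom K A B = Ring.ring_hom A B \<inter> LinearCombinations.module_hom K A B"

definition alg_iso :: "('r, 'x) ring_scheme \<Rightarrow> ('r, 'a, 'y) module_scheme \<Rightarrow>
    ('r, 'b, 'z) module_scheme \<Rightarrow> ('a \<Rightarrow> 'b) set" where
  "alg_iso K A B = {h \<in> alg_hom K A B. bij_betw h (carrier A) (carrier B)}"

definition left_ideal :: "'a set \<Rightarrow> ('a, 'x) ring_scheme \<Rightarrow> bool" where
  "left_ideal L A \<longleftrightarrow> additive_subgroup L A \<and> (\<forall>a\<in>carrier A. \<forall>x\<in>L. a \<otimes>\<^bsub>A\<^esub> x \<in> L)"

definition semisimple_ring :: "('a, 'x) ring_scheme \<Rightarrow> bool" where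
  "semisimple_ring A \<longleftrightarrow> ring A \<and>
    (\<forall>L. left_ideal L A \<longrightarrow>
      (\<exists>L'. left_ideal L' A \<and> L \<inter> L' = {\<zero>\<^bsub>A\<^esub>} \<and> L <+>\<^bsub>A\<^esub> L' = carrier A))"

text \<open>The library locale \<^locale>\<open>Module.module\<close> assumes the ring of scalars to be commutative.\<close>

locale left_module = R?: ring R + M?: abelian_group M
  for R :: "('r, 'x) ring_scheme" (structure) and M :: "('r, 'v, 'y) module_scheme" (structure) +
  assumes act_closed: "\<lbrakk>a \<in> carrier R; x \<in> carrier M\<rbrakk> \<Longrightarrow> a \<odot>\<^bsub>M\<^esub> x \<in> carrier M"
    and act_add_left: "\<lbrakk>a \<in> carrier R; b \<in> carrier R; x \<in> carrier M\<rbrakk>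
      \<Longrightarrow> (a \<oplus> b) \<odot>\<^bsub>M\<^esub> x = a \<odot>\<^bsub>M\<^esub> x \<oplus>\<^bsub>M\<^esub> b \<odot>\<^bsub>M\<^esub> x"
    and act_add_right: "\<lbrakk>a \<in> carrier R; x \<in> carrier M; y \<in> carrier M\<rbrakk>
      \<Longrightarrow> a \<odot>\<^bsub>M\<^esub> (x \<oplus>\<^bsub>M\<^esub> y) = a \<odot>\<^bsub>M\<^esub> x \<oplus>\<^bsub>M\<^esub> a \<odot>\<^bsub>M\<^esub> y"
    and act_mult: "\<lbrakk>a \<in> carrier R; b \<in> carrier R; x \<in> carrier M\<rbrakk>
      \<Longrightarrow> (a \<otimes> b) \<odot>\<^bsub>M\<^esub> x = a \<odot>\<^bsub>M\<^esub> (b \<odot>\<^bsub>M\<^esub> x)"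
    and act_one: "x \<in> carrier M \<Longrightarrow> \<one> \<odot>\<^bsub>M\<^esub> x = x"

text \<open>The \<open>\<bbbK>\<close>-vector space underlying a module over a \<open>\<bbbK>\<close>-algebra.\<close>

definition underlying_space ::
    "('k, 'a, 'x) module_scheme \<Rightarrow> ('a, 'v) module \<Rightarrow> ('k, 'v) module" where
  "underlying_space A M =
    \<lparr>carrier = carrier M, mult = mult M, one = one M, zero = zero M, add = add M,
     smult = (\<lambda>c x. (c \<odot>\<^bsub>A\<^esub> \<one>\<^bsub>A\<^esub>) \<odot>\<^bsub>M\<^esub> x)\<rparr>"

text \<open>The carriers of all modules and representations are subsets of a type \<open>'v\<close>, the universe. As
  soon as \<open>\<bbbK>\<close> embeds into \<open>'v\<close> (and \<open>\<bbbK>\<close> is infinite, for instance algebraically closed), every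
  finite dimensional module or representation is isomorphic to one in the universe.\<close>

definition rep_algebra ::
    "('k::field, 'a) module \<Rightarrow> (('a, 'v) module, 'v \<Rightarrow> 'v) preadditive_category" where
  "rep_algebra A =
    \<lparr>Obj = {M. left_module A M \<and> fd_space (underlying_space A M)},
     Hom = (\<lambda>M N. lin_maps A M N),
     Idt = (\<lambda>M. \<lambda>x\<in>carrier M. x),
     Comp = (\<lambda>L M N g f. compose (carrier L) g f),
     Hom_add = (\<lambda>M N f g. \<lambda>x\<in>carrier M. f x \<oplus>\<^bsub>N\<^esub> g x),
     Hom_zero = (\<lambda>M N. \<lambda>x\<in>carrier M. \<zero>\<^bsub>N\<^esub>)\<rparr>"

section \<open>Free products of algebras\<close>

text \<open>Elements of the free algebra on the set \<open>S\<close> are finitely supported functions from words over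
  \<open>S\<close> to the field.\<close>

definition free_algebra :: "'s set \<Rightarrow> ('k::field, 's list \<Rightarrow> 'k) module" where
  "free_algebra S =
    \<lparr>carrier = {f. finite {u. f u \<noteq> 0} \<and> {u. f u \<noteq> 0} \<subseteq> lists S},
     mult = (\<lambda>f g u. \<Sum>n\<le>length u. f (take n u) * g (drop n u)),
     one = (\<lambda>u. if u = [] then 1 else 0),
     zero = (\<lambda>u. 0),
     add = (\<lambda>f g u. f u + g u),
     smult = (\<lambda>c f u. c * f u)\<rparr>"

definition letter :: "'s \<Rightarrow> 's list \<Rightarrow> 'k::field" where
  "letter s = (\<lambda>u. if u = [s] then 1 else 0)"

definition quot_algebra :: "('k, 'a) module \<Rightarrow> 'a set \<Rightarrow> ('k, 'a set) module" where
  "quot_algebra A J =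
    \<lparr>carrier = carrier (A Quot J), mult = mult (A Quot J), one = one (A Quot J),
     zero = zero (A Quot J), add = add (A Quot J),
     smult = (\<lambda>c U. \<Union>u\<in>U. J +>\<^bsub>A\<^esub> (c \<odot>\<^bsub>A\<^esub> u))\<rparr>"

text \<open>The free product of the algebras \<open>A i\<close>, \<open>i \<in> I\<close>: the free algebra on their disjoint union
  modulo the relations that make every map \<open>a \<mapsto> (i, a)\<close> a homomorphism of unital algebras. That
  this is the coproduct is proved below.\<close>

abbreviation letters_algebra ::
    "'i set \<Rightarrow> ('i \<Rightarrow> ('k::field, 'a) module) \<Rightarrow> ('k, ('i \<times> 'a) list \<Rightarrow> 'k) module" where
  "letters_algebra I A \<equiv> free_algebra (SIGMA i:I. carrier (A i))"

definition free_product_relations ::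
    "'i set \<Rightarrow> ('i \<Rightarrow> ('k::field, 'a) module) \<Rightarrow> (('i \<times> 'a) list \<Rightarrow> 'k) set" where
  "free_product_relations I A = (let T = letters_algebra I A in
    {letter (i, a \<oplus>\<^bsub>A i\<^esub> b) \<ominus>\<^bsub>T\<^esub> (letter (i, a) \<oplus>\<^bsub>T\<^esub> letter (i, b)) | i a b.
      i \<in> I \<and> a \<in> carrier (A i) \<and> b \<in> carrier (A i)} \<union>
    {letter (i, c \<odot>\<^bsub>A i\<^esub> a) \<ominus>\<^bsub>T\<^esub> c \<odot>\<^bsub>T\<^esub> letter (i, a) | i c a. i \<in> I \<and> a \<in> carrier (A i)} \<union>
    {letter (i, a \<otimes>\<^bsub>A i\<^esub> b) \<ominus>\<^bsub>T\<^esub> letter (i, a) \<otimes>\<^bsub>T\<^esub> letter (i, b) | i a b.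
      i \<in> I \<and> a \<in> carrier (A i) \<and> b \<in> carrier (A i)} \<union>
    {letter (i, \<one>\<^bsub>A i\<^esub>) \<ominus>\<^bsub>T\<^esub> \<one>\<^bsub>T\<^esub> | i. i \<in> I})"

definition free_product_ideal ::
    "'i set \<Rightarrow> ('i \<Rightarrow> ('k::field, 'a) module) \<Rightarrow> (('i \<times> 'a) list \<Rightarrow> 'k) set" where
  "free_product_ideal I A = Idl\<^bsub>letters_algebra I A\<^esub> (free_product_relations I A)"

definition free_product ::
    "'i set \<Rightarrow> ('i \<Rightarrow> ('k::field, 'a) module) \<Rightarrow> ('k, (('i \<times> 'a) list \<Rightarrow> 'k) set) module" where
  "free_product I A = quot_algebra (letters_algebra I A) (free_product_ideal I A)"

definition free_product_incl ::
    "'i set \<Rightarrow> ('i \<Rightarrow> ('k::field, 'a) module) \<Rightarrow> 'i \<Rightarrow> 'a \<Rightarrow> (('i \<times> 'a) list \<Rightarrow> 'k) set" where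
  "free_product_incl I A i a =
    free_product_ideal I A +>\<^bsub>letters_algebra I A\<^esub> letter (i, a)"

subsection \<open>The universal property\<close>

lemma free_algebra_simps:
  "carrier (free_algebra S) = {f. finite {u. f u \<noteq> 0} \<and> {u. f u \<noteq> 0} \<subseteq> lists S}"
  "f \<otimes>\<^bsub>free_algebra S\<^esub> g = (\<lambda>u. \<Sum>n\<le>length u. f (take n u) * g (drop n u))"
  "\<one>\<^bsub>free_algebra S\<^esub> = (\<lambda>u. if u = [] then 1 else 0)"
  "\<zero>\<^bsub>free_algebra S\<^esub> = (\<lambda>u. 0)"
  "f \<oplus>\<^bsub>free_algebra S\<^esub> g = (\<lambda>u. f u + g u)"
  "c \<odot>\<^bsub>free_algebra S\<^esub> f = (\<lambda>u. c * f u)"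
  by (simp_all add: free_algebra_def)

lemma free_algebra_add_closed:
  assumes "f \<in> carrier (free_algebra S)" "g \<in> carrier (free_algebra S)"
  shows "(\<lambda>u. f u + g u) \<in> carrier (free_algebra S)"
proof -
  have "{u. f u + g u \<noteq> 0} \<subseteq> {u. f u \<noteq> 0} \<union> {u. g u \<noteq> 0}" by auto
  then show ?thesis using assms by (auto simp: free_algebra_simps intro: finite_subset)
qed

lemma free_algebra_smult_closed:
  assumes "f \<in> carrier (free_algebra S)"
  shows "(\<lambda>u. c * f u) \<in> carrier (free_algebra S)"
proof -
  have "{u. c * f u \<noteq> 0} \<subseteq> {u. f u \<noteq> 0}" by auto
  then show ?thesis using assms by (auto simp: free_algebra_simps intro: finite_subset)
qed

lemma free_algebra_mult_closed:
  assumes "f \<in> carrier (free_algebra S)" "g \<in> carrier (free_algebra S)"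
  shows "(\<lambda>u. \<Sum>n\<le>length u. f (take n u) * g (drop n u)) \<in> carrier (free_algebra S)"
proof -
  let ?p = "\<lambda>u. \<Sum>n\<le>length u. f (take n u) * g (drop n u)"
  have sub: "{u. ?p u \<noteq> 0} \<subseteq> (\<lambda>(a, b). a @ b) ` ({u. f u \<noteq> 0} \<times> {u. g u \<noteq> 0})"
  proof
    fix u assume "u \<in> {u. ?p u \<noteq> 0}"
    then have "?p u \<noteq> 0" by simp
    then obtain n where "f (take n u) * g (drop n u) \<noteq> 0" by (meson sum.neutral)
    then show "u \<in> (\<lambda>(a, b). a @ b) ` ({u. f u \<noteq> 0} \<times> {u. g u \<noteq> 0})"
      by (intro image_eqI[of _ _ "(take n u, drop n u)"]) auto
  qed
  have "finite ({u. f u \<noteq> 0} \<times> {u. g u \<noteq> 0})" using assms by (auto simp: free_algebra_simps)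
  then have "finite {u. ?p u \<noteq> 0}" using sub by (meson finite_imageI finite_subset)
  moreover have "{u. ?p u \<noteq> 0} \<subseteq> lists S"
    using sub assms by (fastforce simp: free_algebra_simps)
  ultimately show ?thesis by (simp add: free_algebra_simps)
qed

lemma free_algebra_mult_assoc:
  fixes f g h :: "'s list \<Rightarrow> 'k::field"
  shows "(\<Sum>n\<le>length u. (\<Sum>m\<le>length (take n u). f (take m (take n u)) * g (drop m (take n u))) * h (drop n u)) =
    (\<Sum>m\<le>length u. f (take m u) * (\<Sum>l\<le>length (drop m u). g (take l (drop m u)) * h (drop l (drop m u))))"
    (is "?L = ?R")
proof -
  have "?L = (\<Sum>n\<le>length u. \<Sum>m\<le>n. f (take m u) * g (drop m (take n u)) * h (drop n u))"
    by (intro sum.cong) (auto simp: sum_distrib_right min_def)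
  also have "\<dots> = (\<Sum>(n, m)\<in>(SIGMA n:{..length u}. {..n}). f (take m u) * g (drop m (take n u)) * h (drop n u))"
    by (rule sum.Sigma) auto
  also have "\<dots> = (\<Sum>(m, l)\<in>(SIGMA m:{..length u}. {..length u - m}).
      f (take m u) * (g (take l (drop m u)) * h (drop l (drop m u))))"
    by (rule sum.reindex_bij_witness[of _ "\<lambda>(m, l). (l + m, m)" "\<lambda>(n, m). (m, n - m)"])
       (auto simp: drop_take algebra_simps)
  also have "\<dots> = (\<Sum>m\<le>length u. \<Sum>l\<le>length u - m. f (take m u) * (g (take l (drop m u)) * h (drop l (drop m u))))"
    by (rule sum.Sigma[symmetric]) auto
  also have "\<dots> = ?R" by (intro sum.cong) (auto simp: sum_distrib_left)
  finally show ?thesis .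
qed

lemma free_algebra_ring: "ring (free_algebra S :: ('k::field, 's list \<Rightarrow> 'k) module)"
proof (rule ringI)
  let ?T = "free_algebra S :: ('k, 's list \<Rightarrow> 'k) module"
  show "abelian_group ?T"
  proof (rule abelian_groupI)
    fix x assume x: "x \<in> carrier ?T"
    show "\<exists>y\<in>carrier ?T. y \<oplus>\<^bsub>?T\<^esub> x = \<zero>\<^bsub>?T\<^esub>"
      using free_algebra_smult_closed[OF x, of "-1"]
      by (intro bexI[of _ "\<lambda>u. (-1) * x u"]) (auto simp: free_algebra_simps(4,5))
  qed (auto simp: free_algebra_simps(2-) free_algebra_add_closed add_ac,
       auto simp: free_algebra_simps)
  show "Group.monoid ?T"
  proof (rule monoidI)
    fix x y z assume "x \<in> carrier ?T" "y \<in> carrier ?T" "z \<in> carrier ?T"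
    show "x \<otimes>\<^bsub>?T\<^esub> y \<otimes>\<^bsub>?T\<^esub> z = x \<otimes>\<^bsub>?T\<^esub> (y \<otimes>\<^bsub>?T\<^esub> z)"
      unfolding free_algebra_simps(2) by (rule ext) (rule free_algebra_mult_assoc)
  next
    fix x :: "'s list \<Rightarrow> 'k" assume "x \<in> carrier ?T"
    have "(\<Sum>n\<le>length u. (if take n u = [] then 1 else 0) * x (drop n u)) = x u" for u
    proof -
      have "(\<Sum>n\<le>length u. (if take n u = [] then 1 else 0) * x (drop n u)) =
        (\<Sum>n\<le>length u. if n = 0 then x u else 0)"
        by (intro sum.cong) auto
      then show ?thesis by simp
    qed
    then show "\<one>\<^bsub>?T\<^esub> \<otimes>\<^bsub>?T\<^esub> x = x" by (simp add: free_algebra_simps)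
    have "(\<Sum>n\<le>length u. x (take n u) * (if drop n u = [] then 1 else 0)) = x u" for u
    proof -
      have "(\<Sum>n\<le>length u. x (take n u) * (if drop n u = [] then 1 else 0)) =
        (\<Sum>n\<le>length u. if n = length u then x u else 0)"
        by (intro sum.cong) auto
      then show ?thesis by simp
    qed
    then show "x \<otimes>\<^bsub>?T\<^esub> \<one>\<^bsub>?T\<^esub> = x" by (simp add: free_algebra_simps)
  qed (auto simp: free_algebra_simps(2) free_algebra_mult_closed, auto simp: free_algebra_simps)
qed (auto simp: free_algebra_simps(2-) algebra_simps sum.distrib)

lemma free_algebra_assoc_algebra:
  "assoc_algebra class_ring (free_algebra S :: ('k::field, 's list \<Rightarrow> 'k) module)"
proof -
  let ?T = "free_algebra S :: ('k, 's list \<Rightarrow> 'k) module"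
  interpret ring ?T by (rule free_algebra_ring)
  have "Module.module class_ring ?T"
    by (rule moduleI)
      (auto simp: free_algebra_simps(2-) free_algebra_smult_closed algebra_simps class_cring.cring_axioms abelian_group_axioms
        intro: class_cring.cring_axioms abelian_group_axioms)
  then show ?thesis
    by (intro assoc_algebra.intro assoc_algebra_axioms.intro ring_axioms)
       (auto simp: free_algebra_simps(2-) sum_distrib_left algebra_simps)
qed

lemma quot_algebra_simps:
  "carrier (quot_algebra A J) = carrier (A Quot J)"
  "mult (quot_algebra A J) = mult (A Quot J)"
  "one (quot_algebra A J) = one (A Quot J)"
  "zero (quot_algebra A J) = zero (A Quot J)"
  "add (quot_algebra A J) = add (A Quot J)"
  by (simp_all add: quot_algebra_def)

lemma quot_algebra_smult:
  assumes "assoc_algebra K A" "ideal J A" "c \<in> carrier K" "u \<in> carrier A"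
  shows "c \<odot>\<^bsub>quot_algebra A J\<^esub> (J +>\<^bsub>A\<^esub> u) = J +>\<^bsub>A\<^esub> (c \<odot>\<^bsub>A\<^esub> u)"
proof -
  interpret assoc_algebra K A by fact
  interpret J: ideal J A by fact
  have "J +>\<^bsub>A\<^esub> (c \<odot>\<^bsub>A\<^esub> v) = J +>\<^bsub>A\<^esub> (c \<odot>\<^bsub>A\<^esub> u)" if v: "v \<in> J +>\<^bsub>A\<^esub> u" for v
  proof -
    obtain j where j: "j \<in> J" "v = j \<oplus>\<^bsub>A\<^esub> u" using v by (auto simp: a_r_coset_def')
    have jc: "j \<in> carrier A" using j(1) by (rule J.a_Hcarr)
    have "(c \<odot>\<^bsub>A\<^esub> \<one>\<^bsub>A\<^esub>) \<otimes>\<^bsub>A\<^esub> j \<in> J" using j(1) assms(3) by (intro J.I_l_closed) auto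
    then have "c \<odot>\<^bsub>A\<^esub> j \<in> J" using jc assms(3) by (simp add: smult_mult_left)
    moreover have "c \<odot>\<^bsub>A\<^esub> v = c \<odot>\<^bsub>A\<^esub> j \<oplus>\<^bsub>A\<^esub> c \<odot>\<^bsub>A\<^esub> u"
      using j jc assms(3,4) by (simp add: smult_r_distr)
    ultimately have "c \<odot>\<^bsub>A\<^esub> v \<in> J +>\<^bsub>A\<^esub> (c \<odot>\<^bsub>A\<^esub> u)" by (auto simp: a_r_coset_def')
    then show ?thesis using J.a_repr_independence' assms(3,4) by blast
  qed
  moreover have "u \<in> J +>\<^bsub>A\<^esub> u" using assms(4) by (rule J.a_rcos_self)
  ultimately have "(\<Union>v\<in>J +>\<^bsub>A\<^esub> u. J +>\<^bsub>A\<^esub> (c \<odot>\<^bsub>A\<^esub> v)) = J +>\<^bsub>A\<^esub> (c \<odot>\<^bsub>A\<^esub> u)"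
    by (intro SUP_eq_const) blast+
  then show ?thesis by (simp add: quot_algebra_def)
qed

lemma quot_algebra_coset:
  assumes "U \<in> carrier (quot_algebra A J)"
  obtains u where "u \<in> carrier A" "U = J +>\<^bsub>A\<^esub> u"
  using assms by (auto simp: quot_algebra_simps FactRing_def A_RCOSETS_def' a_r_coset_def')

lemma quot_algebra_ring:
  assumes "ideal J A" shows "ring (quot_algebra A J)"
proof -
  interpret ring "A Quot J" using assms by (rule ideal.quotient_is_ring)
  show ?thesis
  proof (rule ringI)
    show "abelian_group (quot_algebra A J)"
    proof (rule abelian_groupI)
      fix x assume "x \<in> carrier (quot_algebra A J)"
      then show "\<exists>y\<in>carrier (quot_algebra A J). y \<oplus>\<^bsub>quot_algebra A J\<^esub> x = \<zero>\<^bsub>quot_algebra A J\<^esub>"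
        by (intro bexI[of _ "\<ominus>\<^bsub>A Quot J\<^esub> x"]) (simp_all add: quot_algebra_simps l_neg)
    qed (simp_all add: quot_algebra_simps a_ac)
    show "Group.monoid (quot_algebra A J)"
      by (rule monoidI) (simp_all add: quot_algebra_simps m_assoc)
  qed (simp_all add: quot_algebra_simps l_distr r_distr)
qed

lemma quot_algebra_proj_closed:
  assumes "ideal J A" "u \<in> carrier A"
  shows "J +>\<^bsub>A\<^esub> u \<in> carrier (quot_algebra A J)"
proof -
  interpret J: ideal J A by fact
  show ?thesis using assms(2) J.a_rcosetsI[OF J.a_subset] by (simp add: quot_algebra_simps FactRing_def)
qed

lemma quot_algebra_proj:
  assumes "assoc_algebra K A" "ideal J A"
  shows "(\<lambda>u. J +>\<^bsub>A\<^esub> u) \<in> alg_hom K A (quot_algebra A J)"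
proof -
  interpret J: ideal J A by fact
  have "(+>\<^bsub>A\<^esub>) J \<in> Ring.ring_hom A (A Quot J)" by (rule J.rcos_ring_hom)
  then show ?thesis using quot_algebra_smult[OF assms] quot_algebra_proj_closed[OF assms(2)]
    by (auto simp: alg_hom_def LinearCombinations.module_hom_def Ring.ring_hom_def quot_algebra_simps)
qed

lemma quot_algebra_assoc_algebra:
  assumes "assoc_algebra K A" "ideal J A"
  shows "assoc_algebra K (quot_algebra A J)"
proof -
  interpret assoc_algebra K A by fact
  interpret J: ideal J A by fact
  let ?Q = "quot_algebra A J"
  interpret Q: ring ?Q by (rule quot_algebra_ring) fact
  note sm = quot_algebra_smult[OF assms]
  have add: "(J +>\<^bsub>A\<^esub> u) \<oplus>\<^bsub>?Q\<^esub> (J +>\<^bsub>A\<^esub> v) = J +>\<^bsub>A\<^esub> (u \<oplus>\<^bsub>A\<^esub> v)"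
    if "u \<in> carrier A" "v \<in> carrier A" for u v
    using that by (simp add: quot_algebra_simps FactRing_def J.a_rcos_sum)
  have mul: "(J +>\<^bsub>A\<^esub> u) \<otimes>\<^bsub>?Q\<^esub> (J +>\<^bsub>A\<^esub> v) = J +>\<^bsub>A\<^esub> (u \<otimes>\<^bsub>A\<^esub> v)"
    if "u \<in> carrier A" "v \<in> carrier A" for u v
    using that by (simp add: quot_algebra_simps FactRing_def J.rcoset_mult_add)
  have car: "carrier ?Q = (\<lambda>u. J +>\<^bsub>A\<^esub> u) ` carrier A"
    using quot_algebra_proj_closed[OF assms(2)] by (blast elim: quot_algebra_coset)
  have m: "Module.module K ?Q"
  proof (rule moduleI)
    show "cring K" "abelian_group ?Q" by (rule R.cring_axioms, rule Q.abelian_group_axioms)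
    show "c \<odot>\<^bsub>?Q\<^esub> U \<in> carrier ?Q" if "c \<in> carrier K" "U \<in> carrier ?Q" for c U
      using that sm unfolding car by auto
    show "\<one>\<^bsub>K\<^esub> \<odot>\<^bsub>?Q\<^esub> U = U" if "U \<in> carrier ?Q" for U
      using that sm unfolding car by auto
    show "(c \<oplus>\<^bsub>K\<^esub> d) \<odot>\<^bsub>?Q\<^esub> U = c \<odot>\<^bsub>?Q\<^esub> U \<oplus>\<^bsub>?Q\<^esub> d \<odot>\<^bsub>?Q\<^esub> U"
      if "c \<in> carrier K" "d \<in> carrier K" "U \<in> carrier ?Q" for c d U
    proof -
      obtain u where "u \<in> carrier A" "U = J +>\<^bsub>A\<^esub> u" using \<open>U \<in> carrier ?Q\<close> car by auto
      then show ?thesis using that(1,2) by (simp add: sm add smult_l_distr)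
    qed
    show "(c \<otimes>\<^bsub>K\<^esub> d) \<odot>\<^bsub>?Q\<^esub> U = c \<odot>\<^bsub>?Q\<^esub> (d \<odot>\<^bsub>?Q\<^esub> U)"
      if "c \<in> carrier K" "d \<in> carrier K" "U \<in> carrier ?Q" for c d U
    proof -
      obtain u where "u \<in> carrier A" "U = J +>\<^bsub>A\<^esub> u" using \<open>U \<in> carrier ?Q\<close> car by auto
      then show ?thesis using that(1,2) by (simp add: sm smult_assoc1)
    qed
    show "c \<odot>\<^bsub>?Q\<^esub> (U \<oplus>\<^bsub>?Q\<^esub> V) = c \<odot>\<^bsub>?Q\<^esub> U \<oplus>\<^bsub>?Q\<^esub> c \<odot>\<^bsub>?Q\<^esub> V"
      if "c \<in> carrier K" "U \<in> carrier ?Q" "V \<in> carrier ?Q" for c U V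
    proof -
      obtain u where "u \<in> carrier A" "U = J +>\<^bsub>A\<^esub> u" using \<open>U \<in> carrier ?Q\<close> car by auto
      moreover obtain v where "v \<in> carrier A" "V = J +>\<^bsub>A\<^esub> v" using \<open>V \<in> carrier ?Q\<close> car by auto
      ultimately show ?thesis using that(1) by (simp add: sm add smult_r_distr)
    qed
  qed
  show ?thesis
  proof (intro assoc_algebra.intro assoc_algebra_axioms.intro Q.ring_axioms m)
    fix c U V assume c: "c \<in> carrier K" and U: "U \<in> carrier ?Q" and V: "V \<in> carrier ?Q"
    obtain u where "u \<in> carrier A" "U = J +>\<^bsub>A\<^esub> u" using U car by auto
    moreover obtain v where "v \<in> carrier A" "V = J +>\<^bsub>A\<^esub> v" using V car by auto
    ultimately show "(c \<odot>\<^bsub>?Q\<^esub> U) \<otimes>\<^bsub>?Q\<^esub> V = c \<odot>\<^bsub>?Q\<^esub> (U \<otimes>\<^bsub>?Q\<^esub> V)"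
      and "U \<otimes>\<^bsub>?Q\<^esub> (c \<odot>\<^bsub>?Q\<^esub> V) = c \<odot>\<^bsub>?Q\<^esub> (U \<otimes>\<^bsub>?Q\<^esub> V)"
      using c by (simp_all add: sm mul smult_mult_left smult_mult_right)
  qed
qed

lemma free_algebra_letter: "s \<in> S \<Longrightarrow> letter s \<in> carrier (free_algebra S)"
  by (auto simp: free_algebra_simps letter_def)

lemma free_product_relations_carrier:
  assumes "\<And>i. i \<in> I \<Longrightarrow> assoc_algebra class_ring (A i)"
  shows "free_product_relations I A \<subseteq> carrier (letters_algebra I A)"
proof -
  interpret T: assoc_algebra class_ring "letters_algebra I A" by (rule free_algebra_assoc_algebra)
  have [simp]: "a \<oplus>\<^bsub>A i\<^esub> b \<in> carrier (A i)" "a \<otimes>\<^bsub>A i\<^esub> b \<in> carrier (A i)" "c \<odot>\<^bsub>A i\<^esub> a \<in> carrier (A i)"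
      "\<one>\<^bsub>A i\<^esub> \<in> carrier (A i)"
    if "i \<in> I" "a \<in> carrier (A i)" "b \<in> carrier (A i)" for i a b c
  proof -
    interpret assoc_algebra class_ring "A i" using that assms by blast
    show "a \<oplus>\<^bsub>A i\<^esub> b \<in> carrier (A i)" "a \<otimes>\<^bsub>A i\<^esub> b \<in> carrier (A i)" "c \<odot>\<^bsub>A i\<^esub> a \<in> carrier (A i)"
      "\<one>\<^bsub>A i\<^esub> \<in> carrier (A i)" using that by auto
  qed
  have [simp]: "\<one>\<^bsub>A i\<^esub> \<in> carrier (A i)" if "i \<in> I" for i
  proof -
    interpret assoc_algebra class_ring "A i" using that assms by blast
    show ?thesis by simp
  qed
  show ?thesis unfolding free_product_relations_def Let_def
    by (auto intro!: T.minus_closed T.add.m_closed T.m_closed T.smult_closed free_algebra_letter)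
qed

lemma free_product_ideal:
  assumes "\<And>i. i \<in> I \<Longrightarrow> assoc_algebra class_ring (A i)"
  shows "ideal (free_product_ideal I A) (letters_algebra I A)"
  unfolding free_product_ideal_def
  by (rule ring.genideal_ideal[OF free_algebra_ring free_product_relations_carrier[OF assms]])

theorem free_product_assoc_algebra:
  assumes "\<And>i. i \<in> I \<Longrightarrow> assoc_algebra class_ring (A i)"
  shows "assoc_algebra class_ring (free_product I A)"
  unfolding free_product_def
  by (rule quot_algebra_assoc_algebra[OF free_algebra_assoc_algebra free_product_ideal[OF assms]])

lemma ideal_diff_coset_eq:
  assumes "ideal J A" "x \<in> carrier A" "y \<in> carrier A" "x \<ominus>\<^bsub>A\<^esub> y \<in> J"
  shows "J +>\<^bsub>A\<^esub> x = J +>\<^bsub>A\<^esub> y"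
proof -
  interpret J: ideal J A by fact
  have "x = (x \<ominus>\<^bsub>A\<^esub> y) \<oplus>\<^bsub>A\<^esub> y" using assms(2,3) by algebra
  then have "x \<in> J +>\<^bsub>A\<^esub> y" using assms(4) by (auto simp: a_r_coset_def')
  then show ?thesis using J.a_repr_independence' assms(3) by blast
qed

theorem free_product_incl_hom:
  fixes A :: "'i \<Rightarrow> ('k::field, 'a) module"
  assumes A: "\<And>i. i \<in> I \<Longrightarrow> assoc_algebra class_ring (A i)" and i: "i \<in> I"
  shows "free_product_incl I A i \<in> alg_hom class_ring (A i) (free_product I A)"
proof -
  let ?T = "letters_algebra I A" and ?J = "free_product_ideal I A" and ?P = "free_product I A"
  interpret T: assoc_algebra class_ring ?T by (rule free_algebra_assoc_algebra)
  interpret Ai: assoc_algebra class_ring "A i" by (rule A) fact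
  note J = free_product_ideal[OF A, of I]
  interpret J: ideal ?J ?T by (rule J) simp
  have pr: "(\<lambda>u. ?J +>\<^bsub>?T\<^esub> u) \<in> alg_hom class_ring ?T ?P"
    unfolding free_product_def by (rule quot_algebra_proj) unfold_locales
  have rel: "free_product_relations I A \<subseteq> ?J"
    unfolding free_product_ideal_def by (rule T.genideal_self[OF free_product_relations_carrier[OF A]])
  have l: "letter (i, a) \<in> carrier ?T" if "a \<in> carrier (A i)" for a
    using that i by (intro free_algebra_letter) auto
  have c: "a \<oplus>\<^bsub>A i\<^esub> b \<in> carrier (A i)" "a \<otimes>\<^bsub>A i\<^esub> b \<in> carrier (A i)" "c \<odot>\<^bsub>A i\<^esub> a \<in> carrier (A i)"
    if "a \<in> carrier (A i)" "b \<in> carrier (A i)" for a b c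
    using that by auto
  have eq: "?J +>\<^bsub>?T\<^esub> x = ?J +>\<^bsub>?T\<^esub> y"
    if "x \<in> carrier ?T" "y \<in> carrier ?T" "x \<ominus>\<^bsub>?T\<^esub> y \<in> free_product_relations I A" for x y
    using that rel by (intro ideal_diff_coset_eq[OF J.ideal_axioms]) auto
  have 1: "?J +>\<^bsub>?T\<^esub> letter (i, a \<oplus>\<^bsub>A i\<^esub> b) = ?J +>\<^bsub>?T\<^esub> (letter (i, a) \<oplus>\<^bsub>?T\<^esub> letter (i, b))"
    if "a \<in> carrier (A i)" "b \<in> carrier (A i)" for a b
  proof (rule eq)
    show "letter (i, a \<oplus>\<^bsub>A i\<^esub> b) \<ominus>\<^bsub>?T\<^esub> (letter (i, a) \<oplus>\<^bsub>?T\<^esub> letter (i, b)) \<in> free_product_relations I A"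
      unfolding free_product_relations_def Let_def using that i by blast
  qed (simp_all add: l c that)
  have 2: "?J +>\<^bsub>?T\<^esub> letter (i, a \<otimes>\<^bsub>A i\<^esub> b) = ?J +>\<^bsub>?T\<^esub> (letter (i, a) \<otimes>\<^bsub>?T\<^esub> letter (i, b))"
    if "a \<in> carrier (A i)" "b \<in> carrier (A i)" for a b
  proof (rule eq)
    show "letter (i, a \<otimes>\<^bsub>A i\<^esub> b) \<ominus>\<^bsub>?T\<^esub> (letter (i, a) \<otimes>\<^bsub>?T\<^esub> letter (i, b)) \<in> free_product_relations I A"
      unfolding free_product_relations_def Let_def using that i by blast
  qed (simp_all add: l c that)
  have 3: "?J +>\<^bsub>?T\<^esub> letter (i, c \<odot>\<^bsub>A i\<^esub> a) = ?J +>\<^bsub>?T\<^esub> (c \<odot>\<^bsub>?T\<^esub> letter (i, a))"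
    if "a \<in> carrier (A i)" for a c
  proof (rule eq)
    show "letter (i, c \<odot>\<^bsub>A i\<^esub> a) \<ominus>\<^bsub>?T\<^esub> (c \<odot>\<^bsub>?T\<^esub> letter (i, a)) \<in> free_product_relations I A"
      unfolding free_product_relations_def Let_def using that i by blast
  qed (simp_all add: l c that)
  have 4: "?J +>\<^bsub>?T\<^esub> letter (i, \<one>\<^bsub>A i\<^esub>) = ?J +>\<^bsub>?T\<^esub> \<one>\<^bsub>?T\<^esub>"
  proof (rule eq)
    show "letter (i, \<one>\<^bsub>A i\<^esub>) \<ominus>\<^bsub>?T\<^esub> \<one>\<^bsub>?T\<^esub> \<in> free_product_relations I A"
      unfolding free_product_relations_def Let_def using i by blast
  qed (simp_all add: l c )
  show ?thesis using pr l unfolding free_product_incl_def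
    by (auto simp: alg_hom_def LinearCombinations.module_hom_def Ring.ring_hom_def 1 2 3 4)
qed

definition word_monom :: "'k::field \<Rightarrow> 's list \<Rightarrow> 's list \<Rightarrow> 'k" where
  "word_monom c u = (\<lambda>v. if v = u then c else 0)"

lemma word_monom_closed: "u \<in> lists S \<Longrightarrow> word_monom c u \<in> carrier (free_algebra S)"
  by (auto simp: free_algebra_simps word_monom_def if_distrib cong: if_cong)

lemma word_monom_mult:
  "word_monom c u \<otimes>\<^bsub>free_algebra S\<^esub> word_monom d v = word_monom (c * d) (u @ v)"
proof
  fix x
  have "(\<Sum>n\<le>length x. word_monom c u (take n x) * word_monom d v (drop n x)) =
    (\<Sum>n\<le>length x. if n = length u then (if x = u @ v then c * d else 0) else 0)"
  proof (intro sum.cong refl)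
    fix n assume "n \<in> {..length x}"
    then have iff: "take n x = u \<and> drop n x = v \<longleftrightarrow> n = length u \<and> x = u @ v"
      by (metis append_eq_conv_conj append_take_drop_id atMost_iff length_take min.absorb2)
    have "word_monom c u (take n x) * word_monom d v (drop n x) =
        (if take n x = u \<and> drop n x = v then c * d else 0)"
      by (simp add: word_monom_def)
    then show "word_monom c u (take n x) * word_monom d v (drop n x) =
        (if n = length u then (if x = u @ v then c * d else 0) else 0)"
      unfolding iff by simp
  qed
  also have "\<dots> = word_monom (c * d) (u @ v) x" by (auto simp: word_monom_def)
  finally show "(word_monom c u \<otimes>\<^bsub>free_algebra S\<^esub> word_monom d v) x = word_monom (c * d) (u @ v) x"
    by (simp add: free_algebra_simps)
qed

lemma free_algebra_induct [consumes 1, case_names zero add]: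
  assumes "f \<in> carrier (free_algebra S)"
    and zero: "P \<zero>\<^bsub>free_algebra S\<^esub>"
    and add: "\<And>c u f. \<lbrakk>u \<in> lists S; f \<in> carrier (free_algebra S); P f\<rbrakk>
      \<Longrightarrow> P (word_monom c u \<oplus>\<^bsub>free_algebra S\<^esub> f)"
  shows "P f"
proof -
  have "finite U \<Longrightarrow> U \<subseteq> lists S \<Longrightarrow> {u. f u \<noteq> 0} \<subseteq> U \<Longrightarrow> P f" for U f
  proof (induction U arbitrary: f rule: finite_induct)
    case empty
    then have "f = \<zero>\<^bsub>free_algebra S\<^esub>" by (auto simp: free_algebra_simps)
    then show ?case using zero by simp
  next
    case (insert u U)
    have sub: "{v. (f(u := 0)) v \<noteq> 0} \<subseteq> U" using insert.prems by auto
    have "P (f(u := 0))" by (rule insert.IH[OF _ sub]) (use insert.prems in auto)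
    moreover have "f(u := 0) \<in> carrier (free_algebra S)"
      unfolding free_algebra_simps(1) mem_Collect_eq
      using finite_subset[OF sub insert.hyps(1)] sub insert.prems(1) by blast
    ultimately have "P (word_monom (f u) u \<oplus>\<^bsub>free_algebra S\<^esub> f(u := 0))"
      using insert.prems(1) by (intro add) auto
    moreover have "word_monom (f u) u \<oplus>\<^bsub>free_algebra S\<^esub> f(u := 0) = f"
      by (auto simp: free_algebra_simps word_monom_def)
    ultimately show ?case by simp
  qed
  from this[of "{u. f u \<noteq> 0}" f] show ?thesis using assms(1) by (simp add: free_algebra_simps)
qed

definition word_eval :: "('r, 'b, 'z) module_scheme \<Rightarrow> ('s \<Rightarrow> 'b) \<Rightarrow> 's list \<Rightarrow> 'b" where
  "word_eval B h u = foldr (\<lambda>s x. h s \<otimes>\<^bsub>B\<^esub> x) u \<one>\<^bsub>B\<^esub>"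

definition free_eval :: "('k::field, 'b, 'z) module_scheme \<Rightarrow> ('s \<Rightarrow> 'b) \<Rightarrow> ('s list \<Rightarrow> 'k) \<Rightarrow> 'b" where
  "free_eval B h f = (\<Oplus>\<^bsub>B\<^esub>u\<in>{u. f u \<noteq> 0}. f u \<odot>\<^bsub>B\<^esub> word_eval B h u)"

context
  fixes B :: "('k::field, 'b, 'z) module_scheme" and S :: "'s set" and h :: "'s \<Rightarrow> 'b"
  assumes B: "assoc_algebra class_ring B" and h: "\<And>s. s \<in> S \<Longrightarrow> h s \<in> carrier B"
begin

interpretation B: assoc_algebra class_ring B by (rule B)
interpretation T: assoc_algebra class_ring "free_algebra S :: ('k, 's list \<Rightarrow> 'k) module"
  by (rule free_algebra_assoc_algebra)

lemma scalar_closed [simp]: "x \<in> carrier B \<Longrightarrow> c \<odot>\<^bsub>B\<^esub> x \<in> carrier B"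
  using B.smult_closed[of c x] by simp

lemma word_eval_closed [simp]: "u \<in> lists S \<Longrightarrow> word_eval B h u \<in> carrier B"
  by (induction u) (auto simp: word_eval_def h)

lemma word_eval_append:
  "u \<in> lists S \<Longrightarrow> v \<in> lists S \<Longrightarrow> word_eval B h (u @ v) = word_eval B h u \<otimes>\<^bsub>B\<^esub> word_eval B h v"
proof (induction u)
  case Nil then show ?case using word_eval_closed[of v] by (simp add: word_eval_def)
next
  case (Cons s u)
  then show ?case using word_eval_closed[of u] word_eval_closed[of v] h[of s]
    by (simp add: word_eval_def B.m_assoc)
qed

lemma free_eval_superset:
  assumes "finite U" "U \<subseteq> lists S" "{u. f u \<noteq> 0} \<subseteq> U"
  shows "free_eval B h f = (\<Oplus>\<^bsub>B\<^esub>u\<in>U. f u \<odot>\<^bsub>B\<^esub> word_eval B h u)"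
  unfolding free_eval_def
proof (rule B.add.finprod_mono_neutral_cong_left)
  show "f i \<odot>\<^bsub>B\<^esub> word_eval B h i = \<zero>\<^bsub>B\<^esub>" if "i \<in> U - {u. f u \<noteq> 0}" for i
  proof -
    have "i \<in> lists S" using that assms(2) by blast
    then show ?thesis using that B.smult_l_null[of "word_eval B h i"] by simp
  qed
qed (use assms in \<open>auto intro!: scalar_closed word_eval_closed\<close>)

lemma free_eval_closed:
  "f \<in> carrier (free_algebra S) \<Longrightarrow> free_eval B h f \<in> carrier B"
  unfolding free_eval_def by (auto simp: free_algebra_simps intro!: B.finsum_closed scalar_closed word_eval_closed)

lemma free_eval_monom: "u \<in> lists S \<Longrightarrow> free_eval B h (word_monom c u) = c \<odot>\<^bsub>B\<^esub> word_eval B h u"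
proof -
  assume u: "u \<in> lists S"
  then have "free_eval B h (word_monom c u) = (\<Oplus>\<^bsub>B\<^esub>v\<in>{u}. word_monom c u v \<odot>\<^bsub>B\<^esub> word_eval B h v)"
    by (intro free_eval_superset) (auto simp: word_monom_def)
  also have "\<dots> = c \<odot>\<^bsub>B\<^esub> word_eval B h u"
    using word_eval_closed[OF u] by (simp add: B.finsum_insert word_monom_def)
  finally show ?thesis .
qed

lemma free_eval_add:
  assumes "f \<in> carrier (free_algebra S)" "g \<in> carrier (free_algebra S)"
  shows "free_eval B h (f \<oplus>\<^bsub>free_algebra S\<^esub> g) = free_eval B h f \<oplus>\<^bsub>B\<^esub> free_eval B h g"
proof -
  let ?U = "{u. f u \<noteq> 0} \<union> {u. g u \<noteq> 0}"
  have U: "finite ?U" "?U \<subseteq> lists S" using assms by (auto simp: free_algebra_simps)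
  have "free_eval B h (f \<oplus>\<^bsub>free_algebra S\<^esub> g) = (\<Oplus>\<^bsub>B\<^esub>u\<in>?U. (f u + g u) \<odot>\<^bsub>B\<^esub> word_eval B h u)"
    unfolding free_algebra_simps(5) by (rule free_eval_superset[OF U]) auto
  also have "\<dots> = (\<Oplus>\<^bsub>B\<^esub>u\<in>?U. f u \<odot>\<^bsub>B\<^esub> word_eval B h u \<oplus>\<^bsub>B\<^esub> g u \<odot>\<^bsub>B\<^esub> word_eval B h u)"
  proof (rule B.finsum_cong')
    fix u assume "u \<in> ?U"
    then have "u \<in> lists S" using U(2) by blast
    then show "(f u + g u) \<odot>\<^bsub>B\<^esub> word_eval B h u = f u \<odot>\<^bsub>B\<^esub> word_eval B h u \<oplus>\<^bsub>B\<^esub> g u \<odot>\<^bsub>B\<^esub> word_eval B h u"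
      using B.smult_l_distr[of "f u" "g u" "word_eval B h u"] by simp
  qed (use U in \<open>auto intro!: scalar_closed word_eval_closed\<close>)
  also have "\<dots> = (\<Oplus>\<^bsub>B\<^esub>u\<in>?U. f u \<odot>\<^bsub>B\<^esub> word_eval B h u) \<oplus>\<^bsub>B\<^esub> (\<Oplus>\<^bsub>B\<^esub>u\<in>?U. g u \<odot>\<^bsub>B\<^esub> word_eval B h u)"
    by (rule B.finsum_addf) (use U in \<open>auto intro!: scalar_closed word_eval_closed\<close>)
  also have "\<dots> = free_eval B h f \<oplus>\<^bsub>B\<^esub> free_eval B h g"
    using free_eval_superset[OF U, of f] free_eval_superset[OF U, of g] by auto
  finally show ?thesis .
qed

lemma free_eval_zero: "free_eval B h \<zero>\<^bsub>free_algebra S\<^esub> = \<zero>\<^bsub>B\<^esub>"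
  by (simp add: free_eval_def free_algebra_simps)

lemma smult_word_monom: "(c::'k) \<odot>\<^bsub>free_algebra S\<^esub> word_monom d u = word_monom (c * d) u"
  by (auto simp: free_algebra_simps word_monom_def)

lemma free_eval_smult:
  assumes "f \<in> carrier (free_algebra S)"
  shows "free_eval B h (c \<odot>\<^bsub>free_algebra S\<^esub> f) = c \<odot>\<^bsub>B\<^esub> free_eval B h f"
  using assms
proof (induction f rule: free_algebra_induct)
  case zero
  have "c \<odot>\<^bsub>free_algebra S\<^esub> \<zero>\<^bsub>free_algebra S\<^esub> = \<zero>\<^bsub>free_algebra S\<^esub>" by (simp add: free_algebra_simps)
  then show ?case using B.smult_r_null[of c] by (simp add: free_eval_zero)
next
  case (add d u f)
  have m: "word_monom d u \<in> carrier (free_algebra S)" "word_monom (c * d) u \<in> carrier (free_algebra S)"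
    using add by (auto intro: word_monom_closed)
  have cf: "c \<odot>\<^bsub>free_algebra S\<^esub> f \<in> carrier (free_algebra S)" using add T.smult_closed[of c f] by simp
  have "c \<odot>\<^bsub>free_algebra S\<^esub> (word_monom d u \<oplus>\<^bsub>free_algebra S\<^esub> f) = word_monom (c * d) u \<oplus>\<^bsub>free_algebra S\<^esub> c \<odot>\<^bsub>free_algebra S\<^esub> f"
    using T.smult_r_distr[of c "word_monom d u" f] add m by (simp add: smult_word_monom)
  then have "free_eval B h (c \<odot>\<^bsub>free_algebra S\<^esub> (word_monom d u \<oplus>\<^bsub>free_algebra S\<^esub> f)) =
      (c * d) \<odot>\<^bsub>B\<^esub> word_eval B h u \<oplus>\<^bsub>B\<^esub> c \<odot>\<^bsub>B\<^esub> free_eval B h f"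
    using add m cf by (simp add: free_eval_add free_eval_monom)
  also have "\<dots> = c \<odot>\<^bsub>B\<^esub> (d \<odot>\<^bsub>B\<^esub> word_eval B h u \<oplus>\<^bsub>B\<^esub> free_eval B h f)"
    using B.smult_r_distr[of c "d \<odot>\<^bsub>B\<^esub> word_eval B h u" "free_eval B h f"]
      B.smult_assoc1[of c d "word_eval B h u"] add free_eval_closed by simp
  also have "\<dots> = c \<odot>\<^bsub>B\<^esub> free_eval B h (word_monom d u \<oplus>\<^bsub>free_algebra S\<^esub> f)"
    using add m by (simp add: free_eval_add free_eval_monom)
  finally show ?case .
qed

lemma free_eval_mult_monom:
  assumes "g \<in> carrier (free_algebra S)" "u \<in> lists S"
  shows "free_eval B h (word_monom c u \<otimes>\<^bsub>free_algebra S\<^esub> g) = (c \<odot>\<^bsub>B\<^esub> word_eval B h u) \<otimes>\<^bsub>B\<^esub> free_eval B h g"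
  using assms(1)
proof (induction g rule: free_algebra_induct)
  case zero
  then show ?case using assms(2) by (simp add: free_eval_zero word_monom_closed)
next
  case (add d v g)
  have m: "word_monom d v \<in> carrier (free_algebra S)" "word_monom c u \<in> carrier (free_algebra S)" "u @ v \<in> lists S"
    using add assms(2) by (auto intro: word_monom_closed)
  have "word_monom c u \<otimes>\<^bsub>free_algebra S\<^esub> (word_monom d v \<oplus>\<^bsub>free_algebra S\<^esub> g) =
      word_monom (c * d) (u @ v) \<oplus>\<^bsub>free_algebra S\<^esub> word_monom c u \<otimes>\<^bsub>free_algebra S\<^esub> g"
    using add m by (simp add: T.r_distr word_monom_mult)
  then have "free_eval B h (word_monom c u \<otimes>\<^bsub>free_algebra S\<^esub> (word_monom d v \<oplus>\<^bsub>free_algebra S\<^esub> g)) =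
      (c * d) \<odot>\<^bsub>B\<^esub> (word_eval B h u \<otimes>\<^bsub>B\<^esub> word_eval B h v) \<oplus>\<^bsub>B\<^esub>
      (c \<odot>\<^bsub>B\<^esub> word_eval B h u) \<otimes>\<^bsub>B\<^esub> free_eval B h g"
    using add m assms(2)
    by (simp add: free_eval_add free_eval_monom word_eval_append word_monom_closed del: append_in_lists_conv)
  also have "(c * d) \<odot>\<^bsub>B\<^esub> (word_eval B h u \<otimes>\<^bsub>B\<^esub> word_eval B h v) =
      (c \<odot>\<^bsub>B\<^esub> word_eval B h u) \<otimes>\<^bsub>B\<^esub> (d \<odot>\<^bsub>B\<^esub> word_eval B h v)"
    using B.smult_assoc1[of c d "word_eval B h u \<otimes>\<^bsub>B\<^esub> word_eval B h v"] add(1) assms(2)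
      B.smult_mult_left[of c "word_eval B h u" "d \<odot>\<^bsub>B\<^esub> word_eval B h v"]
      B.smult_mult_right[of d "word_eval B h u" "word_eval B h v"] by simp
  finally show ?case using add m assms(2)
    by (simp add: free_eval_add free_eval_monom free_eval_closed B.r_distr)
qed

lemma free_eval_mult:
  assumes "f \<in> carrier (free_algebra S)" "g \<in> carrier (free_algebra S)"
  shows "free_eval B h (f \<otimes>\<^bsub>free_algebra S\<^esub> g) = free_eval B h f \<otimes>\<^bsub>B\<^esub> free_eval B h g"
  using assms(1)
proof (induction f rule: free_algebra_induct)
  case zero
  then show ?case using assms(2) by (simp add: free_eval_zero free_eval_closed)
next
  case (add c u f)
  then show ?case using assms(2)
    by (simp add: T.l_distr free_eval_add word_monom_closed free_eval_mult_monom free_eval_monom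
        free_eval_closed B.l_distr)
qed

lemma free_eval_one: "free_eval B h \<one>\<^bsub>free_algebra S\<^esub> = \<one>\<^bsub>B\<^esub>"
proof -
  have "\<one>\<^bsub>free_algebra S\<^esub> = (word_monom 1 [] :: 's list \<Rightarrow> 'k)" by (simp add: free_algebra_simps word_monom_def)
  then show ?thesis using free_eval_monom[of "[]" 1] B.smult_one[of "\<one>\<^bsub>B\<^esub>"] by (simp add: word_eval_def)
qed

lemma free_eval_letter: "s \<in> S \<Longrightarrow> free_eval B h (letter s) = h s"
proof -
  assume s: "s \<in> S"
  have "(letter s :: 's list \<Rightarrow> 'k) = word_monom 1 [s]" by (simp add: letter_def word_monom_def)
  then show ?thesis using free_eval_monom[of "[s]" 1] B.smult_one[of "h s"] h[OF s] s by (simp add: word_eval_def)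
qed

lemma free_eval_hom: "free_eval B h \<in> alg_hom class_ring (free_algebra S) B"
  by (auto simp: alg_hom_def LinearCombinations.module_hom_def Ring.ring_hom_def
      free_eval_closed free_eval_add free_eval_mult free_eval_one free_eval_smult)

end

declare scalar_closed [simp del] word_eval_closed [simp del]

lemma free_algebra_hom_unique:
  fixes S :: "'s set" and B :: "('k::field, 'b, 'z) module_scheme"
  assumes B: "assoc_algebra class_ring B"
    and g: "g \<in> alg_hom class_ring (free_algebra S) B" and h: "h \<in> alg_hom class_ring (free_algebra S) B"
    and eq: "\<And>s. s \<in> S \<Longrightarrow> g (letter s) = h (letter s)"
    and f: "f \<in> carrier (free_algebra S)"
  shows "g f = h f"
proof -
  interpret B: assoc_algebra class_ring B by (rule B)
  let ?T = "free_algebra S :: ('k, 's list \<Rightarrow> 'k) module"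
  interpret T: assoc_algebra class_ring ?T by (rule free_algebra_assoc_algebra)
  have w: "word_monom 1 u \<in> carrier ?T" if "u \<in> lists S" for u using that by (rule word_monom_closed)
  have word: "g (word_monom 1 u) = h (word_monom 1 u)" if "u \<in> lists S" for u
    using that
  proof (induction u)
    case Nil
    have "word_monom 1 [] = \<one>\<^bsub>?T\<^esub>" by (simp add: free_algebra_simps word_monom_def)
    then show ?case using g h by (simp add: alg_hom_def Ring.ring_hom_def)
  next
    case (Cons s u)
    have l: "(word_monom 1 [s] :: 's list \<Rightarrow> 'k) = letter s" by (simp add: letter_def word_monom_def)
    have "(word_monom 1 (s # u) :: 's list \<Rightarrow> 'k) = letter s \<otimes>\<^bsub>?T\<^esub> word_monom 1 u"
      using word_monom_mult[where c = "1::'k" and u = "[s]" and S = S and d = 1 and v = u] l by simp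
    moreover have "letter s \<in> carrier ?T" using Cons by (intro free_algebra_letter) auto
    ultimately show ?case using g h w[of u] Cons eq[of s] by (simp add: alg_hom_def Ring.ring_hom_def)
  qed
  have mon: "g (word_monom c u) = h (word_monom c u)" if "u \<in> lists S" for c u
  proof -
    have "word_monom c u = c \<odot>\<^bsub>?T\<^esub> word_monom 1 u" by (auto simp: free_algebra_simps word_monom_def)
    then show ?thesis using g h w[OF that] word[OF that]
      by (simp add: alg_hom_def LinearCombinations.module_hom_def)
  qed
  from f show ?thesis
  proof (induction f rule: free_algebra_induct)
    case zero
    have "\<zero>\<^bsub>?T\<^esub> = word_monom 0 []" by (auto simp: free_algebra_simps word_monom_def)
    then show ?case using mon[of "[]" 0] by simp
  next
    case (add c u f)
    then show ?case using g h mon[of u c] word_monom_closed[of u S c]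
      by (simp add: alg_hom_def LinearCombinations.module_hom_def)
  qed
qed

text \<open>The universal property holds for test algebras \<open>B\<close> over an arbitrary type.\<close>

theorem free_product_universal:
  fixes A :: "'i \<Rightarrow> ('k::field, 'a) module" and B :: "('k, 'b, 'z) module_scheme"
  assumes A: "\<And>i. i \<in> I \<Longrightarrow> assoc_algebra class_ring (A i)" and B: "assoc_algebra class_ring B"
    and h: "\<And>i. i \<in> I \<Longrightarrow> h i \<in> alg_hom class_ring (A i) B"
  shows "\<exists>!H. H \<in> alg_hom class_ring (free_product I A) B \<inter> extensional (carrier (free_product I A)) \<and>
    (\<forall>i\<in>I. \<forall>a\<in>carrier (A i). H (free_product_incl I A i a) = h i a)"
proof -
  let ?T = "letters_algebra I A" and ?J = "free_product_ideal I A" and ?P = "free_product I A"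
  let ?S = "SIGMA i:I. carrier (A i)"
  interpret B: assoc_algebra class_ring B by (rule B)
  interpret T: assoc_algebra class_ring ?T by (rule free_algebra_assoc_algebra)
  interpret P: assoc_algebra class_ring ?P by (rule free_product_assoc_algebra[OF A])
  note J = free_product_ideal[OF A, of I]
  interpret J: ideal ?J ?T by (rule J) simp
  let ?pi = "\<lambda>u. ?J +>\<^bsub>?T\<^esub> u"
  have pr: "?pi \<in> alg_hom class_ring ?T ?P"
    unfolding free_product_def by (rule quot_algebra_proj) unfold_locales
  define h' where "h' = (\<lambda>(i, a). h i a)"
  have hc: "h' s \<in> carrier B" if "s \<in> ?S" for s
    using that h by (auto simp: h'_def alg_hom_def Ring.ring_hom_def)
  define ev where "ev = free_eval B h'"
  have evh: "ev \<in> alg_hom class_ring ?T B" unfolding ev_def using B hc by (rule free_eval_hom)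
  have evl: "ev (letter (i, a)) = h i a" if "i \<in> I" "a \<in> carrier (A i)" for i a
    using free_eval_letter[OF B hc, where s = "(i, a)"] that by (auto simp: ev_def h'_def)
  interpret E: ring_hom_ring ?T B ev
    using evh by (intro ring_hom_ringI2) (auto simp: alg_hom_def T.ring_axioms B.ring_axioms)
  have l: "letter (i, a) \<in> carrier ?T" if "i \<in> I" "a \<in> carrier (A i)" for i a
    using that by (intro free_algebra_letter) auto
  have evs: "ev (c \<odot>\<^bsub>?T\<^esub> x) = c \<odot>\<^bsub>B\<^esub> ev x" if "x \<in> carrier ?T" for c x
    using evh that by (simp add: alg_hom_def LinearCombinations.module_hom_def)
  have "free_product_relations I A \<subseteq> a_kernel ?T B ev"
  proof
    fix x assume x: "x \<in> free_product_relations I A"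
    have "free_product_relations I A \<subseteq> carrier ?T" by (rule free_product_relations_carrier) (rule A)
    with x have xc: "x \<in> carrier ?T" by blast
    have diff: "ev (y \<ominus>\<^bsub>?T\<^esub> z) = \<zero>\<^bsub>B\<^esub>" if "y \<in> carrier ?T" "z \<in> carrier ?T" "ev y = ev z" for y z
      using that by (simp add: T.minus_eq B.r_neg)
    consider
        (add) i a b where "i \<in> I" "a \<in> carrier (A i)" "b \<in> carrier (A i)"
          "x = letter (i, a \<oplus>\<^bsub>A i\<^esub> b) \<ominus>\<^bsub>?T\<^esub> (letter (i, a) \<oplus>\<^bsub>?T\<^esub> letter (i, b))"
      | (smult) i c a where "i \<in> I" "a \<in> carrier (A i)"
          "x = letter (i, c \<odot>\<^bsub>A i\<^esub> a) \<ominus>\<^bsub>?T\<^esub> c \<odot>\<^bsub>?T\<^esub> letter (i, a)"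
      | (mult) i a b where "i \<in> I" "a \<in> carrier (A i)" "b \<in> carrier (A i)"
          "x = letter (i, a \<otimes>\<^bsub>A i\<^esub> b) \<ominus>\<^bsub>?T\<^esub> letter (i, a) \<otimes>\<^bsub>?T\<^esub> letter (i, b)"
      | (one) i where "i \<in> I" "x = letter (i, \<one>\<^bsub>A i\<^esub>) \<ominus>\<^bsub>?T\<^esub> \<one>\<^bsub>?T\<^esub>"
      using x unfolding free_product_relations_def Let_def by blast
    then have "ev x = \<zero>\<^bsub>B\<^esub>"
    proof cases
      case add
      interpret Ai: assoc_algebra class_ring "A i" using add(1) by (rule A)
      show ?thesis unfolding add(4)
        by (rule diff) (use add h[of i] in \<open>auto simp: l evl alg_hom_def Ring.ring_hom_def\<close>)
    next
      case smult
      interpret Ai: assoc_algebra class_ring "A i" using smult(1) by (rule A)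
      have c: "c \<odot>\<^bsub>A i\<^esub> a \<in> carrier (A i)" using Ai.smult_closed[of c a] smult by simp
      have c': "c \<odot>\<^bsub>?T\<^esub> letter (i, a) \<in> carrier ?T" using T.smult_closed[of c "letter (i, a)"] smult l by simp
      have "h i (c \<odot>\<^bsub>A i\<^esub> a) = c \<odot>\<^bsub>B\<^esub> h i a"
        using h[of i] smult by (simp add: alg_hom_def LinearCombinations.module_hom_def)
      then show ?thesis unfolding smult(3)
        by (intro diff) (use smult c c' in \<open>simp_all add: l evl evs\<close>)
    next
      case mult
      interpret Ai: assoc_algebra class_ring "A i" using mult(1) by (rule A)
      show ?thesis unfolding mult(4)
        by (rule diff) (use mult h[of i] in \<open>auto simp: l evl alg_hom_def Ring.ring_hom_def\<close>)
    next
      case one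
      interpret Ai: assoc_algebra class_ring "A i" using one(1) by (rule A)
      show ?thesis unfolding one(2)
        by (rule diff) (use one h[of i] in \<open>auto simp: l evl alg_hom_def Ring.ring_hom_def\<close>)
    qed
    then show "x \<in> a_kernel ?T B ev" using xc unfolding a_kernel_def' by blast
  qed
  then have ker: "?J \<subseteq> a_kernel ?T B ev"
    unfolding free_product_ideal_def by (rule T.genideal_minimal[OF E.kernel_is_ideal])
  have ev_coset: "ev v = ev u" if v: "v \<in> ?pi u" and u: "u \<in> carrier ?T" for u v
  proof -
    obtain j where j: "j \<in> ?J" "v = j \<oplus>\<^bsub>?T\<^esub> u" using v by (auto simp: a_r_coset_def')
    then have "ev j = \<zero>\<^bsub>B\<^esub>" "j \<in> carrier ?T" using ker unfolding a_kernel_def' by blast+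
    then show ?thesis using j u by simp
  qed
  define H where "H = (\<lambda>U\<in>carrier ?P. ev (SOME u. u \<in> U))"
  have pc: "?pi u \<in> carrier ?P" if "u \<in> carrier ?T" for u
    using pr that by (auto simp: alg_hom_def Ring.ring_hom_def)
  have Hpi: "H (?pi u) = ev u" if u: "u \<in> carrier ?T" for u
  proof -
    have "u \<in> ?pi u" using u by (rule J.a_rcos_self)
    then have "(SOME v. v \<in> ?pi u) \<in> ?pi u" by (rule someI[of "\<lambda>v. v \<in> ?pi u"])
    then show ?thesis using ev_coset[OF _ u] pc[OF u] by (simp add: H_def)
  qed
  have cos: "\<exists>u\<in>carrier ?T. U = ?pi u" if "U \<in> carrier ?P" for U
    using that unfolding free_product_def by (blast elim: quot_algebra_coset)
  have p: "?pi u \<oplus>\<^bsub>?P\<^esub> ?pi v = ?pi (u \<oplus>\<^bsub>?T\<^esub> v)" "?pi u \<otimes>\<^bsub>?P\<^esub> ?pi v = ?pi (u \<otimes>\<^bsub>?T\<^esub> v)"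
      "c \<odot>\<^bsub>?P\<^esub> ?pi u = ?pi (c \<odot>\<^bsub>?T\<^esub> u)" if "u \<in> carrier ?T" "v \<in> carrier ?T" for u v c
    using pr that by (auto simp: alg_hom_def Ring.ring_hom_def LinearCombinations.module_hom_def)
  have p1: "\<one>\<^bsub>?P\<^esub> = ?pi \<one>\<^bsub>?T\<^esub>" using pr by (auto simp: alg_hom_def Ring.ring_hom_def)
  have Tsm: "c \<odot>\<^bsub>?T\<^esub> u \<in> carrier ?T" if "u \<in> carrier ?T" for c u
    using T.smult_closed[of c u] that by simp
  have Hc: "H U \<in> carrier B" if "U \<in> carrier ?P" for U using cos[OF that] Hpi by auto
  have H2: "H (U \<oplus>\<^bsub>?P\<^esub> V) = H U \<oplus>\<^bsub>B\<^esub> H V" "H (U \<otimes>\<^bsub>?P\<^esub> V) = H U \<otimes>\<^bsub>B\<^esub> H V"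
    if "U \<in> carrier ?P" "V \<in> carrier ?P" for U V
  proof -
    obtain u v where uv: "u \<in> carrier ?T" "v \<in> carrier ?T" "U = ?pi u" "V = ?pi v"
      using cos[OF \<open>U \<in> carrier ?P\<close>] cos[OF \<open>V \<in> carrier ?P\<close>] by blast
    show "H (U \<oplus>\<^bsub>?P\<^esub> V) = H U \<oplus>\<^bsub>B\<^esub> H V" "H (U \<otimes>\<^bsub>?P\<^esub> V) = H U \<otimes>\<^bsub>B\<^esub> H V"
      unfolding uv(3,4) using uv(1,2) by (simp_all add: p Hpi)
  qed
  have H3: "H (c \<odot>\<^bsub>?P\<^esub> U) = c \<odot>\<^bsub>B\<^esub> H U" if "U \<in> carrier ?P" for c U
  proof -
    obtain u where u: "u \<in> carrier ?T" "U = ?pi u" using cos[OF \<open>U \<in> carrier ?P\<close>] by blast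
    show ?thesis unfolding u(2) using u(1) p(3)[OF u(1) u(1)] by (simp add: Hpi Tsm evs)
  qed
  have H1: "H \<one>\<^bsub>?P\<^esub> = \<one>\<^bsub>B\<^esub>" unfolding p1 by (simp add: Hpi)
  have Hhom: "H \<in> alg_hom class_ring ?P B"
    unfolding alg_hom_def Ring.ring_hom_def LinearCombinations.module_hom_def
    using Hc H1 H2 H3 by auto
  show ?thesis
  proof (rule ex1I[of _ H], intro conjI IntI ballI Hhom)
    show "H \<in> extensional (carrier ?P)" unfolding H_def by simp
    show "H (free_product_incl I A i a) = h i a" if "i \<in> I" "a \<in> carrier (A i)" for i a
      unfolding free_product_incl_def using that by (simp add: Hpi l evl)
  next
    fix G assume G: "G \<in> alg_hom class_ring ?P B \<inter> extensional (carrier ?P) \<and>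
      (\<forall>i\<in>I. \<forall>a\<in>carrier (A i). G (free_product_incl I A i a) = h i a)"
    have Gpi: "(\<lambda>u. G (?pi u)) \<in> alg_hom class_ring ?T B"
      using G pc p1 unfolding alg_hom_def Ring.ring_hom_def LinearCombinations.module_hom_def
      by (auto simp flip: p)
    have eq: "G (?pi u) = ev u" if "u \<in> carrier ?T" for u
    proof (rule free_algebra_hom_unique[OF B Gpi evh _ that])
      fix s assume "s \<in> ?S"
      then obtain i a where s: "s = (i, a)" "i \<in> I" "a \<in> carrier (A i)" by blast
      then show "G (?pi (letter s)) = ev (letter s)"
        using G by (simp add: evl free_product_incl_def)
    qed
    show "G = H"
    proof (rule extensionalityI[of _ "carrier ?P"])
      show "G \<in> extensional (carrier ?P)" using G by blast
      show "H \<in> extensional (carrier ?P)" unfolding H_def by simp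
      fix U assume "U \<in> carrier ?P"
      then obtain u where "u \<in> carrier ?T" "U = ?pi u" using cos by blast
      then show "G U = H U" by (simp add: eq Hpi)
    qed
  qed
qed

section \<open>Quiver representations\<close>

text \<open>A quiver is a \<^typ>\<open>('q, 'e) pre_digraph\<close>; an arc \<open>\<alpha>\<close> points from \<open>tail Q \<alpha>\<close> to
  \<open>head Q \<alpha>\<close>.\<close>

record ('k, 'q, 'e, 'v) quiver_rep =
  space :: "'q \<Rightarrow> ('k, 'v) module"
  amap :: "'e \<Rightarrow> 'v \<Rightarrow> 'v"

definition rep_quiver :: "('q, 'e) pre_digraph \<Rightarrow>
    (('k::field, 'q, 'e, 'v) quiver_rep, 'q \<Rightarrow> 'v \<Rightarrow> 'v) preadditive_category" where
  "rep_quiver Q =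
    \<lparr>Obj = {X. (\<forall>v\<in>verts Q. fd_space (space X v)) \<and>
       (\<forall>\<alpha>\<in>arcs Q. amap X \<alpha> \<in> lin_maps class_ring (space X (tail Q \<alpha>)) (space X (head Q \<alpha>)))},
     Hom = (\<lambda>X Y. {f \<in> extensional (verts Q).
       (\<forall>v\<in>verts Q. f v \<in> lin_maps class_ring (space X v) (space Y v)) \<and>
       (\<forall>\<alpha>\<in>arcs Q. \<forall>x\<in>carrier (space X (tail Q \<alpha>)).
          f (head Q \<alpha>) (amap X \<alpha> x) = amap Y \<alpha> (f (tail Q \<alpha>) x))}),
     Idt = (\<lambda>X. \<lambda>v\<in>verts Q. \<lambda>x\<in>carrier (space X v). x),
     Comp = (\<lambda>X Y Z g f. \<lambda>v\<in>verts Q. compose (carrier (space X v)) (g v) (f v)),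
     Hom_add = (\<lambda>X Y f g. \<lambda>v\<in>verts Q. \<lambda>x\<in>carrier (space X v). f v x \<oplus>\<^bsub>space Y v\<^esub> g v x),
     Hom_zero = (\<lambda>X Y. \<lambda>v\<in>verts Q. \<lambda>x\<in>carrier (space X v). \<zero>\<^bsub>space Y v\<^esub>)\<rparr>"

section \<open>The quiver and the functor attached to a free product of semisimple algebras\<close>

text \<open>All indices are counted from 0, in agreement with the matrix library: \<open>i < m\<close>, \<open>j < r i\<close>,
  \<open>k < w i j\<close>. In particular \<open>e\<^sub>i\<^sub>j\<^sup>1\<^sup>1\<close> is \<open>e i j 0 0\<close>.\<close>

datatype vertex = Sink | Source nat nat

definition quiver :: "nat \<Rightarrow> (nat \<Rightarrow> nat) \<Rightarrow> (nat \<Rightarrow> nat \<Rightarrow> nat) \<Rightarrow>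
    (vertex, nat \<times> nat \<times> nat) pre_digraph" where
  "quiver m r w =
    \<lparr>verts = insert Sink {Source i j | i j. i < m \<and> j < r i},
     arcs = {(i, j, k). i < m \<and> j < r i \<and> k < w i j},
     tail = (\<lambda>(i, j, k). Source i j),
     head = (\<lambda>(i, j, k). Sink)\<rparr>"

definition Psi_dom :: "(nat \<Rightarrow> nat) \<Rightarrow> (nat \<Rightarrow> nat \<Rightarrow> nat) \<Rightarrow>
    ('k::field, vertex, nat \<times> nat \<times> nat, 'v) quiver_rep \<Rightarrow> nat \<Rightarrow>
    ('k, nat \<times> nat \<Rightarrow> 'v) module" where
  "Psi_dom r w X i =
    dprod (SIGMA j:{..<r i}. {..<w i j}) (\<lambda>(j, k). space X (Source i j))"

definition Psi :: "(nat \<Rightarrow> nat) \<Rightarrow> (nat \<Rightarrow> nat \<Rightarrow> nat) \<Rightarrow>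
    ('k::field, vertex, nat \<times> nat \<times> nat, 'v) quiver_rep \<Rightarrow> nat \<Rightarrow>
    (nat \<times> nat \<Rightarrow> 'v) \<Rightarrow> 'v" where
  "Psi r w X i = (\<lambda>y\<in>carrier (Psi_dom r w X i).
    \<Oplus>\<^bsub>space X Sink\<^esub>jk\<in>(SIGMA j:{..<r i}. {..<w i j}). amap X (i, jk) (y jk))"

definition balanced :: "nat \<Rightarrow> (nat \<Rightarrow> nat) \<Rightarrow> (nat \<Rightarrow> nat \<Rightarrow> nat) \<Rightarrow>
    ('k::field, vertex, nat \<times> nat \<times> nat, 'v) quiver_rep \<Rightarrow> bool" where
  "balanced m r w X \<longleftrightarrow>
    (\<forall>i<m. invertible_lin_map class_ring (Psi_dom r w X i) (space X Sink) (Psi r w X i))"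

definition balanced_reps :: "nat \<Rightarrow> (nat \<Rightarrow> nat) \<Rightarrow> (nat \<Rightarrow> nat \<Rightarrow> nat) \<Rightarrow>
    (('k::field, vertex, nat \<times> nat \<times> nat, 'v) quiver_rep, vertex \<Rightarrow> 'v \<Rightarrow> 'v)
      preadditive_category" where
  "balanced_reps m r w = full_subcategory (rep_quiver (quiver m r w)) (balanced m r w)"

text \<open>The algebra \<open>Mat\<^sub>d(\<bbbK>)\<close> is \<^term>\<open>module_mat TYPE('k::field) d d\<close>.\<close>

definition mat_algebras :: "nat \<Rightarrow> (nat \<Rightarrow> nat) \<Rightarrow> ('k::field, nat \<Rightarrow> 'k mat) module" where
  "mat_algebras s d = dprod {..<s} (\<lambda>j. module_mat TYPE('k) (d j) (d j))"

definition mat_unit :: "nat \<Rightarrow> (nat \<Rightarrow> nat) \<Rightarrow> nat \<Rightarrow> nat \<Rightarrow> nat \<Rightarrow> (nat \<Rightarrow> 'k::field mat)" where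
  "mat_unit s d j p q = (\<lambda>j'\<in>{..<s}.
    if j' = j then mat (d j) (d j) (\<lambda>(a, b). if a = p \<and> b = q then 1 else 0)
    else 0\<^sub>m (d j') (d j'))"

text \<open>The image in the free product of the matrix unit of \<open>A i\<close>, where \<open>\<phi> i\<close> identifies \<open>A i\<close> with
  a product of matrix algebras.\<close>

definition unit_elt :: "nat \<Rightarrow> (nat \<Rightarrow> nat) \<Rightarrow> (nat \<Rightarrow> nat \<Rightarrow> nat) \<Rightarrow>
    (nat \<Rightarrow> ('k::field, 'a) module) \<Rightarrow> (nat \<Rightarrow> 'a \<Rightarrow> nat \<Rightarrow> 'k mat) \<Rightarrow>
    nat \<Rightarrow> nat \<Rightarrow> nat \<Rightarrow> nat \<Rightarrow> ((nat \<times> 'a) list \<Rightarrow> 'k) set" where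
  "unit_elt m r w A \<phi> i j p q =
    free_product_incl {..<m} A i
      (inv_into (carrier (A i)) (\<phi> i) (mat_unit (r i) (w i) j p q))"

definition functor_F :: "nat \<Rightarrow> (nat \<Rightarrow> nat) \<Rightarrow> (nat \<Rightarrow> nat \<Rightarrow> nat) \<Rightarrow>
    (nat \<Rightarrow> ('k::field, 'a) module) \<Rightarrow> (nat \<Rightarrow> 'a \<Rightarrow> nat \<Rightarrow> 'k mat) \<Rightarrow>
    ((((nat \<times> 'a) list \<Rightarrow> 'k) set, 'v) module, 'v \<Rightarrow> 'v,
     ('k, vertex, nat \<times> nat \<times> nat, 'v) quiver_rep, vertex \<Rightarrow> 'v \<Rightarrow> 'v) functor_data" where
  "functor_F m r w A \<phi> =
    (let P = free_product {..<m} A;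
         e = unit_elt m r w A \<phi>;
         sp = (\<lambda>M v. case v of
             Sink \<Rightarrow> underlying_space P M
           | Source i j \<Rightarrow> (underlying_space P M)
               \<lparr>carrier := (\<lambda>x. e i j 0 0 \<odot>\<^bsub>M\<^esub> x) ` carrier M\<rparr>)
     in \<lparr>fobj = (\<lambda>M. \<lparr>space = sp M,
           amap = (\<lambda>(i, j, k). \<lambda>x\<in>carrier (sp M (Source i j)). e i j k 0 \<odot>\<^bsub>M\<^esub> x)\<rparr>),
         farr = (\<lambda>M N f. \<lambda>v\<in>verts (quiver m r w). restrict f (carrier (sp M v)))\<rparr>)"

end

theory Submission
  imports Defs
begin

text \<open>A module \<open>M\<close> over the free product is a vector space with one action of every factor \<open>A i\<close>, and
  the actions of different factors are unrelated. An action of a product of matrix algebras on \<open>M\<close>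
  amounts to a decomposition of \<open>M\<close> into blocks, \<open>w i j\<close> of them for each \<open>j\<close>, together with
  identifications of the blocks with the same \<open>j\<close>: the matrix unit \<open>e i j k 0\<close> carries the first
  block \<open>e i j 0 0 M\<close> isomorphically onto the block \<open>e i j k k M\<close>, and \<open>M\<close> is the direct sum of all
  blocks because the diagonal units sum to \<open>1\<close>. These data are a balanced representation: the first
  blocks sit at the sources, \<open>M\<close> at the sink, the arrows are the maps \<open>e i j k 0\<close>, and
  invertibility of \<open>Psi\<close> says that the images of the arrows with first index \<open>i\<close> decompose \<open>M\<close>.

  The equivalence is obtained from full faithfulness and essential surjectivity of \<open>F\<close>. A morphism
  \<open>F M \<rightarrow> F N\<close> is determined by its component \<open>f\<close> at the sink. That component commutes with the maps
  \<open>e i j k 0\<close> on first blocks, hence, by the decomposition into blocks, with every matrix unit, and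
  the matrix units generate the free product (\<open>P_induct\<close>), so \<open>f\<close> is a module homomorphism
  (\<open>F_full\<close>). Conversely, on a balanced representation \<open>X\<close> the algebra \<open>A i\<close> acts on
  the domain of \<open>Psi r w X i\<close> by matrices (\<open>mat_act_hom\<close>), hence on \<open>space X Sink\<close> through \<open>Psi\<close>; the
  universal property glues the actions of all factors to a module whose image under \<open>F\<close> is
  isomorphic to \<open>X\<close> (\<open>balanced_isomorphic_F\<close>).

  That the balanced representations form an abelian category then follows from the corresponding
  fact for modules (\<open>rep_algebra_abelian\<close>), since an additive equivalence transports every axiom
  (\<open>abelian_category_transfer\<close>). The carriers of all modules are subsets of one type, into which the
  field embeds. An infinite field contains copies of all its finite powers, so direct sums of modules
  can be moved back into the type; a quotient lives on a set of representatives.\<close>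

section \<open>Fully faithful functors and equivalences\<close>

definition fully_faithful where
  "fully_faithful C D F \<longleftrightarrow> (\<forall>X\<in>Obj C. \<forall>Y\<in>Obj C.
    bij_betw (farr F X Y) (Hom C X Y) (Hom D (fobj F X) (fobj F Y)))"

definition essentially_surjective where
  "essentially_surjective C D F \<longleftrightarrow> (\<forall>Y\<in>Obj D. \<exists>X\<in>Obj C. \<exists>s. is_iso D (fobj F X) Y s)"

lemma fully_faithful_inj:
  assumes "fully_faithful C D F" "X \<in> Obj C" "Y \<in> Obj C" "f \<in> Hom C X Y" "g \<in> Hom C X Y"
    "farr F X Y f = farr F X Y g"
  shows "f = g"
  using assms by (auto simp: fully_faithful_def bij_betw_def dest: inj_onD)

lemma fully_faithful_surj:
  assumes "fully_faithful C D F" "X \<in> Obj C" "Y \<in> Obj C" "h \<in> Hom D (fobj F X) (fobj F Y)"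
  obtains f where "f \<in> Hom C X Y" "farr F X Y f = h"
proof -
  have "h \<in> farr F X Y ` Hom C X Y" using assms by (simp add: fully_faithful_def bij_betw_def)
  then show ?thesis using that by blast
qed

lemma is_functorD:
  assumes "is_functor C D F"
  shows "category C" "category D" "X \<in> Obj C \<Longrightarrow> fobj F X \<in> Obj D"
    "\<lbrakk>X \<in> Obj C; Y \<in> Obj C; f \<in> Hom C X Y\<rbrakk> \<Longrightarrow> farr F X Y f \<in> Hom D (fobj F X) (fobj F Y)"
    "X \<in> Obj C \<Longrightarrow> farr F X X (Idt C X) = Idt D (fobj F X)"
    "\<lbrakk>X \<in> Obj C; Y \<in> Obj C; Z \<in> Obj C; f \<in> Hom C X Y; g \<in> Hom C Y Z\<rbrakk> \<Longrightarrow>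
      farr F X Z (Comp C X Y Z g f) =
      Comp D (fobj F X) (fobj F Y) (fobj F Z) (farr F Y Z g) (farr F X Y f)"
  using assms by (simp_all add: is_functor_def)

lemma (in category) is_isoE:
  assumes "is_iso C X Y f"
  obtains g where "f \<in> Hom C X Y" "g \<in> Hom C Y X" "Comp C X Y X g f = Idt C X"
    "Comp C Y X Y f g = Idt C Y"
  using assms by (auto simp: is_iso_def)

lemma (in category) inverse_cancel:
  assumes "X \<in> Obj C" "Y \<in> Obj C" "W \<in> Obj C" "f \<in> Hom C X Y" "g \<in> Hom C Y X"
    "Comp C X Y X g f = Idt C X" "x \<in> Hom C W X"
  shows "Comp C W Y X g (Comp C W X Y f x) = x"
  using assms by (simp add: Comp_assoc Comp_Idt_left)

lemma (in category) iso_cancel_left: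
  assumes "X \<in> Obj C" "Y \<in> Obj C" "W \<in> Obj C" "is_iso C X Y f" "x \<in> Hom C W X" "y \<in> Hom C W X"
    "Comp C W X Y f x = Comp C W X Y f y"
  shows "x = y"
  using assms(4)
proof (rule is_isoE)
  fix g assume "f \<in> Hom C X Y" "g \<in> Hom C Y X" "Comp C X Y X g f = Idt C X"
  note cancel = inverse_cancel[OF assms(1-3) this]
  show ?thesis using cancel[OF assms(5)] cancel[OF assms(6)] unfolding assms(7) by (rule trans[OF sym])
qed

lemma is_iso_inverse:
  assumes "is_iso C X Y f"
  obtains g where "is_iso C Y X g" "Comp C X Y X g f = Idt C X" "Comp C Y X Y f g = Idt C Y"
  using assms by (auto simp: is_iso_def)

text \<open>Conjugation by a chosen family of isomorphisms \<open>s Y : F (g Y) \<rightarrow> Y\<close>, with inverses \<open>t Y\<close>, turns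
  an arrow \<open>f : Y \<rightarrow> Y'\<close> into an arrow \<open>c Y Y' f\<close> between images of \<open>F\<close>, which full faithfulness
  lifts to \<open>G f\<close>. Every identity required of \<open>G\<close> is checked after applying \<open>F\<close>, where it becomes a
  cancellation of \<open>s\<close> against \<open>t\<close>. That \<open>G\<close> is itself fully faithful and essentially surjective
  is what transports properties from the source of \<open>F\<close> to its target.\<close>

theorem quasi_inverse_exists:
  assumes F: "is_functor C D F" and ff: "fully_faithful C D F" and es: "essentially_surjective C D F"
  shows "\<exists>G \<eta> \<epsilon>. is_functor D C G \<and> fully_faithful D C G \<and> essentially_surjective D C G \<and>
    natural_iso C C id_functor (comp_functor G F) \<eta> \<and>
    natural_iso D D (comp_functor F G) id_functor \<epsilon>"
proof -
  interpret C: category C by (rule is_functorD(1)[OF F])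
  interpret D: category D by (rule is_functorD(2)[OF F])
  note Fs = is_functorD(3-)[OF F]
  have "\<forall>Y\<in>Obj D. \<exists>p. fst p \<in> Obj C \<and> is_iso D (fobj F (fst p)) Y (snd p)"
    using es by (fastforce simp: essentially_surjective_def)
  then obtain p where p: "\<And>Y. Y \<in> Obj D \<Longrightarrow> fst (p Y) \<in> Obj C \<and> is_iso D (fobj F (fst (p Y))) Y (snd (p Y))"
    using bchoice[of "Obj D"] by metis
  define g where "g Y = fst (p Y)" for Y
  define s where "s Y = snd (p Y)" for Y
  define g' where "g' Y = fobj F (g Y)" for Y
  have g [simp]: "g Y \<in> Obj C" "g' Y \<in> Obj D" if "Y \<in> Obj D" for Y
    using p[OF that] Fs(1) by (auto simp: g_def g'_def)
  have s: "is_iso D (g' Y) Y (s Y)" if "Y \<in> Obj D" for Y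
    using p[OF that] by (auto simp: g_def s_def g'_def)
  have "\<forall>Y\<in>Obj D. \<exists>t. t \<in> Hom D Y (g' Y) \<and> Comp D (g' Y) Y (g' Y) t (s Y) = Idt D (g' Y) \<and>
      Comp D Y (g' Y) Y (s Y) t = Idt D Y"
    using s by (fastforce simp: is_iso_def)
  then obtain t where t [simp]: "\<And>Y. Y \<in> Obj D \<Longrightarrow> t Y \<in> Hom D Y (g' Y)"
      and ts: "\<And>Y. Y \<in> Obj D \<Longrightarrow> Comp D (g' Y) Y (g' Y) (t Y) (s Y) = Idt D (g' Y)"
      and st: "\<And>Y. Y \<in> Obj D \<Longrightarrow> Comp D Y (g' Y) Y (s Y) (t Y) = Idt D Y"
    using bchoice[of "Obj D"] by metis
  have sH [simp]: "s Y \<in> Hom D (g' Y) Y" if "Y \<in> Obj D" for Y using s[OF that] by (simp add: is_iso_def)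
  have ts': "Comp D W Y (g' Y) (t Y) (Comp D W (g' Y) Y (s Y) x) = x"
    if "Y \<in> Obj D" "W \<in> Obj D" "x \<in> Hom D W (g' Y)" for Y W x
    using that by (intro D.inverse_cancel) (auto simp: ts)
  have st': "Comp D W (g' Y) Y (s Y) (Comp D W Y (g' Y) (t Y) x) = x"
    if "Y \<in> Obj D" "W \<in> Obj D" "x \<in> Hom D W Y" for Y W x
    using that by (intro D.inverse_cancel) (auto simp: st)
  note Dsimp = D.Comp_in D.Comp_assoc[symmetric] D.Comp_Idt_left D.Comp_Idt_right ts st ts' st'
  define c where "c Y Y' f = Comp D (g' Y) Y' (g' Y') (t Y') (Comp D (g' Y) Y Y' f (s Y))" for Y Y' f
  have c [simp]: "c Y Y' f \<in> Hom D (g' Y) (g' Y')" if "Y \<in> Obj D" "Y' \<in> Obj D" "f \<in> Hom D Y Y'" for Y Y' f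
    using that by (simp add: c_def D.Comp_in)
  define G where "G = \<lparr>fobj = g, farr = \<lambda>Y Y' f. inv_into (Hom C (g Y) (g Y')) (farr F (g Y) (g Y')) (c Y Y' f)\<rparr>"
  have Go [simp]: "fobj G = g" by (simp add: G_def)
  have lift: "inv_into (Hom C X Y) (farr F X Y) h \<in> Hom C X Y"
      "farr F X Y (inv_into (Hom C X Y) (farr F X Y) h) = h"
    if "X \<in> Obj C" "Y \<in> Obj C" "h \<in> Hom D (fobj F X) (fobj F Y)" for X Y h
    using that ff by (auto simp: fully_faithful_def bij_betw_def intro: inv_into_into f_inv_into_f)
  have G [simp]: "farr G Y Y' f \<in> Hom C (g Y) (g Y')" and FG: "farr F (g Y) (g Y') (farr G Y Y' f) = c Y Y' f"
    if "Y \<in> Obj D" "Y' \<in> Obj D" "f \<in> Hom D Y Y'" for Y Y' f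
    using that lift[of "g Y" "g Y'" "c Y Y' f"] by (auto simp: G_def g'_def[symmetric])
  note F_inj = fully_faithful_inj[OF ff]
  have funG: "is_functor D C G"
    unfolding is_functor_def
  proof (intro conjI ballI C.category_axioms D.category_axioms)
    fix X assume X: "X \<in> Obj D"
    show "farr G X X (Idt D X) = Idt C (fobj G X)"
      by (rule F_inj[of "g X" "g X"])
        (use X in \<open>simp_all add: FG D.Idt_in C.Idt_in Fs(3) c_def g'_def[symmetric] Dsimp\<close>)
  next
    fix X Y Z f h assume a: "X \<in> Obj D" "Y \<in> Obj D" "Z \<in> Obj D" "f \<in> Hom D X Y" "h \<in> Hom D Y Z"
    show "farr G X Z (Comp D X Y Z h f) =
        Comp C (fobj G X) (fobj G Y) (fobj G Z) (farr G Y Z h) (farr G X Y f)"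
      by (rule F_inj[of "g X" "g Z"])
        (use a in \<open>simp_all add: FG C.Comp_in Fs(4) c_def g'_def[symmetric] Dsimp\<close>)
  qed (simp_all)
  have ffG: "fully_faithful D C G"
    unfolding fully_faithful_def
  proof (intro ballI)
    fix Y Y' assume Y: "Y \<in> Obj D" "Y' \<in> Obj D"
    show "bij_betw (farr G Y Y') (Hom D Y Y') (Hom C (fobj G Y) (fobj G Y'))"
    proof (rule bij_betwI[where g = "\<lambda>h. Comp D Y (g' Y') Y' (s Y') (Comp D Y (g' Y) (g' Y') (farr F (g Y) (g Y') h) (t Y))"])
      show "farr G Y Y' \<in> Hom D Y Y' \<rightarrow> Hom C (fobj G Y) (fobj G Y')" using Y by auto
      have FH: "farr F (g Y) (g Y') h \<in> Hom D (g' Y) (g' Y')" if "h \<in> Hom C (g Y) (g Y')" for h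
        using that Y by (simp add: g'_def Fs(2))
      show "(\<lambda>h. Comp D Y (g' Y') Y' (s Y') (Comp D Y (g' Y) (g' Y') (farr F (g Y) (g Y') h) (t Y)))
          \<in> Hom C (fobj G Y) (fobj G Y') \<rightarrow> Hom D Y Y'"
        using Y FH by (auto intro!: D.Comp_in)
      fix f assume f: "f \<in> Hom D Y Y'"
      show "Comp D Y (g' Y') Y' (s Y') (Comp D Y (g' Y) (g' Y') (farr F (g Y) (g Y') (farr G Y Y' f)) (t Y)) = f"
        using Y f by (simp add: FG c_def Dsimp)
    next
      fix h assume "h \<in> Hom C (fobj G Y) (fobj G Y')"
      then have h: "h \<in> Hom C (g Y) (g Y')" by simp
      have FH: "farr F (g Y) (g Y') h \<in> Hom D (g' Y) (g' Y')"
        using h Y by (simp add: g'_def Fs(2))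
      show "farr G Y Y' (Comp D Y (g' Y') Y' (s Y') (Comp D Y (g' Y) (g' Y') (farr F (g Y) (g Y') h) (t Y))) = h"
        by (rule F_inj[of "g Y" "g Y'"]) (use Y h FH in \<open>simp_all add: FG c_def Dsimp\<close>)
    qed
  qed
  \<comment> \<open>the arrow that \<open>F\<close> maps to the inverse \<open>F X \<rightarrow> F (g (F X))\<close> of the chosen isomorphism\<close>
  define \<eta> where "\<eta> X = inv_into (Hom C X (g (fobj F X))) (farr F X (g (fobj F X))) (t (fobj F X))" for X
  have \<eta> [simp]: "\<eta> X \<in> Hom C X (g (fobj F X))" and F\<eta>: "farr F X (g (fobj F X)) (\<eta> X) = t (fobj F X)"
    if "X \<in> Obj C" for X
    using that lift[of X "g (fobj F X)" "t (fobj F X)"] Fs(1)[OF that]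
    by (auto simp: \<eta>_def g'_def[symmetric])
  have \<eta>iso: "is_iso C X (g (fobj F X)) (\<eta> X)" if X: "X \<in> Obj C" for X
  proof -
    let ?Y = "fobj F X"
    have Y: "?Y \<in> Obj D" using Fs(1)[OF X] .
    obtain \<theta> where \<theta>: "\<theta> \<in> Hom C (g ?Y) X" "farr F (g ?Y) X \<theta> = s ?Y"
      by (rule fully_faithful_surj[OF ff, of "g ?Y" X "s ?Y"]) (use X Y in \<open>auto simp: g'_def[symmetric]\<close>)
    have "Comp C X (g ?Y) X \<theta> (\<eta> X) = Idt C X"
      by (rule F_inj[of X X])
        (use X Y \<theta> in \<open>simp_all add: C.Comp_in C.Idt_in Fs(3,4) F\<eta> g'_def[symmetric] st\<close>)
    moreover have "Comp C (g ?Y) X (g ?Y) (\<eta> X) \<theta> = Idt C (g ?Y)"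
      by (rule F_inj[of "g ?Y" "g ?Y"])
        (use X Y \<theta> in \<open>simp_all add: C.Comp_in C.Idt_in Fs(3,4) F\<eta> g'_def[symmetric] ts\<close>)
    ultimately show ?thesis using \<theta> X by (auto simp: is_iso_def)
  qed
  have "natural_iso C C id_functor (comp_functor G F) \<eta>"
    unfolding natural_iso_def
  proof (intro conjI ballI)
    fix X assume "X \<in> Obj C"
    then show "is_iso C (fobj id_functor X) (fobj (comp_functor G F) X) (\<eta> X)"
      using \<eta>iso by (simp add: id_functor_def comp_functor_def)
  next
    fix X Y f assume a: "X \<in> Obj C" "Y \<in> Obj C" "f \<in> Hom C X Y"
    have b: "fobj F X \<in> Obj D" "fobj F Y \<in> Obj D" "farr F X Y f \<in> Hom D (fobj F X) (fobj F Y)"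
      using a Fs by auto
    have "Comp C X Y (g (fobj F Y)) (\<eta> Y) f =
        Comp C X (g (fobj F X)) (g (fobj F Y)) (farr G (fobj F X) (fobj F Y) (farr F X Y f)) (\<eta> X)"
      by (rule F_inj[of X "g (fobj F Y)"])
        (use a b in \<open>simp_all add: C.Comp_in Fs(4) F\<eta> FG g'_def[symmetric] c_def Dsimp\<close>)
    then show "Comp C (fobj id_functor X) (fobj id_functor Y) (fobj (comp_functor G F) Y) (\<eta> Y) (farr id_functor X Y f) =
        Comp C (fobj id_functor X) (fobj (comp_functor G F) X) (fobj (comp_functor G F) Y) (farr (comp_functor G F) X Y f) (\<eta> X)"
      by (simp add: id_functor_def comp_functor_def)
  qed
  moreover have "natural_iso D D (comp_functor F G) id_functor s"
    using s by (simp add: natural_iso_def id_functor_def comp_functor_def g'_def[symmetric] FG c_def Dsimp)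
  moreover have "essentially_surjective D C G"
    unfolding essentially_surjective_def
  proof
    fix X assume X: "X \<in> Obj C"
    then obtain \<theta> where "is_iso C (g (fobj F X)) X \<theta>" using \<eta>iso is_iso_inverse by metis
    then show "\<exists>Y\<in>Obj D. \<exists>s. is_iso C (fobj G Y) X s" using Fs(1)[OF X] by auto
  qed
  ultimately show ?thesis using funG ffG by blast
qed

corollary fully_faithful_essentially_surjective_equivalence:
  assumes "is_functor C D F" "fully_faithful C D F" "essentially_surjective C D F"
  shows "equivalence_of_categories C D F"
proof -
  obtain G \<eta> \<epsilon> where "is_functor D C G" "natural_iso C C id_functor (comp_functor G F) \<eta>"
      "natural_iso D D (comp_functor F G) id_functor \<epsilon>"
    using quasi_inverse_exists[OF assms] by (elim exE conjE)
  then show ?thesis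
    unfolding equivalence_of_categories_def using assms(1) by (intro conjI exI)
qed

section \<open>Abelian categories under equivalence\<close>

text \<open>Reversing the arrows exchanges kernels with cokernels and monomorphisms with epimorphisms, so
  that statements about cokernels and epimorphisms follow by duality.\<close>

definition opposite :: "('o, 'm, 'x) preadditive_category_scheme \<Rightarrow> ('o, 'm, 'x) preadditive_category_scheme" where
  "opposite C = C\<lparr>Hom := \<lambda>X Y. Hom C Y X, Comp := \<lambda>X Y Z g f. Comp C Z Y X f g,
    Hom_add := \<lambda>X Y. Hom_add C Y X, Hom_zero := \<lambda>X Y. Hom_zero C Y X\<rparr>"

definition opposite_functor where
  "opposite_functor F = F\<lparr>farr := \<lambda>X Y. farr F Y X\<rparr>"

lemma opposite_simps [simp]:
  "Obj (opposite C) = Obj C" "Hom (opposite C) X Y = Hom C Y X" "Idt (opposite C) = Idt C"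
  "Comp (opposite C) X Y Z g f = Comp C Z Y X f g" "Hom_add (opposite C) X Y = Hom_add C Y X"
  "Hom_zero (opposite C) X Y = Hom_zero C Y X"
  "fobj (opposite_functor F) = fobj F" "farr (opposite_functor F) X Y = farr F Y X"
  by (simp_all add: opposite_def opposite_functor_def)

lemma category_opposite: "category C \<Longrightarrow> category (opposite C)"
  by (rule category.intro) (simp_all add: category.Idt_in category.Comp_in category.Comp_Idt_left
    category.Comp_Idt_right category.Comp_assoc)

lemma preadditive_opposite: "preadditive_category C \<Longrightarrow> preadditive_category (opposite C)"
  unfolding preadditive_category_def
  by (auto simp: category_opposite preadditive_category_axioms_def)

lemma is_cokernel_opposite: "is_cokernel C X Y f Q q \<longleftrightarrow> is_kernel (opposite C) Y X f Q q"
  by (simp add: is_cokernel_def is_kernel_def)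

lemma is_epi_opposite: "is_epi C X Y f \<longleftrightarrow> is_mono (opposite C) Y X f"
  by (simp add: is_epi_def is_mono_def)

lemma is_iso_opposite: "is_iso (opposite C) X Y f \<longleftrightarrow> is_iso C Y X f"
  by (auto simp: is_iso_def)

lemma fully_faithful_opposite:
  "fully_faithful (opposite C) (opposite D) (opposite_functor F) \<longleftrightarrow> fully_faithful C D F"
  by (auto simp: fully_faithful_def)

lemma is_functor_opposite:
  "is_functor C D F \<Longrightarrow> is_functor (opposite C) (opposite D) (opposite_functor F)"
  by (simp add: is_functor_def category_opposite)

lemma essentially_surjective_opposite:
  "essentially_surjective C D F \<Longrightarrow>
    essentially_surjective (opposite C) (opposite D) (opposite_functor F)"
  unfolding essentially_surjective_def is_iso_opposite by (simp, meson is_iso_inverse)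

definition additive_functor where
  "additive_functor C D F \<longleftrightarrow> (\<forall>X\<in>Obj C. \<forall>Y\<in>Obj C. \<forall>f\<in>Hom C X Y. \<forall>g\<in>Hom C X Y.
    farr F X Y (Hom_add C X Y f g) = Hom_add D (fobj F X) (fobj F Y) (farr F X Y f) (farr F X Y g))"

lemma additive_functor_opposite:
  "additive_functor C D F \<Longrightarrow> additive_functor (opposite C) (opposite D) (opposite_functor F)"
  by (simp add: additive_functor_def)

context preadditive_category
begin

lemma Hom_add_closed:
  assumes "X \<in> Obj C" "Y \<in> Obj C" "f \<in> Hom C X Y" "g \<in> Hom C X Y"
  shows "Hom_add C X Y f g \<in> Hom C X Y"
proof -
  interpret H: comm_group "\<lparr>carrier = Hom C X Y, mult = Hom_add C X Y, one = Hom_zero C X Y\<rparr>"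
    by (rule Hom_group) fact+
  show ?thesis using H.m_closed assms by simp
qed

lemma Hom_zero_in: "X \<in> Obj C \<Longrightarrow> Y \<in> Obj C \<Longrightarrow> Hom_zero C X Y \<in> Hom C X Y"
  using Group.monoid.one_closed[OF group.is_monoid[OF comm_group.axioms(2)[OF Hom_group]]] by auto

lemma idempotent_Hom_zero:
  assumes "X \<in> Obj C" "Y \<in> Obj C" "f \<in> Hom C X Y" "Hom_add C X Y f f = f"
  shows "f = Hom_zero C X Y"
proof -
  interpret H: comm_group "\<lparr>carrier = Hom C X Y, mult = Hom_add C X Y, one = Hom_zero C X Y\<rparr>"
    by (rule Hom_group) fact+
  show ?thesis using H.l_cancel_one assms by simp
qed

lemma Hom_zero_add: "X \<in> Obj C \<Longrightarrow> Y \<in> Obj C \<Longrightarrow>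
    Hom_add C X Y (Hom_zero C X Y) (Hom_zero C X Y) = Hom_zero C X Y"
proof -
  assume "X \<in> Obj C" "Y \<in> Obj C"
  then interpret H: comm_group "\<lparr>carrier = Hom C X Y, mult = Hom_add C X Y, one = Hom_zero C X Y\<rparr>"
    by (rule Hom_group)
  show ?thesis using H.l_one[of "Hom_zero C X Y"] H.one_closed by simp
qed

lemma Comp_zero_right:
  assumes "X \<in> Obj C" "Y \<in> Obj C" "Z \<in> Obj C" "g \<in> Hom C Y Z"
  shows "Comp C X Y Z g (Hom_zero C X Y) = Hom_zero C X Z"
  using assms Comp_add_right[of X Y Z "Hom_zero C X Y" "Hom_zero C X Y" g]
  by (intro idempotent_Hom_zero) (simp_all add: Comp_in Hom_zero_in Hom_zero_add)

lemma Comp_zero_left: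
  assumes "X \<in> Obj C" "Y \<in> Obj C" "Z \<in> Obj C" "f \<in> Hom C X Y"
  shows "Comp C X Y Z (Hom_zero C Y Z) f = Hom_zero C X Z"
  using assms Comp_add_left[of X Y Z f "Hom_zero C Y Z" "Hom_zero C Y Z"]
  by (intro idempotent_Hom_zero) (simp_all add: Comp_in Hom_zero_in Hom_zero_add)

text \<open>Unlike the universal property, the equation on the right is preserved and reflected by
  every faithful additive functor.\<close>

lemma is_zero_object_iff: "is_zero_object C Z \<longleftrightarrow> Z \<in> Obj C \<and> Idt C Z = Hom_zero C Z Z"
proof safe
  assume Z: "is_zero_object C Z"
  then show "Z \<in> Obj C" by (simp add: is_zero_object_def)
  with Z show "Idt C Z = Hom_zero C Z Z"
    unfolding is_zero_object_def using Idt_in Hom_zero_in by blast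
next
  assume Z: "Z \<in> Obj C" "Idt C Z = Hom_zero C Z Z"
  show "is_zero_object C Z"
    unfolding is_zero_object_def
  proof (intro conjI ballI Z(1) ex1I)
    fix X f assume X: "X \<in> Obj C"
    show "Hom_zero C X Z \<in> Hom C X Z" "Hom_zero C Z X \<in> Hom C Z X" using X Z by (simp_all add: Hom_zero_in)
    show "f = Hom_zero C X Z" if "f \<in> Hom C X Z"
      using Comp_Idt_left[OF X Z(1) that] Z X that by (simp add: Comp_zero_left)
    show "f = Hom_zero C Z X" if "f \<in> Hom C Z X"
      using Comp_Idt_right[OF Z(1) X that] Z X that by (simp add: Comp_zero_right)
  qed
qed

text \<open>An essentially surjective functor meets every object only up to isomorphism; this and the next
  lemma allow the kernel object, or the target of the arrow, to be replaced accordingly.\<close>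

lemma kernel_precompose_iso:
  assumes X: "X \<in> Obj C" "Y \<in> Obj C" "f \<in> Hom C X Y" and k: "is_kernel C X Y f K k"
    and K': "K' \<in> Obj C" and u: "is_iso C K' K u"
  shows "is_kernel C X Y f K' (Comp C K' K X k u)"
proof -
  obtain v where uv: "u \<in> Hom C K' K" "v \<in> Hom C K K'" "Comp C K' K K' v u = Idt C K'"
    "Comp C K K' K u v = Idt C K"
    using u by (rule is_isoE)
  have K: "K \<in> Obj C" "k \<in> Hom C K X" "Comp C K X Y f k = Hom_zero C K Y" using k by (auto simp: is_kernel_def)
  note vu' = inverse_cancel[OF K' K(1) _ uv(1,2,3)] and uv' = inverse_cancel[OF K(1) K' _ uv(2,1,4)]
  show ?thesis
    unfolding is_kernel_def
  proof (intro conjI ballI impI K')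
    show "Comp C K' K X k u \<in> Hom C K' X" using K K' X uv by (simp add: Comp_in)
    show "Comp C K' X Y f (Comp C K' K X k u) = Hom_zero C K' Y"
      using K K' X uv by (simp add: Comp_assoc Comp_zero_left)
    fix Z g assume Z: "Z \<in> Obj C" "g \<in> Hom C Z X" "Comp C Z X Y f g = Hom_zero C Z Y"
    then obtain h where h: "h \<in> Hom C Z K" "Comp C Z K X k h = g"
      and uniq: "\<And>h'. h' \<in> Hom C Z K \<Longrightarrow> Comp C Z K X k h' = g \<Longrightarrow> h' = h"
      using k unfolding is_kernel_def by metis
    show "\<exists>!h. h \<in> Hom C Z K' \<and> Comp C Z K' X (Comp C K' K X k u) h = g"
    proof (rule ex1I[of _ "Comp C Z K K' v h"], intro conjI)
      show "Comp C Z K K' v h \<in> Hom C Z K'" using h uv Z K K' by (simp add: Comp_in)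
      show "Comp C Z K' X (Comp C K' K X k u) (Comp C Z K K' v h) = g"
        using h uv Z K K' X by (simp add: Comp_in Comp_assoc[symmetric] uv')
      fix h' assume h': "h' \<in> Hom C Z K' \<and> Comp C Z K' X (Comp C K' K X k u) h' = g"
      then have "Comp C Z K' K u h' = h"
        using uv Z K K' X by (intro uniq) (simp_all add: Comp_in Comp_assoc)
      then show "h' = Comp C Z K K' v h" using h' vu' Z by auto
    qed
  qed
qed

lemma kernel_postcompose_iso:
  assumes X: "X \<in> Obj C" "Y \<in> Obj C" "f \<in> Hom C X Y" and k: "is_kernel C X Y f K k"
    and Y': "Y' \<in> Obj C" and u: "is_iso C Y Y' u"
  shows "is_kernel C X Y' (Comp C X Y Y' u f) K k"
proof -
  obtain v where uv: "u \<in> Hom C Y Y'" "v \<in> Hom C Y' Y" "Comp C Y Y' Y v u = Idt C Y"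
    using u by (rule is_isoE)
  have K: "K \<in> Obj C" "k \<in> Hom C K X" "Comp C K X Y f k = Hom_zero C K Y" using k by (auto simp: is_kernel_def)
  have iff: "Comp C Z X Y' (Comp C X Y Y' u f) g = Hom_zero C Z Y' \<longleftrightarrow> Comp C Z X Y f g = Hom_zero C Z Y"
    if Z: "Z \<in> Obj C" "g \<in> Hom C Z X" for Z g
  proof
    assume "Comp C Z X Y' (Comp C X Y Y' u f) g = Hom_zero C Z Y'"
    then have "Comp C Z Y Y' u (Comp C Z X Y f g) = Hom_zero C Z Y'"
      using Z X Y' uv by (simp add: Comp_assoc)
    then show "Comp C Z X Y f g = Hom_zero C Z Y"
      using inverse_cancel[OF X(2) Y' Z(1) uv, of "Comp C Z X Y f g"] Z X Y' uv
      by (simp add: Comp_in Comp_zero_right)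
  qed (use Z X Y' uv in \<open>simp add: Comp_assoc[symmetric] Comp_zero_right\<close>)
  show ?thesis using k K iff by (simp add: is_kernel_def)
qed

end

text \<open>One self-dual half of the axioms of an abelian category; the other half is the same condition on
  the opposite category.\<close>

definition kernels_normal where
  "kernels_normal C \<longleftrightarrow>
    (\<forall>X\<in>Obj C. \<forall>Y\<in>Obj C. \<forall>f\<in>Hom C X Y. \<exists>K k. is_kernel C X Y f K k) \<and>
    (\<forall>X\<in>Obj C. \<forall>Y\<in>Obj C. \<forall>f. is_mono C X Y f \<longrightarrow>
      (\<exists>Z\<in>Obj C. \<exists>g\<in>Hom C Y Z. is_kernel C Y Z g X f))"

lemma abelian_category_iff:
  "abelian_category C \<longleftrightarrow> preadditive_category C \<and> (\<exists>Z. is_zero_object C Z) \<and>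
    (\<forall>X\<in>Obj C. \<forall>Y\<in>Obj C. \<exists>B inX inY prX prY. is_biproduct C X Y B inX inY prX prY) \<and>
    kernels_normal C \<and> kernels_normal (opposite C)"
  unfolding abelian_category_def kernels_normal_def is_cokernel_opposite is_epi_opposite opposite_simps
  by blast

lemma additive_functor_zero:
  assumes "is_functor C D F" "additive_functor C D F" "preadditive_category C" "preadditive_category D"
    "X \<in> Obj C" "Y \<in> Obj C"
  shows "farr F X Y (Hom_zero C X Y) = Hom_zero D (fobj F X) (fobj F Y)"
proof -
  interpret C: preadditive_category C by fact
  interpret D: preadditive_category D by fact
  note Fs = is_functorD(3-)[OF assms(1)]
  have "Hom_add D (fobj F X) (fobj F Y) (farr F X Y (Hom_zero C X Y)) (farr F X Y (Hom_zero C X Y)) =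
      farr F X Y (Hom_add C X Y (Hom_zero C X Y) (Hom_zero C X Y))"
    using assms(2,5,6) C.Hom_zero_in[of X Y] by (simp add: additive_functor_def)
  then show ?thesis using assms(5,6)
    by (intro D.idempotent_Hom_zero) (simp_all add: Fs C.Hom_zero_in C.Hom_zero_add)
qed

text \<open>Test objects and test arrows are carried to \<open>D\<close>, and the factorisation found there is lifted
  back.\<close>

lemma fully_faithful_reflects_kernel:
  assumes F: "is_functor C D F" "fully_faithful C D F" "additive_functor C D F"
    and C: "preadditive_category C" and D: "preadditive_category D"
    and X: "X \<in> Obj C" "Y \<in> Obj C" "f \<in> Hom C X Y" "K \<in> Obj C" "k \<in> Hom C K X"
    and k: "is_kernel D (fobj F X) (fobj F Y) (farr F X Y f) (fobj F K) (farr F K X k)"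
  shows "is_kernel C X Y f K k"
proof -
  interpret C: preadditive_category C by fact
  interpret D: preadditive_category D by fact
  note Fs = is_functorD(3-)[OF F(1)] and inj = fully_faithful_inj[OF F(2)]
  note F0 = additive_functor_zero[OF F(1,3) C D]
  show ?thesis
    unfolding is_kernel_def
  proof (intro conjI ballI impI X)
    show "Comp C K X Y f k = Hom_zero C K Y"
      by (rule inj[of K Y]) (use X k in \<open>simp_all add: C.Comp_in C.Hom_zero_in Fs(4) F0 is_kernel_def\<close>)
    fix Z g assume Z: "Z \<in> Obj C" "g \<in> Hom C Z X" "Comp C Z X Y f g = Hom_zero C Z Y"
    have "Comp D (fobj F Z) (fobj F X) (fobj F Y) (farr F X Y f) (farr F Z X g) = Hom_zero D (fobj F Z) (fobj F Y)"
      using Z X by (simp add: Fs(4)[symmetric] F0)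
    then have "\<exists>!h. h \<in> Hom D (fobj F Z) (fobj F K) \<and>
        Comp D (fobj F Z) (fobj F K) (fobj F X) (farr F K X k) h = farr F Z X g"
      using k Z X Fs(1,2) by (simp add: is_kernel_def)
    then obtain h where h: "h \<in> Hom D (fobj F Z) (fobj F K)"
        "Comp D (fobj F Z) (fobj F K) (fobj F X) (farr F K X k) h = farr F Z X g"
      and uniq: "\<And>h'. h' \<in> Hom D (fobj F Z) (fobj F K) \<Longrightarrow>
        Comp D (fobj F Z) (fobj F K) (fobj F X) (farr F K X k) h' = farr F Z X g \<Longrightarrow> h' = h"
      by metis
    obtain h' where h': "h' \<in> Hom C Z K" "farr F Z K h' = h"
      using fully_faithful_surj[OF F(2) Z(1) X(4) h(1)] by blast
    show "\<exists>!h. h \<in> Hom C Z K \<and> Comp C Z K X k h = g"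
    proof (rule ex1I[of _ h'], intro conjI h')
      show "Comp C Z K X k h' = g"
        by (rule inj[of Z X]) (use X Z h' h in \<open>simp_all add: C.Comp_in Fs(4)\<close>)
      fix h'' assume h'': "h'' \<in> Hom C Z K \<and> Comp C Z K X k h'' = g"
      then have "farr F Z K h'' = h"
        using X Z by (intro uniq) (simp_all add: Fs(2) Fs(4)[symmetric])
      then show "h'' = h'" using X Z h' h'' by (intro inj[of Z K h'' h']) simp_all
    qed
  qed
qed

text \<open>A kernel in \<open>D\<close> of the image of an arrow is replaced by an isomorphic one that is the image of an
  arrow of \<open>C\<close>, and reflected. For normality, a monomorphism has to stay one in \<open>D\<close>: test objects of
  \<open>D\<close> are isomorphic to images of test objects of \<open>C\<close>. The arrow of which it is the kernel there has
  its target replaced in the same way.\<close>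

lemma kernels_normal_reflect:
  assumes F: "is_functor C D F" "fully_faithful C D F" "additive_functor C D F" "essentially_surjective C D F"
    and C: "preadditive_category C" and D: "preadditive_category D" and n: "kernels_normal D"
  shows "kernels_normal C"
proof -
  interpret C: preadditive_category C by fact
  interpret D: preadditive_category D by fact
  note Fs = is_functorD(3-)[OF F(1)] and inj = fully_faithful_inj[OF F(2)]
  note refl = fully_faithful_reflects_kernel[OF F(1-3) C D]
  show ?thesis
    unfolding kernels_normal_def
  proof (intro conjI ballI allI impI)
    fix X Y f assume X: "X \<in> Obj C" "Y \<in> Obj C" "f \<in> Hom C X Y"
    obtain K k where k: "is_kernel D (fobj F X) (fobj F Y) (farr F X Y f) K k"
      using n Fs(1)[OF X(1)] Fs(1)[OF X(2)] Fs(2)[OF X] unfolding kernels_normal_def by meson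
    then have K: "K \<in> Obj D" "k \<in> Hom D K (fobj F X)" by (auto simp: is_kernel_def)
    then obtain K' u where K': "K' \<in> Obj C" "is_iso D (fobj F K') K u"
      using F(4) by (auto simp: essentially_surjective_def)
    let ?k = "Comp D (fobj F K') K (fobj F X) k u"
    have k': "is_kernel D (fobj F X) (fobj F Y) (farr F X Y f) (fobj F K') ?k"
      using K' k X Fs(1,2) by (intro D.kernel_precompose_iso) auto
    have "?k \<in> Hom D (fobj F K') (fobj F X)" using k' by (simp add: is_kernel_def)
    then obtain k'' where "k'' \<in> Hom C K' X" "farr F K' X k'' = ?k"
      using fully_faithful_surj[OF F(2) K'(1) X(1)] by blast
    then have "is_kernel C X Y f K' k''" using X K' k' by (intro refl) auto
    then show "\<exists>K k. is_kernel C X Y f K k" by blast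
  next
    fix X Y f assume X: "X \<in> Obj C" "Y \<in> Obj C" and f: "is_mono C X Y f"
    then have fH: "f \<in> Hom C X Y" by (simp add: is_mono_def)
    have "is_mono D (fobj F X) (fobj F Y) (farr F X Y f)"
      unfolding is_mono_def
    proof (intro conjI ballI impI)
      show "farr F X Y f \<in> Hom D (fobj F X) (fobj F Y)" using X fH Fs(2) by simp
      fix Z g h assume a: "Z \<in> Obj D" "g \<in> Hom D Z (fobj F X)" "h \<in> Hom D Z (fobj F X)"
        and eq: "Comp D Z (fobj F X) (fobj F Y) (farr F X Y f) g = Comp D Z (fobj F X) (fobj F Y) (farr F X Y f) h"
      obtain Z' u where Z': "Z' \<in> Obj C" "is_iso D (fobj F Z') Z u"
        using F(4) a by (auto simp: essentially_surjective_def)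
      obtain v where uv: "u \<in> Hom D (fobj F Z') Z" "v \<in> Hom D Z (fobj F Z')" "Comp D Z (fobj F Z') Z u v = Idt D Z"
        using Z'(2) by (rule D.is_isoE)
      note O = a X Z' Fs(1)
      obtain g' where g': "g' \<in> Hom C Z' X" "farr F Z' X g' = Comp D (fobj F Z') Z (fobj F X) g u"
        using fully_faithful_surj[OF F(2) Z'(1) X(1), of "Comp D (fobj F Z') Z (fobj F X) g u"] O uv
        by (metis D.Comp_in)
      obtain h' where h': "h' \<in> Hom C Z' X" "farr F Z' X h' = Comp D (fobj F Z') Z (fobj F X) h u"
        using fully_faithful_surj[OF F(2) Z'(1) X(1), of "Comp D (fobj F Z') Z (fobj F X) h u"] O uv
        by (metis D.Comp_in)
      have "Comp C Z' X Y f g' = Comp C Z' X Y f h'"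
        by (rule inj[of Z' Y])
          (use O uv g' h' fH eq in \<open>simp_all add: C.Comp_in Fs(2,4) D.Comp_assoc\<close>)
      then have "g' = h'" using f Z' g' h' by (simp add: is_mono_def)
      then have "Comp D (fobj F Z') Z (fobj F X) g u = Comp D (fobj F Z') Z (fobj F X) h u" using g' h' by simp
      then have "Comp D Z (fobj F Z') (fobj F X) (Comp D (fobj F Z') Z (fobj F X) g u) v =
          Comp D Z (fobj F Z') (fobj F X) (Comp D (fobj F Z') Z (fobj F X) h u) v" by simp
      then show "g = h" using O uv by (simp add: D.Comp_assoc[symmetric] D.Comp_Idt_right)
    qed
    then obtain W g where W: "W \<in> Obj D" "g \<in> Hom D (fobj F Y) W"
        "is_kernel D (fobj F Y) W g (fobj F X) (farr F X Y f)"
      using n Fs(1)[OF X(1)] Fs(1)[OF X(2)] unfolding kernels_normal_def by meson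
    obtain W' u where W': "W' \<in> Obj C" "is_iso D (fobj F W') W u"
      using F(4) W by (auto simp: essentially_surjective_def)
    then obtain v where v: "is_iso D W (fobj F W') v" by (blast elim: is_iso_inverse)
    let ?g = "Comp D (fobj F Y) W (fobj F W') v g"
    have g: "is_kernel D (fobj F Y) (fobj F W') ?g (fobj F X) (farr F X Y f)"
      using W W' X v Fs(1) by (intro D.kernel_postcompose_iso) auto
    have "?g \<in> Hom D (fobj F Y) (fobj F W')"
      using W W' X v Fs(1) by (intro D.Comp_in) (auto simp: is_iso_def)
    then obtain g' where g': "g' \<in> Hom C Y W'" "farr F Y W' g' = ?g"
      using fully_faithful_surj[OF F(2) X(2) W'(1)] by blast
    then have "is_kernel C Y W' g' X f" using X W' g fH by (intro refl) auto
    then show "\<exists>Z\<in>Obj C. \<exists>g\<in>Hom C Y Z. is_kernel C Y Z g X f" using g' W' by blast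
  qed
qed

text \<open>Zero objects and biproducts are given by equations between arrows, so they are reflected once the
  object has been replaced by an isomorphic one in the image of \<open>F\<close> and the structure arrows have
  been lifted.\<close>

lemma abelian_category_reflect:
  assumes F: "is_functor C D F" "fully_faithful C D F" "additive_functor C D F" "essentially_surjective C D F"
    and C: "preadditive_category C" and D: "abelian_category D"
  shows "abelian_category C"
  unfolding abelian_category_iff
proof (intro conjI C ballI)
  interpret C: preadditive_category C by fact
  have D': "preadditive_category D" using D by (simp add: abelian_category_def)
  then interpret D: preadditive_category D .
  note Fs = is_functorD(3-)[OF F(1)] and inj = fully_faithful_inj[OF F(2)]
  note F0 = additive_functor_zero[OF F(1,3) C D']
  show "kernels_normal C"
    using F C D' D by (intro kernels_normal_reflect[of C D F]) (auto simp: abelian_category_iff)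
  show "kernels_normal (opposite C)"
    using F C D' D
    by (intro kernels_normal_reflect[of "opposite C" "opposite D" "opposite_functor F"])
      (auto simp: abelian_category_iff is_functor_opposite fully_faithful_opposite
        additive_functor_opposite essentially_surjective_opposite preadditive_opposite)
  obtain Z where "is_zero_object D Z" using D by (auto simp: abelian_category_def)
  then have Z: "Z \<in> Obj D" "Idt D Z = Hom_zero D Z Z" by (simp_all add: D.is_zero_object_iff)
  obtain Z' u where Z': "Z' \<in> Obj C" "is_iso D (fobj F Z') Z u"
    using F(4) Z by (auto simp: essentially_surjective_def)
  obtain v where uv: "u \<in> Hom D (fobj F Z') Z" "v \<in> Hom D Z (fobj F Z')"
      "Comp D (fobj F Z') Z (fobj F Z') v u = Idt D (fobj F Z')"
    using Z'(2) by (rule D.is_isoE)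
  have "u = Hom_zero D (fobj F Z') Z"
    using D.Comp_Idt_left[of "fobj F Z'" Z u] Z Z' uv Fs(1) by (simp add: D.Comp_zero_left)
  then have "Idt D (fobj F Z') = Hom_zero D (fobj F Z') (fobj F Z')"
    using uv Z Z' Fs(1) by (simp add: D.Comp_zero_right)
  then have "Idt C Z' = Hom_zero C Z' Z'"
    by (intro inj[of Z' Z']) (use Z' in \<open>simp_all add: C.Idt_in C.Hom_zero_in Fs(3) F0\<close>)
  then show "\<exists>Z. is_zero_object C Z" using Z' C.is_zero_object_iff by blast
  fix X Y assume X: "X \<in> Obj C" "Y \<in> Obj C"
  obtain B inX inY prX prY where "is_biproduct D (fobj F X) (fobj F Y) B inX inY prX prY"
    using D X Fs(1) unfolding abelian_category_def by meson
  then have BH: "B \<in> Obj D" "inX \<in> Hom D (fobj F X) B" "inY \<in> Hom D (fobj F Y) B"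
      "prX \<in> Hom D B (fobj F X)" "prY \<in> Hom D B (fobj F Y)"
    and B: "Comp D (fobj F X) B (fobj F X) prX inX = Idt D (fobj F X)"
      "Comp D (fobj F Y) B (fobj F Y) prY inY = Idt D (fobj F Y)"
      "Comp D (fobj F Y) B (fobj F X) prX inY = Hom_zero D (fobj F Y) (fobj F X)"
      "Comp D (fobj F X) B (fobj F Y) prY inX = Hom_zero D (fobj F X) (fobj F Y)"
    and B_sum: "Hom_add D B B (Comp D B (fobj F X) B inX prX) (Comp D B (fobj F Y) B inY prY) = Idt D B"
    by (auto simp: is_biproduct_def)
  obtain B' u where B': "B' \<in> Obj C" "is_iso D (fobj F B') B u"
    using F(4) BH by (auto simp: essentially_surjective_def)
  obtain v where uv: "u \<in> Hom D (fobj F B') B" "v \<in> Hom D B (fobj F B')"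
      "Comp D (fobj F B') B (fobj F B') v u = Idt D (fobj F B')" "Comp D B (fobj F B') B u v = Idt D B"
    using B'(2) by (rule D.is_isoE)
  note O = X B' Fs(1) BH uv
  have uv': "Comp D W (fobj F B') B u (Comp D W B (fobj F B') v x) = x" if "W \<in> Obj D" "x \<in> Hom D W B" for W x
    using that O by (intro D.inverse_cancel) auto
  obtain iX where iX: "iX \<in> Hom C X B'" "farr F X B' iX = Comp D (fobj F X) B (fobj F B') v inX"
    using fully_faithful_surj[OF F(2), of X B' "Comp D (fobj F X) B (fobj F B') v inX"] O by (metis D.Comp_in)
  obtain iY where iY: "iY \<in> Hom C Y B'" "farr F Y B' iY = Comp D (fobj F Y) B (fobj F B') v inY"
    using fully_faithful_surj[OF F(2), of Y B' "Comp D (fobj F Y) B (fobj F B') v inY"] O by (metis D.Comp_in)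
  obtain pX where pX: "pX \<in> Hom C B' X" "farr F B' X pX = Comp D (fobj F B') B (fobj F X) prX u"
    using fully_faithful_surj[OF F(2), of B' X "Comp D (fobj F B') B (fobj F X) prX u"] O by (metis D.Comp_in)
  obtain pY where pY: "pY \<in> Hom C B' Y" "farr F B' Y pY = Comp D (fobj F B') B (fobj F Y) prY u"
    using fully_faithful_surj[OF F(2), of B' Y "Comp D (fobj F B') B (fobj F Y) prY u"] O by (metis D.Comp_in)
  note simps = O iX iY pX pY C.Comp_in C.Idt_in C.Hom_zero_in Fs(3,4) F0 D.Comp_in
  have "Comp C B' X B' iX pX \<in> Hom C B' B'" "Comp C B' Y B' iY pY \<in> Hom C B' B'"
    using O iX iY pX pY by (auto intro: C.Comp_in)
  moreover have "Hom_add D (fobj F B') (fobj F B')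
      (Comp D (fobj F B') (fobj F X) (fobj F B') (Comp D (fobj F X) B (fobj F B') v inX) (Comp D (fobj F B') B (fobj F X) prX u))
      (Comp D (fobj F B') (fobj F Y) (fobj F B') (Comp D (fobj F Y) B (fobj F B') v inY) (Comp D (fobj F B') B (fobj F Y) prY u)) =
      Idt D (fobj F B')"
  proof -
    let ?a = "Comp D B (fobj F X) B inX prX" and ?b = "Comp D B (fobj F Y) B inY prY"
    have ab: "?a \<in> Hom D B B" "?b \<in> Hom D B B" using O by (auto intro: D.Comp_in)
    have "Comp D (fobj F B') B (fobj F B') v (Comp D (fobj F B') B B (Hom_add D B B ?a ?b) u) = Hom_add D (fobj F B') (fobj F B')
       (Comp D (fobj F B') B (fobj F B') v (Comp D (fobj F B') B B ?a u))
       (Comp D (fobj F B') B (fobj F B') v (Comp D (fobj F B') B B ?b u))"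
      using O ab by (simp add: D.Comp_add_left D.Comp_add_right D.Comp_in)
    moreover have "Comp D (fobj F B') B (fobj F B') v (Comp D (fobj F B') B B (Idt D B) u) = Idt D (fobj F B')"
      using O by (simp add: D.Comp_Idt_left)
    ultimately have "Hom_add D (fobj F B') (fobj F B')
       (Comp D (fobj F B') B (fobj F B') v (Comp D (fobj F B') B B ?a u))
       (Comp D (fobj F B') B (fobj F B') v (Comp D (fobj F B') B B ?b u)) = Idt D (fobj F B')"
      unfolding B_sum by (rule trans[OF sym])
    then show ?thesis using O by (simp add: D.Comp_assoc[symmetric] D.Comp_in)
  qed
  ultimately have sum: "Hom_add C B' B' (Comp C B' X B' iX pX) (Comp C B' Y B' iY pY) = Idt C B'"
    using F(3) by (intro inj[of B' B']) (simp_all add: simps C.Hom_add_closed additive_functor_def)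
  have "is_biproduct C X Y B' iX iY pX pY"
    unfolding is_biproduct_def
  proof (intro conjI sum)
    show "Comp C X B' X pX iX = Idt C X"
      by (rule inj[of X X]) (simp_all add: simps B D.Comp_assoc[symmetric] uv')
    show "Comp C Y B' Y pY iY = Idt C Y"
      by (rule inj[of Y Y]) (simp_all add: simps B D.Comp_assoc[symmetric] uv')
    show "Comp C Y B' X pX iY = Hom_zero C Y X"
      by (rule inj[of Y X]) (simp_all add: simps B D.Comp_assoc[symmetric] uv')
    show "Comp C X B' Y pY iX = Hom_zero C X Y"
      by (rule inj[of X Y]) (simp_all add: simps B D.Comp_assoc[symmetric] uv')
  qed (use simps in auto)
  then show "\<exists>B inX inY prX prY. is_biproduct C X Y B inX inY prX prY" by blast
qed

text \<open>Being abelian passes backwards along a functor by \<open>abelian_category_reflect\<close>, so the quasi-inverse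
  has to be used. It is additive because after applying the faithful functor \<open>F\<close> it is conjugation by
  the isomorphisms \<open>\<epsilon>\<close>.\<close>

theorem abelian_category_transfer:
  assumes F: "is_functor C D F" "fully_faithful C D F" "essentially_surjective C D F" "additive_functor C D F"
    and C: "abelian_category C" and D: "preadditive_category D"
  shows "abelian_category D"
proof -
  obtain G \<eta> \<epsilon> where G: "is_functor D C G" "fully_faithful D C G" "essentially_surjective D C G"
      and \<epsilon>: "natural_iso D D (comp_functor F G) id_functor \<epsilon>"
    using quasi_inverse_exists[OF F(1-3)] by blast
  have C': "preadditive_category C" using C by (simp add: abelian_category_def)
  then interpret C: preadditive_category C .
  interpret D: preadditive_category D by fact
  note Fs = is_functorD(3-)[OF F(1)] and Gs = is_functorD(3-)[OF G(1)]
  have iso: "is_iso D (fobj F (fobj G X)) X (\<epsilon> X)" if "X \<in> Obj D" for X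
    using \<epsilon> that by (simp add: natural_iso_def comp_functor_def id_functor_def)
  then have \<epsilon>H: "\<epsilon> X \<in> Hom D (fobj F (fobj G X)) X" if "X \<in> Obj D" for X
    using that by (simp add: is_iso_def)
  have nat: "Comp D (fobj F (fobj G X)) (fobj F (fobj G Y)) Y (\<epsilon> Y) (farr F (fobj G X) (fobj G Y) (farr G X Y f)) =
      Comp D (fobj F (fobj G X)) X Y f (\<epsilon> X)" if "X \<in> Obj D" "Y \<in> Obj D" "f \<in> Hom D X Y" for X Y f
    using \<epsilon> that by (simp add: natural_iso_def comp_functor_def id_functor_def)
  have "additive_functor D C G"
    unfolding additive_functor_def
  proof (intro ballI)
    fix X Y f g assume a: "X \<in> Obj D" "Y \<in> Obj D" "f \<in> Hom D X Y" "g \<in> Hom D X Y"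
    note O = a Gs(1,2) Fs(1,2) D.Hom_add_closed C.Hom_add_closed \<epsilon>H
    show "farr G X Y (Hom_add D X Y f g) = Hom_add C (fobj G X) (fobj G Y) (farr G X Y f) (farr G X Y g)"
    proof (rule fully_faithful_inj[OF F(2), of "fobj G X" "fobj G Y"])
      have "Comp D (fobj F (fobj G X)) (fobj F (fobj G Y)) Y (\<epsilon> Y)
          (farr F (fobj G X) (fobj G Y) (farr G X Y (Hom_add D X Y f g))) =
        Comp D (fobj F (fobj G X)) (fobj F (fobj G Y)) Y (\<epsilon> Y)
          (farr F (fobj G X) (fobj G Y) (Hom_add C (fobj G X) (fobj G Y) (farr G X Y f) (farr G X Y g)))"
        using F(4) by (simp add: O nat D.Comp_add_left D.Comp_add_right additive_functor_def)
      then show "farr F (fobj G X) (fobj G Y) (farr G X Y (Hom_add D X Y f g)) =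
          farr F (fobj G X) (fobj G Y) (Hom_add C (fobj G X) (fobj G Y) (farr G X Y f) (farr G X Y g))"
        by (rule D.iso_cancel_left[rotated 6, of _ _ _ "\<epsilon> Y"]) (simp_all add: O iso)
    qed (simp_all add: O)
  qed
  then show ?thesis using G D C by (intro abelian_category_reflect[of D C G])
qed

section \<open>Linear maps\<close>

lemma lin_maps_iff:
  "f \<in> lin_maps R V W \<longleftrightarrow> (\<forall>x\<in>carrier V. f x \<in> carrier W) \<and>
    (\<forall>x\<in>carrier V. \<forall>y\<in>carrier V. f (x \<oplus>\<^bsub>V\<^esub> y) = f x \<oplus>\<^bsub>W\<^esub> f y) \<and>
    (\<forall>c\<in>carrier R. \<forall>x\<in>carrier V. f (c \<odot>\<^bsub>V\<^esub> x) = c \<odot>\<^bsub>W\<^esub> f x) \<and> f \<in> extensional (carrier V)"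
  by (auto simp: lin_maps_def LinearCombinations.module_hom_def)

lemma lin_mapsI:
  assumes "\<And>x. x \<in> carrier V \<Longrightarrow> f x \<in> carrier W"
    "\<And>x y. x \<in> carrier V \<Longrightarrow> y \<in> carrier V \<Longrightarrow> f (x \<oplus>\<^bsub>V\<^esub> y) = f x \<oplus>\<^bsub>W\<^esub> f y"
    "\<And>c x. c \<in> carrier R \<Longrightarrow> x \<in> carrier V \<Longrightarrow> f (c \<odot>\<^bsub>V\<^esub> x) = c \<odot>\<^bsub>W\<^esub> f x" "f \<in> extensional (carrier V)"
  shows "f \<in> lin_maps R V W"
  using assms by (simp add: lin_maps_iff)

lemma lin_mapsD:
  assumes "f \<in> lin_maps R V W"
  shows "x \<in> carrier V \<Longrightarrow> f x \<in> carrier W"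
    "\<lbrakk>x \<in> carrier V; y \<in> carrier V\<rbrakk> \<Longrightarrow> f (x \<oplus>\<^bsub>V\<^esub> y) = f x \<oplus>\<^bsub>W\<^esub> f y"
    "\<lbrakk>c \<in> carrier R; x \<in> carrier V\<rbrakk> \<Longrightarrow> f (c \<odot>\<^bsub>V\<^esub> x) = c \<odot>\<^bsub>W\<^esub> f x"
    "f \<in> extensional (carrier V)"
  using assms by (simp_all add: lin_maps_iff)

lemma lin_maps_eqI:
  assumes "f \<in> lin_maps R V W" "g \<in> lin_maps R V U" "\<And>x. x \<in> carrier V \<Longrightarrow> f x = g x"
  shows "f = g"
  by (rule extensionalityI[OF lin_mapsD(4)[OF assms(1)] lin_mapsD(4)[OF assms(2)] assms(3)])

lemma left_module_abelian_group: "left_module R M \<Longrightarrow> abelian_group M"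
  by (rule left_module.axioms(2))

lemma left_module_closed:
  assumes "left_module R M"
  shows "\<lbrakk>x \<in> carrier M; y \<in> carrier M\<rbrakk> \<Longrightarrow> x \<oplus>\<^bsub>M\<^esub> y \<in> carrier M" "\<zero>\<^bsub>M\<^esub> \<in> carrier M"
    "\<lbrakk>a \<in> carrier R; x \<in> carrier M\<rbrakk> \<Longrightarrow> a \<odot>\<^bsub>M\<^esub> x \<in> carrier M"
proof -
  interpret M: abelian_group M using assms by (rule left_module_abelian_group)
  show "\<lbrakk>x \<in> carrier M; y \<in> carrier M\<rbrakk> \<Longrightarrow> x \<oplus>\<^bsub>M\<^esub> y \<in> carrier M" "\<zero>\<^bsub>M\<^esub> \<in> carrier M" by simp_all
  show "\<lbrakk>a \<in> carrier R; x \<in> carrier M\<rbrakk> \<Longrightarrow> a \<odot>\<^bsub>M\<^esub> x \<in> carrier M"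
    using assms by (rule left_module.act_closed)
qed

lemma lin_maps_zero:
  assumes "abelian_group V" "abelian_group W" "f \<in> lin_maps R V W"
  shows "f \<zero>\<^bsub>V\<^esub> = \<zero>\<^bsub>W\<^esub>"
proof -
  interpret V: abelian_group V by fact
  interpret W: abelian_group W by fact
  have "f \<zero>\<^bsub>V\<^esub> \<oplus>\<^bsub>W\<^esub> f \<zero>\<^bsub>V\<^esub> = f \<zero>\<^bsub>V\<^esub>"
    using lin_mapsD(2)[OF assms(3), of "\<zero>\<^bsub>V\<^esub>" "\<zero>\<^bsub>V\<^esub>"] by simp
  then show ?thesis using lin_mapsD(1)[OF assms(3), of "\<zero>\<^bsub>V\<^esub>"] W.add.l_cancel_one by simp
qed

lemma lin_maps_a_inv:
  assumes "abelian_group V" "abelian_group W" "f \<in> lin_maps R V W" "x \<in> carrier V"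
  shows "f (\<ominus>\<^bsub>V\<^esub> x) = \<ominus>\<^bsub>W\<^esub> f x"
proof -
  interpret V: abelian_group V by fact
  interpret W: abelian_group W by fact
  have "f (\<ominus>\<^bsub>V\<^esub> x) \<oplus>\<^bsub>W\<^esub> f x = \<zero>\<^bsub>W\<^esub>"
    using lin_mapsD(2)[OF assms(3), of "\<ominus>\<^bsub>V\<^esub> x" x] assms(4) lin_maps_zero[OF assms(1-3)]
    by (simp add: V.l_neg)
  then show ?thesis using lin_mapsD(1)[OF assms(3)] assms(4) by (simp add: W.minus_equality)
qed

lemma lin_maps_minus:
  assumes "abelian_group V" "abelian_group W" "f \<in> lin_maps R V W" "x \<in> carrier V" "y \<in> carrier V"
  shows "f (x \<ominus>\<^bsub>V\<^esub> y) = f x \<ominus>\<^bsub>W\<^esub> f y"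
  using assms lin_mapsD(2)[OF assms(3), of x "\<ominus>\<^bsub>V\<^esub> y"]
  by (simp add: a_minus_def lin_maps_a_inv abelian_group.a_inv_closed)

lemma lin_maps_finsum:
  assumes "abelian_group V" "abelian_group W" "f \<in> lin_maps R V W" "finite S"
    "\<And>s. s \<in> S \<Longrightarrow> g s \<in> carrier V"
  shows "f (\<Oplus>\<^bsub>V\<^esub>s\<in>S. g s) = (\<Oplus>\<^bsub>W\<^esub>s\<in>S. f (g s))"
proof -
  interpret V: abelian_group V by fact
  interpret W: abelian_group W by fact
  show ?thesis using assms(4,5)
    by (induction S rule: finite_induct)
      (simp_all add: lin_maps_zero[OF assms(1-3)] lin_mapsD[OF assms(3)] V.finsum_closed V.finsum_insert
        W.finsum_insert Pi_def)
qed

lemma lin_maps_id: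
  assumes "left_module R V"
  shows "(\<lambda>x\<in>carrier V. x) \<in> lin_maps R V V"
  using left_module_closed[OF assms] by (simp add: lin_maps_iff)

lemma lin_maps_compose:
  assumes "left_module R V" "f \<in> lin_maps R V W" "g \<in> lin_maps R W U"
  shows "compose (carrier V) g f \<in> lin_maps R V U"
  using left_module_closed[OF assms(1)] assms(2,3) by (auto simp: lin_maps_iff compose_def)

lemma lin_maps_inverse:
  assumes "left_module R V" "f \<in> lin_maps R V W" "bij_betw f (carrier V) (carrier W)"
  shows "restrict (inv_into (carrier V) f) (carrier W) \<in> lin_maps R W V"
proof -
  let ?g = "inv_into (carrier V) f"
  note V = left_module_closed[OF assms(1)] and f = lin_mapsD(1-3)[OF assms(2)]
  have g: "?g (f x) = x" if "x \<in> carrier V" for x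
    using assms(3) that by (simp add: bij_betw_def inv_into_f_f)
  have surj: "\<exists>x\<in>carrier V. y = f x" if "y \<in> carrier W" for y
    using assms(3) that by (auto simp: bij_betw_def)
  show ?thesis
  proof (rule lin_mapsI)
    fix y assume "y \<in> carrier W"
    then obtain x where "x \<in> carrier V" "y = f x" using surj by blast
    then show "restrict ?g (carrier W) y \<in> carrier V" by (simp add: f g)
  next
    fix y y' assume "y \<in> carrier W" "y' \<in> carrier W"
    then obtain x x' where "x \<in> carrier V" "y = f x" "x' \<in> carrier V" "y' = f x'" using surj by meson
    then show "restrict ?g (carrier W) (y \<oplus>\<^bsub>W\<^esub> y') = restrict ?g (carrier W) y \<oplus>\<^bsub>V\<^esub> restrict ?g (carrier W) y'"
      by (simp add: f(1) f(2)[symmetric] g V)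
  next
    fix c y assume c: "c \<in> carrier R" and "y \<in> carrier W"
    then obtain x where "x \<in> carrier V" "y = f x" using surj by blast
    then show "restrict ?g (carrier W) (c \<odot>\<^bsub>W\<^esub> y) = c \<odot>\<^bsub>V\<^esub> restrict ?g (carrier W) y"
      using c by (simp add: f(1) f(3)[symmetric] g V)
  qed simp
qed

lemma invertible_lin_map_iff:
  assumes "left_module R V"
  shows "invertible_lin_map R V W f \<longleftrightarrow> f \<in> lin_maps R V W \<and> bij_betw f (carrier V) (carrier W)"
proof safe
  assume f: "invertible_lin_map R V W f"
  then show "f \<in> lin_maps R V W" by (simp add: invertible_lin_map_def)
  obtain g where g: "g \<in> lin_maps R W V" "\<forall>x\<in>carrier V. g (f x) = x" "\<forall>y\<in>carrier W. f (g y) = y"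
    using f by (auto simp: invertible_lin_map_def)
  show "bij_betw f (carrier V) (carrier W)"
    by (rule bij_betwI[of _ _ _ g]) (use f g in \<open>auto simp: invertible_lin_map_def lin_maps_iff\<close>)
next
  assume f: "f \<in> lin_maps R V W" "bij_betw f (carrier V) (carrier W)"
  show "invertible_lin_map R V W f"
    unfolding invertible_lin_map_def using f lin_maps_inverse[OF assms f] lin_mapsD(1)[OF f(1)]
    by (intro conjI bexI[of _ "restrict (inv_into (carrier V) f) (carrier W)"])
      (auto simp: bij_betw_def inv_into_f_f f_inv_into_f)
qed

lemma lin_maps_add:
  assumes "left_module R V" "left_module R W" "f \<in> lin_maps R V W" "g \<in> lin_maps R V W"
  shows "(\<lambda>x\<in>carrier V. f x \<oplus>\<^bsub>W\<^esub> g x) \<in> lin_maps R V W"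
proof -
  interpret W: abelian_group W by (rule left_module_abelian_group) fact
  note f = lin_mapsD[OF assms(3)] and g = lin_mapsD[OF assms(4)]
  show ?thesis
    by (rule lin_mapsI)
      (simp_all add: left_module_closed[OF assms(1)] f(1-3) g(1-3) W.a_ac left_module.act_add_right[OF assms(2)])
qed

lemma left_module_act_zero:
  assumes "left_module R M" "a \<in> carrier R"
  shows "a \<odot>\<^bsub>M\<^esub> \<zero>\<^bsub>M\<^esub> = \<zero>\<^bsub>M\<^esub>"
proof -
  interpret M: abelian_group M by (rule left_module_abelian_group) fact
  have "a \<odot>\<^bsub>M\<^esub> \<zero>\<^bsub>M\<^esub> \<oplus>\<^bsub>M\<^esub> a \<odot>\<^bsub>M\<^esub> \<zero>\<^bsub>M\<^esub> = a \<odot>\<^bsub>M\<^esub> \<zero>\<^bsub>M\<^esub>"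
    using left_module.act_add_right[OF assms, of "\<zero>\<^bsub>M\<^esub>" "\<zero>\<^bsub>M\<^esub>"] by simp
  then show ?thesis using left_module_closed[OF assms(1)] assms(2) M.add.l_cancel_one by simp
qed

lemma left_module_zero_act:
  assumes "left_module R M" "x \<in> carrier M"
  shows "\<zero>\<^bsub>R\<^esub> \<odot>\<^bsub>M\<^esub> x = \<zero>\<^bsub>M\<^esub>"
proof -
  interpret R: ring R by (rule left_module.axioms(1)) fact
  interpret M: abelian_group M by (rule left_module_abelian_group) fact
  have "\<zero>\<^bsub>R\<^esub> \<odot>\<^bsub>M\<^esub> x \<oplus>\<^bsub>M\<^esub> \<zero>\<^bsub>R\<^esub> \<odot>\<^bsub>M\<^esub> x = \<zero>\<^bsub>R\<^esub> \<odot>\<^bsub>M\<^esub> x"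
    using left_module.act_add_left[OF assms(1) R.zero_closed R.zero_closed assms(2)] by simp
  then show ?thesis using left_module_closed[OF assms(1)] assms(2) M.add.l_cancel_one by simp
qed

lemma left_module_act_minus:
  assumes "left_module R M" "a \<in> carrier R" "x \<in> carrier M"
  shows "a \<odot>\<^bsub>M\<^esub> (\<ominus>\<^bsub>M\<^esub> x) = \<ominus>\<^bsub>M\<^esub> (a \<odot>\<^bsub>M\<^esub> x)"
proof -
  interpret M: abelian_group M by (rule left_module_abelian_group) fact
  have "a \<odot>\<^bsub>M\<^esub> (\<ominus>\<^bsub>M\<^esub> x) \<oplus>\<^bsub>M\<^esub> a \<odot>\<^bsub>M\<^esub> x = \<zero>\<^bsub>M\<^esub>"
    using left_module.act_add_right[OF assms(1,2), of "\<ominus>\<^bsub>M\<^esub> x" x] assms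
    by (simp add: M.l_neg left_module_act_zero)
  then show ?thesis using assms left_module_closed(3)[OF assms(1)] by (simp add: M.minus_equality)
qed

lemma lin_maps_const_zero:
  assumes "left_module R V" "left_module R W"
  shows "(\<lambda>x\<in>carrier V. \<zero>\<^bsub>W\<^esub>) \<in> lin_maps R V W"
proof -
  interpret W: abelian_group W by (rule left_module_abelian_group) fact
  show ?thesis by (rule lin_mapsI)
    (simp_all add: left_module_closed[OF assms(1)] left_module_act_zero[OF assms(2)])
qed

lemma lin_maps_uminus:
  assumes "left_module R V" "left_module R W" "f \<in> lin_maps R V W"
  shows "(\<lambda>x\<in>carrier V. \<ominus>\<^bsub>W\<^esub> f x) \<in> lin_maps R V W"
proof -
  interpret W: abelian_group W by (rule left_module_abelian_group) fact
  note f = lin_mapsD[OF assms(3)]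
  show ?thesis by (rule lin_mapsI)
    (simp_all add: left_module_closed[OF assms(1)] f(1-3) W.minus_add left_module_act_minus[OF assms(2)])
qed

lemma vectorspace_left_module: "vectorspace R V \<Longrightarrow> left_module R V"
proof -
  assume "vectorspace R V"
  then interpret vectorspace R V .
  show ?thesis
    by (intro left_module.intro left_module_axioms.intro R.ring_axioms M.abelian_group_axioms)
      (simp_all add: smult_l_distr smult_r_distr smult_assoc1)
qed

lemma left_module_class_ring_vectorspace:
  "left_module class_ring V \<Longrightarrow> vectorspace (class_ring :: 'k::field ring) V"
proof -
  assume V: "left_module (class_ring :: 'k ring) V"
  have "Module.module class_ring V"
    using left_module_closed[OF V] left_module.act_add_left[OF V] left_module.act_add_right[OF V]
      left_module.act_mult[OF V] left_module.act_one[OF V]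
    by (intro moduleI class_cring.cring_axioms left_module_abelian_group[OF V]) auto
  then show ?thesis by (intro vectorspace.intro class_field.field_axioms)
qed

section \<open>Finite dimensional spaces\<close>

lemma fd_space_surjective_image:
  fixes V :: "('k::field, 'v) module" and W :: "('k, 'w) module"
  assumes V: "fd_space V" and W: "vectorspace class_ring W"
    and f: "f \<in> LinearCombinations.module_hom class_ring V W" "f ` carrier V = carrier W"
  shows "fd_space W"
proof -
  interpret V: vectorspace class_ring V using V by (simp add: fd_space_def)
  interpret W: vectorspace class_ring W by fact
  interpret f: linear_map class_ring V W f
    by (intro linear_map.intro mod_hom.intro mod_hom_axioms.intro f(1)) unfold_locales
  show ?thesis using f.surj_fin_dim f(2) V W by (simp add: fd_space_def)
qed

lemma vectorspace_subspace:
  assumes "vectorspace K V" "submodule K N V"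
  shows "vectorspace K (V\<lparr>carrier := N\<rparr>)"
  using assms by (intro vectorspace.subspace_is_vs VectorSpace.subspace.intro)

text \<open>A maximal linearly independent subset of a subspace exists, since the dimension of the whole
  space bounds the size of such subsets; it spans the subspace.\<close>

lemma fd_space_subspace:
  fixes V :: "('k::field, 'v) module"
  assumes V: "fd_space V" and N: "submodule class_ring N V"
  shows "fd_space (V\<lparr>carrier := N\<rparr>)"
proof -
  interpret V: vectorspace class_ring V using V by (simp add: fd_space_def)
  have NV: "vectorspace class_ring (V\<lparr>carrier := N\<rparr>)" by (rule vectorspace_subspace[OF _ N]) unfold_locales
  interpret N: vectorspace class_ring "V\<lparr>carrier := N\<rparr>" by (rule NV)
  have fd: "V.fin_dim" using V by (simp add: fd_space_def)
  have sub: "N \<subseteq> carrier V" using N by (rule submodule.subset)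
  have bound: "finite S \<and> card S \<le> V.dim" if "S \<subseteq> N \<and> N.lin_indpt S" for S
  proof -
    have "V.lin_indpt S" using that V.span_li_not_depend(2)[OF _ N] by blast
    then show ?thesis using V.li_le_dim[OF fd, of S] V.fin_dim_li_fin[OF fd, of S] that sub by blast
  qed
  have "{} \<subseteq> N \<and> N.lin_indpt {}" by (auto simp: N.lin_dep_def)
  from maximal_exists[of "\<lambda>S. S \<subseteq> N \<and> N.lin_indpt S", OF bound this]
  obtain S where S: "finite S" "maximal S (\<lambda>S. S \<subseteq> N \<and> N.lin_indpt S)" by blast
  then have "N.gen_set S" by (intro N.max_li_is_gen) simp
  moreover have "S \<subseteq> N" using S(2) by (simp add: maximal_def)
  ultimately have "N.fin_dim" using S(1) unfolding N.fin_dim_def by auto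
  then show ?thesis using NV by (simp add: fd_space_def)
qed

text \<open>A space that embeds linearly is isomorphic to its image, a subspace.\<close>

lemma fd_space_injective:
  fixes V :: "('k::field, 'v) module" and W :: "('k, 'w) module"
  assumes W: "fd_space W" and V: "vectorspace class_ring V"
    and f: "f \<in> lin_maps class_ring V W" and inj: "inj_on f (carrier V)"
  shows "fd_space V"
proof -
  interpret V: vectorspace class_ring V by fact
  interpret W: vectorspace class_ring W using W by (simp add: fd_space_def)
  let ?U = "W\<lparr>carrier := f ` carrier V\<rparr>"
  have f': "f \<in> LinearCombinations.module_hom class_ring V W" using f by (simp add: lin_maps_def)
  interpret f: mod_hom class_ring V W f
    by (intro mod_hom.intro mod_hom_axioms.intro f') unfold_locales
  have U: "fd_space ?U" using f.im_is_submodule by (intro fd_space_subspace[OF W]) (simp add: f.im_def)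
  have fU: "f \<in> lin_maps class_ring V ?U" "bij_betw f (carrier V) (carrier ?U)"
    using f inj by (auto simp: lin_maps_iff bij_betw_def)
  note g = lin_maps_inverse[OF vectorspace_left_module[OF V] fU]
  show ?thesis
  proof (rule fd_space_surjective_image[OF U V])
    show "restrict (inv_into (carrier V) f) (carrier ?U) \<in> LinearCombinations.module_hom class_ring ?U V"
      using g by (simp add: lin_maps_def)
    show "restrict (inv_into (carrier V) f) (carrier ?U) ` carrier ?U = carrier V"
      using inj by (simp add: inv_into_image_cancel)
  qed
qed

text \<open>The span of a set is the smallest submodule that contains it; phrased in this way, finite
  dimensionality can be verified without linear combinations.\<close>

lemma fd_space_iff_generated:
  fixes V :: "('k::field, 'v) module"
  shows "fd_space V \<longleftrightarrow> vectorspace class_ring V \<and>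
    (\<exists>S. finite S \<and> S \<subseteq> carrier V \<and> (\<forall>N. submodule class_ring N V \<and> S \<subseteq> N \<longrightarrow> carrier V \<subseteq> N))"
proof (cases "vectorspace (class_ring :: 'k ring) V")
  case True
  then interpret V: vectorspace class_ring V .
  have "V.fin_dim \<longleftrightarrow> (\<exists>S. finite S \<and> S \<subseteq> carrier V \<and>
      (\<forall>N. submodule class_ring N V \<and> S \<subseteq> N \<longrightarrow> carrier V \<subseteq> N))" (is "_ \<longleftrightarrow> ?R")
  proof
    assume "V.fin_dim"
    then obtain S where S: "finite S" "S \<subseteq> carrier V" "V.gen_set S" by (auto simp: V.fin_dim_def)
    then show ?R by (metis V.span_is_subset)
  next
    assume ?R
    then obtain S where S: "finite S" "S \<subseteq> carrier V"
      "\<forall>N. submodule class_ring N V \<and> S \<subseteq> N \<longrightarrow> carrier V \<subseteq> N"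
      by (elim exE conjE)
    have "carrier V \<subseteq> V.span S"
      by (rule S(3)[rule_format]) (intro conjI V.span_is_submodule[OF S(2)] V.in_own_span[OF S(2)])
    then have "V.gen_set S" using V.span_is_subset2[OF S(2)] by blast
    then show "V.fin_dim" using S unfolding V.fin_dim_def by blast
  qed
  then show ?thesis using True by (simp add: fd_space_def)
qed (simp add: fd_space_def)

definition prod_module :: "('r, 'v) module \<Rightarrow> ('r, 'w) module \<Rightarrow> ('r, 'v \<times> 'w) module" where
  "prod_module M N = \<lparr>carrier = carrier M \<times> carrier N, mult = undefined, one = undefined,
    zero = (\<zero>\<^bsub>M\<^esub>, \<zero>\<^bsub>N\<^esub>), add = (\<lambda>x y. (fst x \<oplus>\<^bsub>M\<^esub> fst y, snd x \<oplus>\<^bsub>N\<^esub> snd y)),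
    smult = (\<lambda>a x. (a \<odot>\<^bsub>M\<^esub> fst x, a \<odot>\<^bsub>N\<^esub> snd x))\<rparr>"

lemma prod_module_simps [simp]:
  "carrier (prod_module M N) = carrier M \<times> carrier N" "\<zero>\<^bsub>prod_module M N\<^esub> = (\<zero>\<^bsub>M\<^esub>, \<zero>\<^bsub>N\<^esub>)"
  "x \<oplus>\<^bsub>prod_module M N\<^esub> y = (fst x \<oplus>\<^bsub>M\<^esub> fst y, snd x \<oplus>\<^bsub>N\<^esub> snd y)"
  "a \<odot>\<^bsub>prod_module M N\<^esub> x = (a \<odot>\<^bsub>M\<^esub> fst x, a \<odot>\<^bsub>N\<^esub> snd x)"
  by (simp_all add: prod_module_def)

lemma left_module_prod:
  assumes M: "left_module R M" and N: "left_module R N"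
  shows "left_module R (prod_module M N)"
proof -
  interpret M: abelian_group M by (rule left_module_abelian_group) fact
  interpret N: abelian_group N by (rule left_module_abelian_group) fact
  have "abelian_group (prod_module M N)"
  proof (rule abelian_groupI)
    fix x assume "x \<in> carrier (prod_module M N)"
    then show "\<exists>y\<in>carrier (prod_module M N). y \<oplus>\<^bsub>prod_module M N\<^esub> x = \<zero>\<^bsub>prod_module M N\<^esub>"
      by (intro bexI[of _ "(\<ominus>\<^bsub>M\<^esub> fst x, \<ominus>\<^bsub>N\<^esub> snd x)"]) (auto simp: M.l_neg N.l_neg)
  qed (auto simp: M.a_ac N.a_ac)
  then show ?thesis
    using left_module_closed[OF M] left_module_closed[OF N]
    by (intro left_module.intro left_module_axioms.intro left_module.axioms(1)[OF M])
      (auto simp: left_module.act_add_left[OF M] left_module.act_add_left[OF N]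
        left_module.act_add_right[OF M] left_module.act_add_right[OF N] left_module.act_mult[OF M]
        left_module.act_mult[OF N] left_module.act_one[OF M] left_module.act_one[OF N])
qed

lemma submoduleI:
  fixes V :: "('k::field, 'v) module"
  assumes "vectorspace class_ring V" "N \<subseteq> carrier V" "\<zero>\<^bsub>V\<^esub> \<in> N"
    "\<And>x y. x \<in> N \<Longrightarrow> y \<in> N \<Longrightarrow> x \<oplus>\<^bsub>V\<^esub> y \<in> N" "\<And>c x. x \<in> N \<Longrightarrow> c \<odot>\<^bsub>V\<^esub> x \<in> N"
  shows "submodule class_ring N V"
  using assms by (intro submodule.intro) (auto simp: vectorspace_def)

text \<open>If \<open>S\<close> and \<open>T\<close> generate the two spaces, then \<open>S \<times> 0\<close> and \<open>0 \<times> T\<close> together generate the product: a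
  submodule that contains them contains the two axes, and each vector is the sum of its projections
  to the axes.\<close>

lemma fd_space_prod:
  fixes V :: "('k::field, 'v) module" and W :: "('k, 'w) module"
  assumes V: "fd_space V" and W: "fd_space W"
  shows "fd_space (prod_module V W)"
proof -
  have Vv: "vectorspace class_ring V" and Wv: "vectorspace class_ring W" using V W by (simp_all add: fd_space_def)
  interpret V: vectorspace class_ring V by fact
  interpret W: vectorspace class_ring W by fact
  obtain S where S: "finite S" "S \<subseteq> carrier V"
    "\<forall>N. submodule class_ring N V \<and> S \<subseteq> N \<longrightarrow> carrier V \<subseteq> N"
    using V[unfolded fd_space_iff_generated] by (elim conjE exE)
  obtain T where T: "finite T" "T \<subseteq> carrier W"
    "\<forall>N. submodule class_ring N W \<and> T \<subseteq> N \<longrightarrow> carrier W \<subseteq> N"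
    using W[unfolded fd_space_iff_generated] by (elim conjE exE)
  have P: "vectorspace class_ring (prod_module V W)"
    by (rule left_module_class_ring_vectorspace[OF left_module_prod[OF
      vectorspace_left_module[OF Vv] vectorspace_left_module[OF Wv]]])
  let ?U = "(\<lambda>x. (x, \<zero>\<^bsub>W\<^esub>)) ` S \<union> (\<lambda>y. (\<zero>\<^bsub>V\<^esub>, y)) ` T"
  have gen: "carrier (prod_module V W) \<subseteq> N" if N: "submodule class_ring N (prod_module V W)" and U: "?U \<subseteq> N" for N
  proof -
    interpret N: submodule class_ring N "prod_module V W" by (rule N)
    have z: "(\<zero>\<^bsub>V\<^esub>, \<zero>\<^bsub>W\<^esub>) \<in> N" using N.zero_closed by simp
    have ad: "(x \<oplus>\<^bsub>V\<^esub> x', y \<oplus>\<^bsub>W\<^esub> y') \<in> N" if "(x, y) \<in> N" "(x', y') \<in> N" for x x' y y'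
      using N.m_closed[OF that] by simp
    have sm: "(c \<odot>\<^bsub>V\<^esub> x, c \<odot>\<^bsub>W\<^esub> y) \<in> N" if "(x, y) \<in> N" for c x y
      using N.smult_closed[OF _ that, of c] by simp
    have V0: "c \<odot>\<^bsub>V\<^esub> \<zero>\<^bsub>V\<^esub> = \<zero>\<^bsub>V\<^esub>" "c \<odot>\<^bsub>W\<^esub> \<zero>\<^bsub>W\<^esub> = \<zero>\<^bsub>W\<^esub>" for c
      using V.smult_r_null[of c] W.smult_r_null[of c] by simp_all
    have Vc: "c \<odot>\<^bsub>V\<^esub> x \<in> carrier V" if "x \<in> carrier V" for c x using V.smult_closed[of c x] that by simp
    have Wc: "c \<odot>\<^bsub>W\<^esub> x \<in> carrier W" if "x \<in> carrier W" for c x using W.smult_closed[of c x] that by simp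
    \<comment> \<open>the part of \<open>N\<close> on an axis is a submodule of the factor, and contains its generators\<close>
    have "submodule class_ring {x \<in> carrier V. (x, \<zero>\<^bsub>W\<^esub>) \<in> N} V"
      by (rule submoduleI[OF Vv]) (use z ad[of _ "\<zero>\<^bsub>W\<^esub>" _ "\<zero>\<^bsub>W\<^esub>"] sm[of _ "\<zero>\<^bsub>W\<^esub>"] in \<open>auto simp: V0 Vc\<close>)
    then have "carrier V \<subseteq> {x \<in> carrier V. (x, \<zero>\<^bsub>W\<^esub>) \<in> N}"
      using S(2) U by (intro S(3)[rule_format]) auto
    then have 1: "(x, \<zero>\<^bsub>W\<^esub>) \<in> N" if "x \<in> carrier V" for x using that by blast
    have "submodule class_ring {y \<in> carrier W. (\<zero>\<^bsub>V\<^esub>, y) \<in> N} W"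
      by (rule submoduleI[OF Wv]) (use z ad[of "\<zero>\<^bsub>V\<^esub>" _ "\<zero>\<^bsub>V\<^esub>"] sm[of "\<zero>\<^bsub>V\<^esub>"] in \<open>auto simp: V0 Wc\<close>)
    then have "carrier W \<subseteq> {y \<in> carrier W. (\<zero>\<^bsub>V\<^esub>, y) \<in> N}"
      using T(2) U by (intro T(3)[rule_format]) auto
    then have 2: "(\<zero>\<^bsub>V\<^esub>, y) \<in> N" if "y \<in> carrier W" for y using that by blast
    show ?thesis using ad[OF 1 2] by auto
  qed
  have U: "finite ?U" "?U \<subseteq> carrier (prod_module V W)" using S(1,2) T(1,2) by auto
  show ?thesis
    unfolding fd_space_iff_generated by (intro conjI P exI[of _ ?U] U allI impI gen) (elim conjE, assumption)+
qed

text \<open>Over a finite field, \<open>1\<close> plus the product of all \<open>X - a\<close> would have no root.\<close>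

lemma infinite_UNIV_alg_closed_field: "infinite (UNIV :: 'k::alg_closed_field set)"
proof
  assume fin: "finite (UNIV :: 'k set)"
  define p :: "'k poly" where "p = (\<Prod>a\<in>UNIV. [:- a, 1:]) + 1"
  have "poly p x = 1" for x
    using fin by (auto simp: p_def poly_prod prod_zero_iff)
  moreover have "degree (\<Prod>a\<in>(UNIV::'k set). [:- a, 1:]) = card (UNIV :: 'k set)"
    by (subst degree_prod_eq_sum_degree) auto
  then have "degree p > 0"
    unfolding p_def using fin by (subst degree_add_eq_left) (auto simp: card_gt_0_iff)
  ultimately show False using alg_closed_imp_poly_has_root[of p] by auto
qed

lemma prod_inj_of_infinite:
  assumes "infinite (UNIV :: 'k set)"
  obtains g :: "'k \<times> 'k \<Rightarrow> 'k" where "inj g"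
  using card_of_Times_same_infinite[OF assms] card_of_ordIso[of "UNIV \<times> UNIV" "UNIV :: 'k set"]
  by (auto simp: bij_betw_def)

text \<open>Coordinates embed a finite dimensional space into a power of the field, and over an infinite
  field a power embeds into the field itself.\<close>

lemma fd_space_embeds_in_field:
  fixes V :: "('k::field, 'v) module"
  assumes inf: "infinite (UNIV :: 'k set)" and V: "fd_space V"
  obtains h :: "'v \<Rightarrow> 'k" where "inj_on h (carrier V)"
proof -
  interpret V: vectorspace class_ring V using V by (simp add: fd_space_def)
  obtain g :: "'k \<times> 'k \<Rightarrow> 'k" where g: "inj g" using prod_inj_of_infinite[OF inf] .
  \<comment> \<open>a list of known length is recovered from iterated pairing of its entries\<close>
  define code :: "'k list \<Rightarrow> 'k" where "code xs = foldr (\<lambda>x y. g (x, y)) xs 0" for xs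
  have code: "code xs = code ys \<Longrightarrow> xs = ys" if "length xs = length ys" for xs ys
    using that by (induction rule: list_induct2) (auto simp: code_def dest: injD[OF g])
  obtain S where S: "finite S" "S \<subseteq> carrier V" "V.gen_set S"
    using V by (auto simp: fd_space_def V.fin_dim_def)
  obtain ss where ss: "set ss = S" using finite_list[OF S(1)] by blast
  have "\<exists>c. V.lincomb c S = x" if "x \<in> carrier V" for x
    using that S V.finite_in_span[OF S(1,2)] by blast
  then obtain c where c: "\<And>x. x \<in> carrier V \<Longrightarrow> V.lincomb (c x) S = x" by metis
  have "inj_on (\<lambda>x. code (map (c x) ss)) (carrier V)"
  proof (rule inj_onI)
    fix x y assume xy: "x \<in> carrier V" "y \<in> carrier V" "code (map (c x) ss) = code (map (c y) ss)"
    then have "\<And>v. v \<in> S \<Longrightarrow> c x v = c y v" using code[of "map (c x) ss" "map (c y) ss"] ss by auto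
    then have "V.lincomb (c x) S = V.lincomb (c y) S" using S by (intro V.lincomb_cong) auto
    then show "x = y" using c xy by metis
  qed
  then show ?thesis using that by blast
qed

section \<open>Submodules, images and factorisation of linear maps\<close>

lemma left_module_restrict_carrier:
  assumes M: "left_module R M"
    and N: "N \<subseteq> carrier M" "\<zero>\<^bsub>M\<^esub> \<in> N" "\<And>x y. x \<in> N \<Longrightarrow> y \<in> N \<Longrightarrow> x \<oplus>\<^bsub>M\<^esub> y \<in> N"
      "\<And>a x. a \<in> carrier R \<Longrightarrow> x \<in> N \<Longrightarrow> a \<odot>\<^bsub>M\<^esub> x \<in> N"
  shows "left_module R (M\<lparr>carrier := N\<rparr>)"
proof -
  interpret R: ring R by (rule left_module.axioms(1)) fact
  interpret M: abelian_group M by (rule left_module_abelian_group) fact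
  have NM: "x \<in> carrier M" if "x \<in> N" for x using N(1) that by blast
  \<comment> \<open>additive inverses come for free, as multiples by \<open>- 1\<close>\<close>
  have neg: "(\<ominus>\<^bsub>R\<^esub> \<one>\<^bsub>R\<^esub>) \<odot>\<^bsub>M\<^esub> x \<oplus>\<^bsub>M\<^esub> x = \<zero>\<^bsub>M\<^esub>" if "x \<in> N" for x
    using left_module.act_add_left[OF M, of "\<ominus>\<^bsub>R\<^esub> \<one>\<^bsub>R\<^esub>" "\<one>\<^bsub>R\<^esub>" x] NM[OF that]
    by (simp add: R.l_neg left_module.act_one[OF M] left_module_zero_act[OF M])
  have "abelian_group (M\<lparr>carrier := N\<rparr>)"
  proof (rule abelian_groupI)
    fix x assume "x \<in> carrier (M\<lparr>carrier := N\<rparr>)"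
    then show "\<exists>y\<in>carrier (M\<lparr>carrier := N\<rparr>). y \<oplus>\<^bsub>M\<lparr>carrier := N\<rparr>\<^esub> x = \<zero>\<^bsub>M\<lparr>carrier := N\<rparr>\<^esub>"
      using neg N(4) by (intro bexI[of _ "(\<ominus>\<^bsub>R\<^esub> \<one>\<^bsub>R\<^esub>) \<odot>\<^bsub>M\<^esub> x"]) simp_all
  qed (simp_all add: N NM M.a_ac)
  then show ?thesis
    by (intro left_module.intro left_module_axioms.intro R.ring_axioms)
      (simp_all add: N NM left_module.act_add_left[OF M] left_module.act_add_right[OF M]
        left_module.act_mult[OF M] left_module.act_one[OF M])
qed

text \<open>Transport of the module structure along a surjection \<open>h\<close> whose fibres are the classes of a
  congruence. An injective \<open>h\<close> moves a module into another universe; a choice of coset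
  representatives realises a quotient module inside the given universe.\<close>

definition image_module :: "('v \<Rightarrow> 'w) \<Rightarrow> ('r, 'v) module \<Rightarrow> ('r, 'w) module" where
  "image_module h M = (let g = inv_into (carrier M) h in
    \<lparr>carrier = h ` carrier M, mult = undefined, one = undefined, zero = h \<zero>\<^bsub>M\<^esub>,
     add = (\<lambda>x y. h (g x \<oplus>\<^bsub>M\<^esub> g y)), smult = (\<lambda>a x. h (a \<odot>\<^bsub>M\<^esub> g x))\<rparr>)"

lemma image_module:
  assumes M: "left_module R M"
    and add: "\<And>x x' y y'. \<lbrakk>x \<in> carrier M; x' \<in> carrier M; y \<in> carrier M; y' \<in> carrier M;
      h x = h x'; h y = h y'\<rbrakk> \<Longrightarrow> h (x \<oplus>\<^bsub>M\<^esub> y) = h (x' \<oplus>\<^bsub>M\<^esub> y')"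
    and act: "\<And>a x x'. \<lbrakk>a \<in> carrier R; x \<in> carrier M; x' \<in> carrier M; h x = h x'\<rbrakk>
      \<Longrightarrow> h (a \<odot>\<^bsub>M\<^esub> x) = h (a \<odot>\<^bsub>M\<^esub> x')"
  shows "left_module R (image_module h M)"
    and "restrict h (carrier M) \<in> lin_maps R M (image_module h M)"
    and "carrier (image_module h M) = h ` carrier M"
    and "\<zero>\<^bsub>image_module h M\<^esub> = h \<zero>\<^bsub>M\<^esub>"
proof -
  interpret M: abelian_group M by (rule left_module_abelian_group) fact
  interpret R: ring R by (rule left_module.axioms(1)) fact
  let ?I = "image_module h M"
  have c: "carrier ?I = h ` carrier M" by (simp add: image_module_def Let_def)
  then show "carrier ?I = h ` carrier M" .
  have inv: "inv_into (carrier M) h (h x) \<in> carrier M" "h (inv_into (carrier M) h (h x)) = h x"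
    if "x \<in> carrier M" for x using that by (auto intro: inv_into_into f_inv_into_f)
  have z: "\<zero>\<^bsub>?I\<^esub> = h \<zero>\<^bsub>M\<^esub>" by (simp add: image_module_def Let_def)
  then show "\<zero>\<^bsub>?I\<^esub> = h \<zero>\<^bsub>M\<^esub>" .
  have a: "h x \<oplus>\<^bsub>?I\<^esub> h y = h (x \<oplus>\<^bsub>M\<^esub> y)" if "x \<in> carrier M" "y \<in> carrier M" for x y
    using that inv by (auto simp: image_module_def Let_def intro: add)
  have s: "r \<odot>\<^bsub>?I\<^esub> h x = h (r \<odot>\<^bsub>M\<^esub> x)" if "r \<in> carrier R" "x \<in> carrier M" for r x
    using that inv by (auto simp: image_module_def Let_def intro: act)
  note C = left_module_closed[OF M]
  show "restrict h (carrier M) \<in> lin_maps R M ?I"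
    by (rule lin_mapsI) (simp_all add: c a s C)
  have "abelian_group ?I"
  proof (rule abelian_groupI)
    fix x assume "x \<in> carrier ?I"
    then obtain x' where "x' \<in> carrier M" "x = h x'" by (auto simp: c)
    then show "\<exists>y\<in>carrier ?I. y \<oplus>\<^bsub>?I\<^esub> x = \<zero>\<^bsub>?I\<^esub>"
      by (intro bexI[of _ "h (\<ominus>\<^bsub>M\<^esub> x')"]) (simp_all add: a z c M.l_neg)
  qed (auto simp: a z c M.a_ac)
  then show "left_module R ?I"
    by (intro left_module.intro left_module_axioms.intro left_module.axioms(1)[OF M])
      (auto simp: a s c C left_module.act_add_left[OF M] left_module.act_add_right[OF M]
        left_module.act_mult[OF M] left_module.act_one[OF M])
qed

lemma abelian_group_minus_eq_zero_iff:
  assumes "abelian_group G" "x \<in> carrier G" "y \<in> carrier G"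
  shows "x \<ominus>\<^bsub>G\<^esub> y = \<zero>\<^bsub>G\<^esub> \<longleftrightarrow> x = y"
proof -
  interpret G: abelian_group G by fact
  show ?thesis
    using assms(2,3) G.minus_equality[of x "\<ominus>\<^bsub>G\<^esub> y"] by (auto simp: G.minus_eq G.r_neg)
qed

lemma lin_map_eq_iff_diff:
  assumes "left_module R V" "left_module R W" "f \<in> lin_maps R V W" "x \<in> carrier V" "y \<in> carrier V"
  shows "f x = f y \<longleftrightarrow> f (x \<ominus>\<^bsub>V\<^esub> y) = \<zero>\<^bsub>W\<^esub>"
proof -
  interpret V: abelian_group V by (rule left_module_abelian_group) fact
  interpret W: abelian_group W by (rule left_module_abelian_group) fact
  have "f (x \<ominus>\<^bsub>V\<^esub> y) = f x \<ominus>\<^bsub>W\<^esub> f y"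
    by (rule lin_maps_minus[OF V.abelian_group_axioms W.abelian_group_axioms assms(3-5)])
  then show ?thesis using assms(4,5) lin_mapsD(1)[OF assms(3)] by (simp add: abelian_group_minus_eq_zero_iff[OF W.abelian_group_axioms])
qed

lemma lin_map_inj_iff:
  assumes "left_module R V" "left_module R W" "f \<in> lin_maps R V W"
  shows "inj_on f (carrier V) \<longleftrightarrow> (\<forall>x\<in>carrier V. f x = \<zero>\<^bsub>W\<^esub> \<longrightarrow> x = \<zero>\<^bsub>V\<^esub>)"
proof -
  interpret V: abelian_group V by (rule left_module_abelian_group) fact
  interpret W: abelian_group W by (rule left_module_abelian_group) fact
  have f0: "f \<zero>\<^bsub>V\<^esub> = \<zero>\<^bsub>W\<^esub>"
    by (rule lin_maps_zero[OF V.abelian_group_axioms W.abelian_group_axioms assms(3)])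
  show ?thesis
  proof
    assume "inj_on f (carrier V)"
    then show "\<forall>x\<in>carrier V. f x = \<zero>\<^bsub>W\<^esub> \<longrightarrow> x = \<zero>\<^bsub>V\<^esub>"
      using f0 V.zero_closed by (metis inj_onD)
  next
    assume k: "\<forall>x\<in>carrier V. f x = \<zero>\<^bsub>W\<^esub> \<longrightarrow> x = \<zero>\<^bsub>V\<^esub>"
    show "inj_on f (carrier V)"
    proof (rule inj_onI)
      fix x y assume xy: "x \<in> carrier V" "y \<in> carrier V" "f x = f y"
      then have "x \<ominus>\<^bsub>V\<^esub> y = \<zero>\<^bsub>V\<^esub>" using k lin_map_eq_iff_diff[OF assms xy(1,2)] by simp
      then show "x = y" using xy by (simp add: abelian_group_minus_eq_zero_iff[OF V.abelian_group_axioms])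
    qed
  qed
qed

text \<open>Of this lemma and the next, one is the universal property of kernels and the other that of
  cokernels, in terms of elements.\<close>

lemma lin_map_factor_injective:
  assumes U: "left_module R U" and V: "left_module R V" and f: "f \<in> lin_maps R V W" "inj_on f (carrier V)"
    and g: "g \<in> lin_maps R U W" "\<And>u. u \<in> carrier U \<Longrightarrow> g u \<in> f ` carrier V"
  shows "\<exists>!h. h \<in> lin_maps R U V \<and> compose (carrier U) f h = g"
proof (rule ex1I, intro conjI)
  let ?h = "\<lambda>u\<in>carrier U. inv_into (carrier V) f (g u)"
  note fD = lin_mapsD[OF f(1)] and gD = lin_mapsD[OF g(1)]
  have h: "?h u \<in> carrier V" "f (?h u) = g u" if "u \<in> carrier U" for u
    using g(2)[OF that] that by (auto intro: inv_into_into f_inv_into_f)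
  have eqI: "x = y" if "x \<in> carrier V" "y \<in> carrier V" "f x = f y" for x y using f(2) that by (auto dest: inj_onD)
  show "?h \<in> lin_maps R U V"
  proof (rule lin_mapsI)
    fix x y assume xy: "x \<in> carrier U" "y \<in> carrier U"
    show "?h (x \<oplus>\<^bsub>U\<^esub> y) = ?h x \<oplus>\<^bsub>V\<^esub> ?h y"
      by (rule eqI) (use xy h left_module_closed[OF U] left_module_closed[OF V] in \<open>simp_all add: fD gD del: restrict_apply\<close>)
  next
    fix c x assume cx: "c \<in> carrier R" "x \<in> carrier U"
    show "?h (c \<odot>\<^bsub>U\<^esub> x) = c \<odot>\<^bsub>V\<^esub> ?h x"
      by (rule eqI) (use cx h left_module_closed[OF U] left_module_closed[OF V] in \<open>simp_all add: fD gD del: restrict_apply\<close>)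
  qed (use h in \<open>simp_all del: restrict_apply\<close>)
  show "compose (carrier U) f ?h = g"
    by (rule extensionalityI[of _ "carrier U"]) (use h gD(4) in \<open>simp_all add: compose_eq del: restrict_apply\<close>)
  fix h' assume h': "h' \<in> lin_maps R U V \<and> compose (carrier U) f h' = g"
  show "h' = ?h"
  proof (rule extensionalityI[of _ "carrier U"])
    fix u assume u: "u \<in> carrier U"
    have "f (h' u) = g u" using h' u by (auto simp: compose_eq)
    then show "h' u = ?h u" using h[OF u] h' u by (intro eqI) (auto dest: lin_mapsD(1))
  qed (use h' lin_mapsD(4) in auto)
qed

lemma lin_map_factor_surjective:
  assumes V: "left_module R V" and W: "left_module R W" and U: "left_module R U"
    and f: "f \<in> lin_maps R V W" "f ` carrier V = carrier W"
    and g: "g \<in> lin_maps R V U" "\<And>x. x \<in> carrier V \<Longrightarrow> f x = \<zero>\<^bsub>W\<^esub> \<Longrightarrow> g x = \<zero>\<^bsub>U\<^esub>"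
  shows "\<exists>!h. h \<in> lin_maps R W U \<and> compose (carrier V) h f = g"
proof (rule ex1I, intro conjI)
  interpret V: abelian_group V by (rule left_module_abelian_group) fact
  let ?h = "\<lambda>y\<in>carrier W. g (inv_into (carrier V) f y)"
  note fD = lin_mapsD[OF f(1)] and gD = lin_mapsD[OF g(1)] and C = left_module_closed[OF V]
  have h: "?h (f x) = g x" if "x \<in> carrier V" for x
  proof -
    \<comment> \<open>the chosen preimage differs from \<open>x\<close> by an element of the kernel of \<open>f\<close>, on which \<open>g\<close> vanishes\<close>
    let ?x = "inv_into (carrier V) f (f x)"
    have x: "?x \<in> carrier V" "f ?x = f x" using that by (auto intro: inv_into_into f_inv_into_f)
    then have "f (?x \<ominus>\<^bsub>V\<^esub> x) = \<zero>\<^bsub>W\<^esub>" using lin_map_eq_iff_diff[OF V W f(1)] that by simp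
    then have "g (?x \<ominus>\<^bsub>V\<^esub> x) = \<zero>\<^bsub>U\<^esub>" using g(2) x that by simp
    then have "g ?x = g x" using lin_map_eq_iff_diff[OF V U g(1)] x that by simp
    then show ?thesis using fD(1) that by simp
  qed
  have surj: "\<exists>x\<in>carrier V. y = f x" if "y \<in> carrier W" for y using f(2) that by blast
  show "?h \<in> lin_maps R W U"
  proof (rule lin_mapsI)
    fix y assume "y \<in> carrier W"
    then obtain x where "x \<in> carrier V" "y = f x" using surj by blast
    then show "?h y \<in> carrier U" by (simp add: h gD del: restrict_apply)
  next
    fix y y' assume "y \<in> carrier W" "y' \<in> carrier W"
    then obtain x x' where "x \<in> carrier V" "y = f x" "x' \<in> carrier V" "y' = f x'" using surj by meson
    then show "?h (y \<oplus>\<^bsub>W\<^esub> y') = ?h y \<oplus>\<^bsub>U\<^esub> ?h y'"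
      by (simp add: h gD fD(2)[symmetric] C del: restrict_apply)
  next
    fix c y assume c: "c \<in> carrier R" and "y \<in> carrier W"
    then obtain x where "x \<in> carrier V" "y = f x" using surj by blast
    then show "?h (c \<odot>\<^bsub>W\<^esub> y) = c \<odot>\<^bsub>U\<^esub> ?h y"
      using c by (simp add: h gD fD(3)[symmetric] C del: restrict_apply)
  qed simp
  show "compose (carrier V) ?h f = g"
    by (rule extensionalityI[of _ "carrier V"]) (use h gD(4) in \<open>simp_all add: compose_eq del: restrict_apply\<close>)
  fix h' assume h': "h' \<in> lin_maps R W U \<and> compose (carrier V) h' f = g"
  show "h' = ?h"
  proof (rule extensionalityI[of _ "carrier W"])
    fix y assume "y \<in> carrier W"
    then obtain x where x: "x \<in> carrier V" "y = f x" using surj by blast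
    then show "h' y = ?h y" using h[OF x(1)] h' by (auto simp: compose_eq simp del: restrict_apply)
  qed (use h' lin_mapsD(4) in auto)
qed

text \<open>The ring of scalars is arbitrary, so this serves for the homomorphisms of modules over an algebra as
  well as for the linear maps at the vertices of a quiver.\<close>

lemma lin_maps_comm_group:
  assumes V: "left_module R V" and W: "left_module R W"
  shows "comm_group \<lparr>carrier = lin_maps R V W, mult = \<lambda>f g. \<lambda>x\<in>carrier V. f x \<oplus>\<^bsub>W\<^esub> g x,
    one = \<lambda>x\<in>carrier V. \<zero>\<^bsub>W\<^esub>\<rparr>"
proof -
  interpret W: abelian_group W by (rule left_module_abelian_group) fact
  show ?thesis
  proof (rule comm_groupI)
    fix f g k assume a: "f \<in> carrier \<lparr>carrier = lin_maps R V W, mult = \<lambda>f g. \<lambda>x\<in>carrier V. f x \<oplus>\<^bsub>W\<^esub> g x,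
    one = \<lambda>x\<in>carrier V. \<zero>\<^bsub>W\<^esub>\<rparr>"
    then have f: "f \<in> lin_maps R V W" by simp
    note fD = lin_mapsD[OF f]
    show "\<exists>g\<in>carrier \<lparr>carrier = lin_maps R V W, mult = \<lambda>f g. \<lambda>x\<in>carrier V. f x \<oplus>\<^bsub>W\<^esub> g x,
        one = \<lambda>x\<in>carrier V. \<zero>\<^bsub>W\<^esub>\<rparr>.
        g \<otimes>\<^bsub>\<lparr>carrier = lin_maps R V W, mult = \<lambda>f g. \<lambda>x\<in>carrier V. f x \<oplus>\<^bsub>W\<^esub> g x,
        one = \<lambda>x\<in>carrier V. \<zero>\<^bsub>W\<^esub>\<rparr>\<^esub> f = \<one>\<^bsub>\<lparr>carrier = lin_maps R V W, mult = \<lambda>f g. \<lambda>x\<in>carrier V. f x \<oplus>\<^bsub>W\<^esub> g x,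
        one = \<lambda>x\<in>carrier V. \<zero>\<^bsub>W\<^esub>\<rparr>\<^esub>"
      using lin_maps_uminus[OF V W f] fD(1)
      by (intro bexI[of _ "\<lambda>x\<in>carrier V. \<ominus>\<^bsub>W\<^esub> f x"]) (auto simp: W.l_neg cong: restrict_cong)
    show "\<one>\<^bsub>\<lparr>carrier = lin_maps R V W, mult = \<lambda>f g. \<lambda>x\<in>carrier V. f x \<oplus>\<^bsub>W\<^esub> g x,
        one = \<lambda>x\<in>carrier V. \<zero>\<^bsub>W\<^esub>\<rparr>\<^esub> \<otimes>\<^bsub>\<lparr>carrier = lin_maps R V W, mult = \<lambda>f g. \<lambda>x\<in>carrier V. f x \<oplus>\<^bsub>W\<^esub> g x,
        one = \<lambda>x\<in>carrier V. \<zero>\<^bsub>W\<^esub>\<rparr>\<^esub> f = f"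
      using fD by (intro extensionalityI[of _ "carrier V" f]) simp_all
  qed (auto simp: lin_maps_add[OF V W] lin_maps_const_zero[OF V W] lin_mapsD(1) W.a_ac intro!: restrict_ext)
qed

section \<open>Modules over an algebra form an abelian category\<close>

lemma underlying_space_simps [simp]:
  "carrier (underlying_space P M) = carrier M" "\<zero>\<^bsub>underlying_space P M\<^esub> = \<zero>\<^bsub>M\<^esub>"
  "x \<oplus>\<^bsub>underlying_space P M\<^esub> y = x \<oplus>\<^bsub>M\<^esub> y"
  "c \<odot>\<^bsub>underlying_space P M\<^esub> x = (c \<odot>\<^bsub>P\<^esub> \<one>\<^bsub>P\<^esub>) \<odot>\<^bsub>M\<^esub> x"
  by (simp_all add: underlying_space_def)

lemma rep_algebra_simps [simp]:
  "Obj (rep_algebra P) = {M. left_module P M \<and> fd_space (underlying_space P M)}"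
  "Hom (rep_algebra P) M N = lin_maps P M N"
  "Idt (rep_algebra P) M = (\<lambda>x\<in>carrier M. x)"
  "Comp (rep_algebra P) L M N g f = compose (carrier L) g f"
  "Hom_add (rep_algebra P) M N f g = (\<lambda>x\<in>carrier M. f x \<oplus>\<^bsub>N\<^esub> g x)"
  "Hom_zero (rep_algebra P) M N = (\<lambda>x\<in>carrier M. \<zero>\<^bsub>N\<^esub>)"
  by (simp_all add: rep_algebra_def)

lemma compose_lin_maps_assoc:
  assumes "f \<in> lin_maps R V W"
  shows "compose (carrier V) h (compose (carrier V) g f) = compose (carrier V) (compose (carrier W) h g) f"
  using lin_mapsD(1)[OF assms] by (auto simp: compose_def intro!: restrict_ext)

lemma compose_lin_maps_id:
  assumes "f \<in> lin_maps R V W"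
  shows "compose (carrier V) (\<lambda>x\<in>carrier W. x) f = f" "compose (carrier V) f (\<lambda>x\<in>carrier V. x) = f"
  using lin_mapsD(1,4)[OF assms] by (auto intro!: extensionalityI[of _ "carrier V" f] simp: compose_eq)

lemma rep_algebra_preadditive:
  "preadditive_category (rep_algebra P :: (('a, 'v) module, 'v \<Rightarrow> 'v) preadditive_category)"
  (is "preadditive_category ?C")
proof (intro preadditive_category.intro category.intro preadditive_category_axioms.intro)
  fix X assume "X \<in> Obj ?C"
  then show "Idt ?C X \<in> Hom ?C X X" by (simp add: lin_maps_id)
next
  fix X Y Z f g assume "X \<in> Obj ?C" "f \<in> Hom ?C X Y" "g \<in> Hom ?C Y Z"
  then show "Comp ?C X Y Z g f \<in> Hom ?C X Z"
    by (simp add: lin_maps_compose[where W = Y])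
next
  fix X Y assume "X \<in> Obj ?C" "Y \<in> Obj ?C"
  then show "comm_group \<lparr>carrier = Hom ?C X Y, mult = Hom_add ?C X Y,
      one = Hom_zero ?C X Y\<rparr>"
    using lin_maps_comm_group[of P X Y] by (simp add: rep_algebra_def)
next
  fix X Y Z f f' g assume "X \<in> Obj ?C" "Y \<in> Obj ?C" "Z \<in> Obj ?C"
    and f: "f \<in> Hom ?C X Y" "f' \<in> Hom ?C X Y" "g \<in> Hom ?C Y Z"
  have [simp]: "f x \<in> carrier Y" "f' x \<in> carrier Y" if "x \<in> carrier X" for x
    using f that by (simp_all add: lin_mapsD(1))
  show "Comp ?C X Y Z g (Hom_add ?C X Y f f') =
      Hom_add ?C X Z (Comp ?C X Y Z g f) (Comp ?C X Y Z g f')"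
    using f by (auto simp: compose_def lin_mapsD(2) intro!: restrict_ext)
next
  fix X Y Z f g g' assume f: "f \<in> Hom ?C X Y"
  then have [simp]: "f x \<in> carrier Y" if "x \<in> carrier X" for x
    using that by (simp add: lin_mapsD(1))
  show "Comp ?C X Y Z (Hom_add ?C Y Z g g') f =
      Hom_add ?C X Z (Comp ?C X Y Z g f) (Comp ?C X Y Z g' f)"
    by (auto simp: compose_def intro!: restrict_ext)
qed (auto simp: compose_lin_maps_id compose_lin_maps_assoc)

context
  fixes P :: "('k::field, 'a) module"
  assumes P: "assoc_algebra class_ring P"
begin

interpretation P: assoc_algebra class_ring P by (rule P)

lemma scalar_in_algebra: "c \<odot>\<^bsub>P\<^esub> \<one>\<^bsub>P\<^esub> \<in> carrier P"
  using P.smult_closed[of c "\<one>\<^bsub>P\<^esub>"] by simp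

lemma underlying_space_left_module:
  assumes M: "left_module P M"
  shows "left_module class_ring (underlying_space P M)"
proof -
  interpret M: abelian_group M by (rule left_module_abelian_group) fact
  have "abelian_group (underlying_space P M)"
  proof (rule abelian_groupI)
    fix x assume "x \<in> carrier (underlying_space P M)"
    then show "\<exists>y\<in>carrier (underlying_space P M). y \<oplus>\<^bsub>underlying_space P M\<^esub> x = \<zero>\<^bsub>underlying_space P M\<^esub>"
      by (intro bexI[of _ "\<ominus>\<^bsub>M\<^esub> x"]) (simp_all add: M.l_neg)
  qed (simp_all add: M.a_ac)
  moreover have "(c + d) \<odot>\<^bsub>P\<^esub> \<one>\<^bsub>P\<^esub> = c \<odot>\<^bsub>P\<^esub> \<one>\<^bsub>P\<^esub> \<oplus>\<^bsub>P\<^esub> d \<odot>\<^bsub>P\<^esub> \<one>\<^bsub>P\<^esub>" for c d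
    using P.smult_l_distr[of c d "\<one>\<^bsub>P\<^esub>"] by simp
  moreover have "(c * d) \<odot>\<^bsub>P\<^esub> \<one>\<^bsub>P\<^esub> = (c \<odot>\<^bsub>P\<^esub> \<one>\<^bsub>P\<^esub>) \<otimes>\<^bsub>P\<^esub> (d \<odot>\<^bsub>P\<^esub> \<one>\<^bsub>P\<^esub>)" for c d
    using P.smult_assoc1[of c d "\<one>\<^bsub>P\<^esub>"] P.smult_mult_left[of c "\<one>\<^bsub>P\<^esub>" "d \<odot>\<^bsub>P\<^esub> \<one>\<^bsub>P\<^esub>"] scalar_in_algebra[of d] by simp
  moreover have "1 \<odot>\<^bsub>P\<^esub> \<one>\<^bsub>P\<^esub> = \<one>\<^bsub>P\<^esub>" using P.smult_one[of "\<one>\<^bsub>P\<^esub>"] by simp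
  ultimately show ?thesis
    by (intro left_module.intro left_module_axioms.intro class_ring.ring_axioms)
      (simp_all add: scalar_in_algebra left_module_closed[OF M] left_module.act_add_left[OF M]
        left_module.act_add_right[OF M] left_module.act_mult[OF M] left_module.act_one[OF M])
qed

lemma underlying_space_vectorspace:
  "left_module P M \<Longrightarrow> vectorspace class_ring (underlying_space P M)"
  by (intro left_module_class_ring_vectorspace underlying_space_left_module)

lemma lin_maps_underlying:
  assumes "f \<in> lin_maps P M N"
  shows "f \<in> lin_maps class_ring (underlying_space P M) (underlying_space P N)"
  using assms scalar_in_algebra by (simp add: lin_maps_iff)

lemma rep_algebra_Obj_surjective:
  assumes "M \<in> Obj (rep_algebra P)" "left_module P N" "f \<in> lin_maps P M N" "f ` carrier M = carrier N"
  shows "N \<in> Obj (rep_algebra P)"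
  using assms lin_maps_underlying[OF assms(3)] fd_space_surjective_image[of "underlying_space P M" "underlying_space P N" f]
  by (simp add: underlying_space_vectorspace lin_maps_def)

lemma rep_algebra_Obj_injective:
  assumes "N \<in> Obj (rep_algebra P)" "left_module P M" "f \<in> lin_maps P M N" "inj_on f (carrier M)"
  shows "M \<in> Obj (rep_algebra P)"
  using assms lin_maps_underlying[OF assms(3)] fd_space_injective[of "underlying_space P N" "underlying_space P M" f]
  by (simp add: underlying_space_vectorspace)

lemma rep_algebra_kernelI:
  assumes X: "X \<in> Obj (rep_algebra P)" "Y \<in> Obj (rep_algebra P)" "f \<in> lin_maps P X Y"
    and K: "K \<in> Obj (rep_algebra P)" "k \<in> lin_maps P K X" "inj_on k (carrier K)"
    and ker: "\<And>x. x \<in> carrier X \<Longrightarrow> f x = \<zero>\<^bsub>Y\<^esub> \<longleftrightarrow> x \<in> k ` carrier K"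
  shows "is_kernel (rep_algebra P) X Y f K k"
  unfolding is_kernel_def
proof (intro conjI ballI impI K(1))
  show "k \<in> Hom (rep_algebra P) K X" using K by simp
  show "Comp (rep_algebra P) K X Y f k = Hom_zero (rep_algebra P) K Y"
    using ker lin_mapsD(1)[OF K(2)] by (auto simp: compose_def intro!: restrict_ext)
  fix Z g assume Z: "Z \<in> Obj (rep_algebra P)" and g: "g \<in> Hom (rep_algebra P) Z X"
    and eq: "Comp (rep_algebra P) Z X Y f g = Hom_zero (rep_algebra P) Z Y"
  have "f (g z) = \<zero>\<^bsub>Y\<^esub>" if "z \<in> carrier Z" for z
    using fun_cong[OF eq, of z] that by (simp add: compose_eq)
  then have "g z \<in> k ` carrier K" if "z \<in> carrier Z" for z
    using ker g that by (simp add: lin_mapsD(1))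
  then have "\<exists>!h. h \<in> lin_maps P Z K \<and> compose (carrier Z) k h = g"
    using Z K g by (intro lin_map_factor_injective) auto
  then show "\<exists>!h. h \<in> Hom (rep_algebra P) Z K \<and> Comp (rep_algebra P) Z K X k h = g" by simp
qed

lemma rep_algebra_cokernelI:
  assumes X: "X \<in> Obj (rep_algebra P)" "Y \<in> Obj (rep_algebra P)" "f \<in> lin_maps P X Y"
    and Q: "Q \<in> Obj (rep_algebra P)" "q \<in> lin_maps P Y Q" "q ` carrier Y = carrier Q"
    and ker: "\<And>y. y \<in> carrier Y \<Longrightarrow> q y = \<zero>\<^bsub>Q\<^esub> \<longleftrightarrow> y \<in> f ` carrier X"
  shows "is_cokernel (rep_algebra P) X Y f Q q"
  unfolding is_cokernel_def
proof (intro conjI ballI impI Q(1))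
  show "q \<in> Hom (rep_algebra P) Y Q" using Q by simp
  show "Comp (rep_algebra P) X Y Q q f = Hom_zero (rep_algebra P) X Q"
    using ker lin_mapsD(1)[OF X(3)] by (auto simp: compose_def intro!: restrict_ext)
  fix Z g assume Z: "Z \<in> Obj (rep_algebra P)" and g: "g \<in> Hom (rep_algebra P) Y Z"
    and eq: "Comp (rep_algebra P) X Y Z g f = Hom_zero (rep_algebra P) X Z"
  have "g (f x) = \<zero>\<^bsub>Z\<^esub>" if "x \<in> carrier X" for x
    using fun_cong[OF eq, of x] that by (simp add: compose_eq)
  then have "\<exists>!h. h \<in> lin_maps P Q Z \<and> compose (carrier Y) h q = g"
    using X Z Q g ker by (intro lin_map_factor_surjective) auto
  then show "\<exists>!h. h \<in> Hom (rep_algebra P) Q Z \<and> Comp (rep_algebra P) Y Q Z h q = g" by simp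
qed

lemma rep_algebra_kernel_exists:
  assumes X: "X \<in> Obj (rep_algebra P)" "Y \<in> Obj (rep_algebra P)" "f \<in> lin_maps P X Y"
  defines "K \<equiv> X\<lparr>carrier := {x \<in> carrier X. f x = \<zero>\<^bsub>Y\<^esub>}\<rparr>"
  shows "K \<in> Obj (rep_algebra P)" "(\<lambda>x\<in>carrier K. x) \<in> lin_maps P K X"
    "is_kernel (rep_algebra P) X Y f K (\<lambda>x\<in>carrier K. x)"
proof -
  have M: "left_module P X" "left_module P Y" using X by simp_all
  interpret Y: abelian_group Y by (rule left_module_abelian_group) fact
  note fD = lin_mapsD[OF X(3)]
  have K: "left_module P K"
    unfolding K_def
    by (rule left_module_restrict_carrier[OF M(1)])
      (use lin_maps_zero[OF M(1)[THEN left_module_abelian_group] M(2)[THEN left_module_abelian_group] X(3)] in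
        \<open>auto simp: fD left_module_closed[OF M(1)] left_module_act_zero[OF M(2)]\<close>)
  show k: "(\<lambda>x\<in>carrier K. x) \<in> lin_maps P K X"
    using left_module_closed[OF K] by (auto simp: lin_maps_iff) (simp_all add: K_def)
  have inj: "inj_on (\<lambda>x\<in>carrier K. x) (carrier K)" by (simp add: inj_on_def)
  show K': "K \<in> Obj (rep_algebra P)" by (rule rep_algebra_Obj_injective[OF X(1) K k inj])
  show "is_kernel (rep_algebra P) X Y f K (\<lambda>x\<in>carrier K. x)"
    by (rule rep_algebra_kernelI[OF X K' k inj]) (auto simp: K_def image_def)
qed

text \<open>The quotient by the image \<open>I\<close> of \<open>f\<close> is realised on a set of coset representatives, hence in the
  same universe as \<open>Y\<close>; \<open>rep\<close> picks the representative of a coset.\<close>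

lemma rep_algebra_cokernel_exists:
  fixes X Y :: "('a, 'v) module"
  assumes X: "X \<in> Obj (rep_algebra P)" "Y \<in> Obj (rep_algebra P)" "f \<in> lin_maps P X Y"
  obtains Q :: "('a, 'v) module" and q where
    "Q \<in> Obj (rep_algebra P)" "q \<in> lin_maps P Y Q" "q ` carrier Y = carrier Q"
    "\<forall>y\<in>carrier Y. q y = \<zero>\<^bsub>Q\<^esub> \<longleftrightarrow> y \<in> f ` carrier X"
proof -
  have M: "left_module P X" "left_module P Y" using X by simp_all
  interpret X: abelian_group X by (rule left_module_abelian_group) fact
  interpret Y: abelian_group Y by (rule left_module_abelian_group) fact
  note fD = lin_mapsD[OF X(3)]
  note f_minus = lin_maps_a_inv[OF X.abelian_group_axioms Y.abelian_group_axioms X(3)]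
    and f_zero = lin_maps_zero[OF X.abelian_group_axioms Y.abelian_group_axioms X(3)]
  define I where "I = f ` carrier X"
  have I: "x \<in> carrier Y" if "x \<in> I" for x using that by (auto simp: I_def fD)
  have I0: "\<zero>\<^bsub>Y\<^esub> \<in> I" unfolding I_def using f_zero by (metis X.zero_closed image_eqI)
  have Iadd: "x \<oplus>\<^bsub>Y\<^esub> y \<in> I" if "x \<in> I" "y \<in> I" for x y
    using that by (auto simp: I_def fD(2)[symmetric])
  have Ineg: "\<ominus>\<^bsub>Y\<^esub> x \<in> I" if "x \<in> I" for x
    using that by (auto simp: I_def f_minus[symmetric])
  have Iact: "a \<odot>\<^bsub>Y\<^esub> x \<in> I" if "a \<in> carrier P" "x \<in> I" for a x
    using that by (auto simp: I_def fD(3)[symmetric] left_module_closed[OF M(1)])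
  define rel where "rel x y \<longleftrightarrow> x \<in> carrier Y \<and> y \<in> carrier Y \<and> y \<ominus>\<^bsub>Y\<^esub> x \<in> I" for x y
  define rep where "rep x = (SOME y. rel x y)" for x
  have rel_refl: "rel x x" if "x \<in> carrier Y" for x using that I0 by (simp add: rel_def Y.minus_eq Y.r_neg)
  have rel_sym: "rel y x" if "rel x y" for x y
  proof -
    have "x \<ominus>\<^bsub>Y\<^esub> y = \<ominus>\<^bsub>Y\<^esub> (y \<ominus>\<^bsub>Y\<^esub> x)" using that by (simp add: rel_def Y.minus_eq Y.minus_add Y.a_comm)
    then show ?thesis using that Ineg by (simp add: rel_def)
  qed
  have rel_trans: "rel x z" if "rel x y" "rel y z" for x y z
  proof -
    have c: "x \<in> carrier Y" "y \<in> carrier Y" "z \<in> carrier Y" using that by (auto simp: rel_def)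
    have "(z \<ominus>\<^bsub>Y\<^esub> y) \<oplus>\<^bsub>Y\<^esub> (y \<ominus>\<^bsub>Y\<^esub> x) = z \<oplus>\<^bsub>Y\<^esub> ((\<ominus>\<^bsub>Y\<^esub> y \<oplus>\<^bsub>Y\<^esub> y) \<oplus>\<^bsub>Y\<^esub> \<ominus>\<^bsub>Y\<^esub> x)"
      using c by (simp add: Y.minus_eq Y.a_assoc)
    then have "z \<ominus>\<^bsub>Y\<^esub> x = (z \<ominus>\<^bsub>Y\<^esub> y) \<oplus>\<^bsub>Y\<^esub> (y \<ominus>\<^bsub>Y\<^esub> x)"
      using c by (simp add: Y.minus_eq Y.l_neg)
    then show ?thesis using that Iadd by (simp add: rel_def)
  qed
  have rel_rep: "rel x (rep x)" if "x \<in> carrier Y" for x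
    unfolding rep_def using rel_refl[OF that] by (rule someI)
  have rep_eq: "rep x = rep y \<longleftrightarrow> rel x y" if "x \<in> carrier Y" "y \<in> carrier Y" for x y
  proof
    assume "rep x = rep y"
    then show "rel x y" using rel_trans[OF rel_rep[OF that(1)]] rel_sym[OF rel_rep[OF that(2)]] by simp
  next
    assume "rel x y"
    then have "rel x = rel y" using rel_trans rel_sym by blast
    then show "rep x = rep y" by (simp add: rep_def)
  qed
  let ?Q = "image_module rep Y" and ?q = "restrict rep (carrier Y)"
  have radd: "rep (x \<oplus>\<^bsub>Y\<^esub> y) = rep (x' \<oplus>\<^bsub>Y\<^esub> y')"
    if c: "x \<in> carrier Y" "x' \<in> carrier Y" "y \<in> carrier Y" "y' \<in> carrier Y" and r: "rep x = rep x'" "rep y = rep y'"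
    for x x' y y'
  proof -
    have "x' \<oplus>\<^bsub>Y\<^esub> y' \<ominus>\<^bsub>Y\<^esub> (x \<oplus>\<^bsub>Y\<^esub> y) = (x' \<ominus>\<^bsub>Y\<^esub> x) \<oplus>\<^bsub>Y\<^esub> (y' \<ominus>\<^bsub>Y\<^esub> y)"
      using c by (simp add: Y.minus_eq Y.minus_add Y.a_ac)
    then show ?thesis using r c Iadd by (simp add: rep_eq rel_def)
  qed
  have ract: "rep (a \<odot>\<^bsub>Y\<^esub> x) = rep (a \<odot>\<^bsub>Y\<^esub> x')"
    if c: "a \<in> carrier P" "x \<in> carrier Y" "x' \<in> carrier Y" and r: "rep x = rep x'" for a x x'
  proof -
    have "a \<odot>\<^bsub>Y\<^esub> x' \<ominus>\<^bsub>Y\<^esub> a \<odot>\<^bsub>Y\<^esub> x = a \<odot>\<^bsub>Y\<^esub> (x' \<ominus>\<^bsub>Y\<^esub> x)"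
      using c by (simp add: Y.minus_eq left_module.act_add_right[OF M(2)] left_module_act_minus[OF M(2)])
    then show ?thesis using r c Iact left_module_closed[OF M(2)] by (simp add: rep_eq rel_def)
  qed
  note im = image_module[of P Y rep, OF M(2) radd ract]
  have Q: "left_module P ?Q" "?q \<in> lin_maps P Y ?Q" "carrier ?Q = rep ` carrier Y" "\<zero>\<^bsub>?Q\<^esub> = rep \<zero>\<^bsub>Y\<^esub>"
    by (rule im; assumption)+
  have q: "?q ` carrier Y = carrier ?Q" by (simp add: Q(3))
  show thesis
  proof (rule that[OF _ Q(2) q]; (intro ballI)?)
    show "?Q \<in> Obj (rep_algebra P)" by (rule rep_algebra_Obj_surjective[OF X(2) Q(1,2) q])
  next
    fix y assume y: "y \<in> carrier Y"
    have "\<ominus>\<^bsub>Y\<^esub> \<zero>\<^bsub>Y\<^esub> = \<zero>\<^bsub>Y\<^esub>" by (rule Y.minus_equality) (rule Y.l_zero Y.zero_closed)+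
    then have "y \<ominus>\<^bsub>Y\<^esub> \<zero>\<^bsub>Y\<^esub> = y" using y by (simp add: Y.minus_eq)
    then have "rel \<zero>\<^bsub>Y\<^esub> y \<longleftrightarrow> y \<in> I" using y by (simp add: rel_def)
    then show "?q y = \<zero>\<^bsub>?Q\<^esub> \<longleftrightarrow> y \<in> f ` carrier X"
      using y rep_eq[of "\<zero>\<^bsub>Y\<^esub>" y] by (auto simp: Q(4) I_def)
  qed
qed

text \<open>The inclusion of the kernel and the zero map have the same composite with \<open>f\<close>.\<close>

lemma rep_algebra_mono_injective:
  assumes X: "X \<in> Obj (rep_algebra P)" "Y \<in> Obj (rep_algebra P)" and f: "is_mono (rep_algebra P) X Y f"
  shows "inj_on f (carrier X)"
proof -
  have M: "left_module P X" "left_module P Y" using X by simp_all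
  have fH: "f \<in> lin_maps P X Y" using f by (simp add: is_mono_def)
  define K where "K = X\<lparr>carrier := {x \<in> carrier X. f x = \<zero>\<^bsub>Y\<^esub>}\<rparr>"
  note K = rep_algebra_kernel_exists[OF X fH, folded K_def]
  have MK: "left_module P K" using K(1) by simp
  interpret X: abelian_group X by (rule left_module_abelian_group) fact
  have f0: "f \<zero>\<^bsub>X\<^esub> = \<zero>\<^bsub>Y\<^esub>"
    by (rule lin_maps_zero[OF M[THEN left_module_abelian_group] fH])
  have eq: "(\<lambda>x\<in>carrier K. x) = (\<lambda>x\<in>carrier K. \<zero>\<^bsub>X\<^esub>)"
  proof (rule f[unfolded is_mono_def, THEN conjunct2, rule_format, OF K(1)])
    show "Comp (rep_algebra P) K X Y f (\<lambda>x\<in>carrier K. x) = Comp (rep_algebra P) K X Y f (\<lambda>x\<in>carrier K. \<zero>\<^bsub>X\<^esub>)"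
      by (auto simp: compose_def f0 K_def intro!: restrict_ext)
  qed (use K(2) lin_maps_const_zero[OF MK M(1)] in simp_all)
  have "x = \<zero>\<^bsub>X\<^esub>" if "x \<in> carrier X" "f x = \<zero>\<^bsub>Y\<^esub>" for x
    using that fun_cong[OF eq, of x] by (simp add: K_def)
  then show ?thesis using lin_map_inj_iff[OF M fH] by blast
qed

text \<open>The projection to the cokernel and the zero map have the same composite with \<open>f\<close>.\<close>

lemma rep_algebra_epi_surjective:
  fixes X Y :: "('a, 'v) module"
  assumes X: "X \<in> Obj (rep_algebra P)" "Y \<in> Obj (rep_algebra P)" and f: "is_epi (rep_algebra P) X Y f"
  shows "f ` carrier X = carrier Y"
proof -
  have M: "left_module P X" "left_module P Y" using X by simp_all
  have fH: "f \<in> lin_maps P X Y" using f by (simp add: is_epi_def)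
  obtain Q :: "('a, 'v) module" and q where Q: "Q \<in> Obj (rep_algebra P)" "q \<in> lin_maps P Y Q" "q ` carrier Y = carrier Q"
      "\<forall>y\<in>carrier Y. q y = \<zero>\<^bsub>Q\<^esub> \<longleftrightarrow> y \<in> f ` carrier X"
    by (rule rep_algebra_cokernel_exists[OF X fH])
  have MQ: "left_module P Q" using Q(1) by simp
  have "q = (\<lambda>y\<in>carrier Y. \<zero>\<^bsub>Q\<^esub>)"
  proof (rule f[unfolded is_epi_def, THEN conjunct2, rule_format, OF Q(1)])
    show "Comp (rep_algebra P) X Y Q q f = Comp (rep_algebra P) X Y Q (\<lambda>y\<in>carrier Y. \<zero>\<^bsub>Q\<^esub>) f"
      using Q(4) lin_mapsD(1)[OF fH] by (auto simp: compose_def intro!: restrict_ext)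
  qed (use Q(2) lin_maps_const_zero[OF M(2) MQ] in simp_all)
  then show ?thesis using Q(4) lin_mapsD(1)[OF fH] by auto
qed

lemma rep_algebra_zero_object: "\<exists>Z. is_zero_object (rep_algebra P :: (('a, 'v) module, 'v \<Rightarrow> 'v) preadditive_category) Z"
proof -
  \<comment> \<open>a one-point module; any element of the universe would do\<close>
  let ?Z = "\<lparr>carrier = {undefined}, mult = undefined, one = undefined, zero = undefined,
    add = \<lambda>_ _. undefined, smult = \<lambda>_ _. undefined\<rparr> :: ('a, 'v) module"
  have "abelian_group ?Z" by (rule abelian_groupI) auto
  then have Z: "left_module P ?Z"
    by (intro left_module.intro left_module_axioms.intro P.ring_axioms) auto
  have "fd_space (underlying_space P ?Z)"
    unfolding fd_space_iff_generated
    by (intro conjI underlying_space_vectorspace Z exI[of _ "{}"] allI impI)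
      (auto dest!: submodule.zero_closed)
  then have "?Z \<in> Obj (rep_algebra P)" using Z by simp
  then show ?thesis
    unfolding preadditive_category.is_zero_object_iff[OF rep_algebra_preadditive]
    by (intro exI[of _ ?Z]) (auto intro!: restrict_ext)
qed

lemma underlying_space_prod_module:
  "underlying_space P (prod_module M N) = prod_module (underlying_space P M) (underlying_space P N)"
  by (simp add: underlying_space_def prod_module_def)

text \<open>The direct sum on pairs has its carrier in \<open>'v \<times> 'v\<close>. Being finite dimensional it injects into the
  field, and from there by \<open>emb\<close> into the universe \<open>'v\<close>; \<open>H\<close> and \<open>K\<close> are the mutually inverse
  isomorphisms between it and its copy.\<close>

lemma rep_algebra_biproduct_exists:
  fixes X Y :: "('a, 'v) module" and emb :: "'k \<Rightarrow> 'v"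
  assumes inf: "infinite (UNIV :: 'k set)" and emb: "inj emb"
    and X: "X \<in> Obj (rep_algebra P)" and Y: "Y \<in> Obj (rep_algebra P)"
  shows "\<exists>B inX inY prX prY. is_biproduct (rep_algebra P) X Y B inX inY prX prY"
proof -
  have M: "left_module P X" "left_module P Y" using X Y by simp_all
  interpret X: abelian_group X by (rule left_module_abelian_group) fact
  interpret Y: abelian_group Y by (rule left_module_abelian_group) fact
  let ?D = "prod_module X Y"
  have D: "left_module P ?D" by (rule left_module_prod[OF M])
  have fd: "fd_space (underlying_space P ?D)"
    unfolding underlying_space_prod_module using X Y by (intro fd_space_prod) simp_all
  then have DO: "?D \<in> Obj (rep_algebra P)" using D by simp
  obtain h1 :: "'v \<times> 'v \<Rightarrow> 'k" where h1: "inj_on h1 (carrier (underlying_space P ?D))"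
    using fd_space_embeds_in_field[OF inf fd] .
  define h where "h = emb \<circ> h1"
  have h: "inj_on h (carrier ?D)"
    using h1 emb unfolding h_def underlying_space_simps(1) by (auto intro: comp_inj_on inj_on_subset)
  have heq: "h x = h y \<longleftrightarrow> x = y" if "x \<in> carrier ?D" "y \<in> carrier ?D" for x y
    using h that by (rule inj_on_eq_iff)
  let ?B = "image_module h ?D"
  have im: "left_module P ?B" "restrict h (carrier ?D) \<in> lin_maps P ?D ?B" "carrier ?B = h ` carrier ?D"
    by (rule image_module[OF D]; (simp only: heq)?)+
  have h': "bij_betw (restrict h (carrier ?D)) (carrier ?D) (carrier ?B)"
    using h im(3) by (auto simp: bij_betw_def inj_on_def)
  then have B: "?B \<in> Obj (rep_algebra P)"
    using rep_algebra_Obj_surjective[OF DO im(1,2)] by (simp add: bij_betw_def)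
  define H where "H = restrict h (carrier ?D)"
  define K where "K = restrict (inv_into (carrier ?D) H) (carrier ?B)"
  have H: "H \<in> lin_maps P ?D ?B" and K: "K \<in> lin_maps P ?B ?D"
    using im(2) lin_maps_inverse[OF D im(2) h'] by (simp_all add: H_def K_def)
  have Hb: "inj_on H (carrier ?D)" "H ` carrier ?D = carrier ?B"
    using h' by (simp_all only: H_def bij_betw_def)
  have HK: "H (K b) = b" if "b \<in> carrier ?B" for b
  proof -
    have "b \<in> H ` carrier ?D" using that Hb(2) by blast
    then show ?thesis using that f_inv_into_f[of b H "carrier ?D"] by (simp only: K_def restrict_apply if_True)
  qed
  have KH: "K (H d) = d" if "d \<in> carrier ?D" for d
    using lin_mapsD(1)[OF H that] inv_into_f_f[OF Hb(1) that] by (simp only: K_def restrict_apply if_True)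
  define iX where "iX = (\<lambda>x\<in>carrier X. (x, \<zero>\<^bsub>Y\<^esub>))"
  define iY where "iY = (\<lambda>y\<in>carrier Y. (\<zero>\<^bsub>X\<^esub>, y))"
  define pX where "pX = restrict fst (carrier ?D)"
  define pY where "pY = restrict snd (carrier ?D)"
  have i: "iX \<in> lin_maps P X ?D" "iY \<in> lin_maps P Y ?D" "pX \<in> lin_maps P ?D X" "pY \<in> lin_maps P ?D Y"
    unfolding iX_def iY_def pX_def pY_def
    by (rule lin_mapsI; auto simp: left_module_closed[OF M(1)] left_module_closed[OF M(2)]
      left_module_act_zero[OF M(1)] left_module_act_zero[OF M(2)])+
  have e: "H d \<oplus>\<^bsub>?B\<^esub> H d' = H (d \<oplus>\<^bsub>?D\<^esub> d')" if "d \<in> carrier ?D" "d' \<in> carrier ?D" for d d'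
    using lin_mapsD(2)[OF H that] by simp
  have sum: "H (x, \<zero>\<^bsub>Y\<^esub>) \<oplus>\<^bsub>?B\<^esub> H (\<zero>\<^bsub>X\<^esub>, y) = H (x, y)" if "x \<in> carrier X" "y \<in> carrier Y" for x y
    using e[of "(x, \<zero>\<^bsub>Y\<^esub>)" "(\<zero>\<^bsub>X\<^esub>, y)"] that by simp
  have KX: "fst (K b) \<in> carrier X" "snd (K b) \<in> carrier Y" "K b \<in> carrier X \<times> carrier Y"
    if "b \<in> carrier ?B" for b
    using lin_mapsD(1)[OF K that] by auto
  have HB: "H (x, y) \<in> carrier ?B" if "x \<in> carrier X" "y \<in> carrier Y" for x y
    using lin_mapsD(1)[OF H, of "(x, y)"] that by simp
  have "is_biproduct (rep_algebra P) X Y ?B (compose (carrier X) H iX) (compose (carrier Y) H iY)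
      (compose (carrier ?B) pX K) (compose (carrier ?B) pY K)"
    unfolding is_biproduct_def
  proof (intro conjI B)
    show "compose (carrier X) H iX \<in> Hom (rep_algebra P) X ?B" "compose (carrier Y) H iY \<in> Hom (rep_algebra P) Y ?B"
      "compose (carrier ?B) pX K \<in> Hom (rep_algebra P) ?B X" "compose (carrier ?B) pY K \<in> Hom (rep_algebra P) ?B Y"
      using i H K M im(1) by (auto intro: lin_maps_compose)
  qed (auto simp: compose_def iX_def iY_def pX_def pY_def KH KX HB HK sum intro!: restrict_ext)
  then show ?thesis by blast
qed

text \<open>A monomorphism is injective, so it is the kernel of the projection to its cokernel; an epimorphism
  is surjective, so it is the cokernel of the inclusion of its kernel.\<close>

theorem rep_algebra_abelian:
  fixes emb :: "'k \<Rightarrow> 'v"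
  assumes inf: "infinite (UNIV :: 'k set)" and emb: "inj emb"
  shows "abelian_category (rep_algebra P :: (('a, 'v) module, 'v \<Rightarrow> 'v) preadditive_category)" (is "abelian_category ?C")
  unfolding abelian_category_def
proof (intro conjI rep_algebra_preadditive rep_algebra_zero_object ballI allI impI)
  fix X Y assume X: "X \<in> Obj ?C" and Y: "Y \<in> Obj ?C"
  show "\<exists>B inX inY prX prY. is_biproduct ?C X Y B inX inY prX prY"
    by (rule rep_algebra_biproduct_exists[OF inf emb X Y])
  show "\<exists>K k. is_kernel ?C X Y f K k" if "f \<in> Hom ?C X Y" for f
    using rep_algebra_kernel_exists(3)[OF X Y, of f] that by auto
  show "\<exists>Q q. is_cokernel ?C X Y f Q q" if f: "f \<in> Hom ?C X Y" for f
  proof -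
    have f: "f \<in> lin_maps P X Y" using f by simp
    obtain Q :: "('a, 'v) module" and q where "Q \<in> Obj ?C" "q \<in> lin_maps P Y Q" "q ` carrier Y = carrier Q"
        "\<forall>y\<in>carrier Y. q y = \<zero>\<^bsub>Q\<^esub> \<longleftrightarrow> y \<in> f ` carrier X"
      by (rule rep_algebra_cokernel_exists[OF X Y f])
    from rep_algebra_cokernelI[OF X Y f this(1-3) this(4)[rule_format]] show ?thesis by blast
  qed
  show "\<exists>Z\<in>Obj ?C. \<exists>g\<in>Hom ?C Y Z. is_kernel ?C Y Z g X f" if "is_mono ?C X Y f" for f
  proof -
    have f: "f \<in> lin_maps P X Y" using that by (simp add: is_mono_def)
    obtain Q :: "('a, 'v) module" and q where Q: "Q \<in> Obj ?C" "q \<in> lin_maps P Y Q" "q ` carrier Y = carrier Q"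
        "\<forall>y\<in>carrier Y. q y = \<zero>\<^bsub>Q\<^esub> \<longleftrightarrow> y \<in> f ` carrier X"
      by (rule rep_algebra_cokernel_exists[OF X Y f])
    have "is_kernel ?C Y Q q X f"
      by (rule rep_algebra_kernelI[OF Y Q(1,2) X f rep_algebra_mono_injective[OF X Y that] Q(4)[rule_format]])
    then show ?thesis using Q(1,2) by auto
  qed
  show "\<exists>Z\<in>Obj ?C. \<exists>g\<in>Hom ?C Z X. is_cokernel ?C Z X g Y f" if "is_epi ?C X Y f" for f
  proof -
    have f: "f \<in> lin_maps P X Y" using that by (simp add: is_epi_def)
    note K = rep_algebra_kernel_exists[OF X Y f]
    have "is_cokernel ?C (X\<lparr>carrier := {x \<in> carrier X. f x = \<zero>\<^bsub>Y\<^esub>}\<rparr>) X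
        (\<lambda>x\<in>carrier (X\<lparr>carrier := {x \<in> carrier X. f x = \<zero>\<^bsub>Y\<^esub>}\<rparr>). x) Y f"
      by (rule rep_algebra_cokernelI[OF K(1) X K(2) Y f rep_algebra_epi_surjective[OF X Y that]])
        (auto simp: image_def)
    then show ?thesis using K(1,2) by (intro bexI) auto
  qed
qed

end

section \<open>The category of quiver representations\<close>

lemma rep_quiver_simps [simp]:
  "Obj (rep_quiver Q) = {X. (\<forall>v\<in>verts Q. fd_space (space X v)) \<and>
     (\<forall>\<alpha>\<in>arcs Q. amap X \<alpha> \<in> lin_maps class_ring (space X (tail Q \<alpha>)) (space X (head Q \<alpha>)))}"
  "Hom (rep_quiver Q) X Y = {f \<in> extensional (verts Q).
     (\<forall>v\<in>verts Q. f v \<in> lin_maps class_ring (space X v) (space Y v)) \<and>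
     (\<forall>\<alpha>\<in>arcs Q. \<forall>x\<in>carrier (space X (tail Q \<alpha>)).
        f (head Q \<alpha>) (amap X \<alpha> x) = amap Y \<alpha> (f (tail Q \<alpha>) x))}"
  "Idt (rep_quiver Q) X = (\<lambda>v\<in>verts Q. \<lambda>x\<in>carrier (space X v). x)"
  "Comp (rep_quiver Q) X Y Z g f = (\<lambda>v\<in>verts Q. compose (carrier (space X v)) (g v) (f v))"
  "Hom_add (rep_quiver Q) X Y f g = (\<lambda>v\<in>verts Q. \<lambda>x\<in>carrier (space X v). f v x \<oplus>\<^bsub>space Y v\<^esub> g v x)"
  "Hom_zero (rep_quiver Q) X Y = (\<lambda>v\<in>verts Q. \<lambda>x\<in>carrier (space X v). \<zero>\<^bsub>space Y v\<^esub>)"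
  by (simp_all add: rep_quiver_def)

lemma fd_space_left_module: "fd_space V \<Longrightarrow> left_module class_ring V"
  by (simp add: fd_space_def vectorspace_left_module)

lemma rep_quiver_HomI:
  assumes "f \<in> extensional (verts Q)"
    "\<And>v. v \<in> verts Q \<Longrightarrow> f v \<in> lin_maps class_ring (space X v) (space Y v)"
    "\<And>\<alpha> x. \<lbrakk>\<alpha> \<in> arcs Q; x \<in> carrier (space X (tail Q \<alpha>))\<rbrakk>
      \<Longrightarrow> f (head Q \<alpha>) (amap X \<alpha> x) = amap Y \<alpha> (f (tail Q \<alpha>) x)"
  shows "f \<in> Hom (rep_quiver Q) X Y"
  using assms by simp

lemma rep_quiver_HomD:
  assumes "f \<in> Hom (rep_quiver Q) X Y"
  shows "f \<in> extensional (verts Q)"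
    "v \<in> verts Q \<Longrightarrow> f v \<in> lin_maps class_ring (space X v) (space Y v)"
    "\<lbrakk>\<alpha> \<in> arcs Q; x \<in> carrier (space X (tail Q \<alpha>))\<rbrakk>
      \<Longrightarrow> f (head Q \<alpha>) (amap X \<alpha> x) = amap Y \<alpha> (f (tail Q \<alpha>) x)"
  using assms by simp_all

lemma rep_quiver_ObjD:
  assumes "X \<in> Obj (rep_quiver Q)"
  shows "v \<in> verts Q \<Longrightarrow> fd_space (space X v)"
    "v \<in> verts Q \<Longrightarrow> left_module class_ring (space X v)"
    "\<alpha> \<in> arcs Q \<Longrightarrow> amap X \<alpha> \<in> lin_maps class_ring (space X (tail Q \<alpha>)) (space X (head Q \<alpha>))"
  using assms by (simp_all add: fd_space_left_module)

lemma restrict_eq_of_extensional: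
  "f \<in> extensional S \<Longrightarrow> (\<And>v. v \<in> S \<Longrightarrow> g v = f v) \<Longrightarrow> (\<lambda>v\<in>S. g v) = f"
  by (rule extensionalityI[of _ S]) auto

context wf_digraph
begin

lemma rep_quiver_preadditive:
  "preadditive_category (rep_quiver G ::
    (('k::field, 'a, 'b, 'v) quiver_rep, 'a \<Rightarrow> 'v \<Rightarrow> 'v) preadditive_category)"
  (is "preadditive_category ?C")
proof (intro preadditive_category.intro category.intro preadditive_category_axioms.intro)
  note V = tail_in_verts head_in_verts and ObjD = rep_quiver_ObjD[of _ G] and HomD = rep_quiver_HomD[of _ G]
  fix X assume X: "X \<in> Obj ?C"
  show "Idt ?C X \<in> Hom ?C X X"
    by (rule rep_quiver_HomI) (use V in \<open>simp_all add: lin_maps_id[OF ObjD(2)[OF X]] lin_mapsD(1)[OF ObjD(3)[OF X]]\<close>)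
next
  note V = tail_in_verts head_in_verts and ObjD = rep_quiver_ObjD[of _ G] and HomD = rep_quiver_HomD[of _ G]
  fix X Y Z f g assume X: "X \<in> Obj ?C" and f: "f \<in> Hom ?C X Y" and g: "g \<in> Hom ?C Y Z"
  show "Comp ?C X Y Z g f \<in> Hom ?C X Z"
  proof (rule rep_quiver_HomI)
    fix v assume v: "v \<in> verts G"
    show "Comp ?C X Y Z g f v \<in> lin_maps class_ring (space X v) (space Z v)"
      using v lin_maps_compose[OF ObjD(2)[OF X v] HomD(2)[OF f v] HomD(2)[OF g v]] by simp
  next
    fix \<alpha> x assume a: "\<alpha> \<in> arcs G" "x \<in> carrier (space X (tail G \<alpha>))"
    note v = V(1)[OF a(1)] V(2)[OF a(1)]
    have "f (tail G \<alpha>) x \<in> carrier (space Y (tail G \<alpha>))" using lin_mapsD(1)[OF HomD(2)[OF f v(1)] a(2)] .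
    moreover have "amap X \<alpha> x \<in> carrier (space X (head G \<alpha>))" using lin_mapsD(1)[OF ObjD(3)[OF X a(1)] a(2)] .
    ultimately show "Comp ?C X Y Z g f (head G \<alpha>) (amap X \<alpha> x) = amap Z \<alpha> (Comp ?C X Y Z g f (tail G \<alpha>) x)"
      using a v HomD(3)[OF f a] HomD(3)[OF g a(1)] by (simp add: compose_eq)
  qed simp
next
  fix X Y f assume f: "f \<in> Hom ?C X Y"
  note H = rep_quiver_HomD[OF f]
  show "Comp ?C X Y Y (Idt ?C Y) f = f"
    unfolding rep_quiver_simps by (rule restrict_eq_of_extensional[OF H(1)]) (simp add: compose_lin_maps_id[OF H(2)])
  show "Comp ?C X X Y f (Idt ?C X) = f"
    unfolding rep_quiver_simps by (rule restrict_eq_of_extensional[OF H(1)]) (simp add: compose_lin_maps_id[OF H(2)])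
next
  fix W X Y Z f g h assume f: "f \<in> Hom ?C W X"
  show "Comp ?C W Y Z h (Comp ?C W X Y g f) = Comp ?C W X Z (Comp ?C X Y Z h g) f"
    unfolding rep_quiver_simps
    by (rule restrict_ext) (simp add: compose_lin_maps_assoc[OF rep_quiver_HomD(2)[OF f]])
next
  note V = tail_in_verts head_in_verts and ObjD = rep_quiver_ObjD[of _ G] and HomD = rep_quiver_HomD[of _ G]
  fix X Y assume X: "X \<in> Obj ?C" and Y: "Y \<in> Obj ?C"
  have Yg: "abelian_group (space Y v)" if "v \<in> verts G" for v
    using ObjD(2)[OF Y that] by (rule left_module_abelian_group)
  have amX: "amap X \<alpha> x \<in> carrier (space X (head G \<alpha>))" if "\<alpha> \<in> arcs G" "x \<in> carrier (space X (tail G \<alpha>))" for \<alpha> x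
    using lin_mapsD(1)[OF ObjD(3)[OF X that(1)] that(2)] .
  have HH: "f v x \<in> carrier (space Y v)" if "f \<in> Hom ?C X Y" "v \<in> verts G" "x \<in> carrier (space X v)" for f v x
    using lin_mapsD(1)[OF HomD(2)[OF that(1,2)] that(3)] .
  note YD = lin_mapsD[OF ObjD(3)[OF Y]]
  have add: "Hom_add ?C X Y f g \<in> Hom ?C X Y" if f: "f \<in> Hom ?C X Y" and g: "g \<in> Hom ?C X Y" for f g
  proof (rule rep_quiver_HomI)
    fix v assume v: "v \<in> verts G"
    show "Hom_add ?C X Y f g v \<in> lin_maps class_ring (space X v) (space Y v)"
      using v lin_maps_add[OF ObjD(2)[OF X v] ObjD(2)[OF Y v] HomD(2)[OF f v] HomD(2)[OF g v]] by simp
  next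
    fix \<alpha> x assume a: "\<alpha> \<in> arcs G" "x \<in> carrier (space X (tail G \<alpha>))"
    note v = V(1)[OF a(1)] V(2)[OF a(1)]
    show "Hom_add ?C X Y f g (head G \<alpha>) (amap X \<alpha> x) = amap Y \<alpha> (Hom_add ?C X Y f g (tail G \<alpha>) x)"
      using a v amX[OF a] HomD(3)[OF f a] HomD(3)[OF g a] HH[OF f v(1) a(2)] HH[OF g v(1) a(2)]
      by (simp add: YD(2)[OF a(1)])
  qed simp
  have zero: "Hom_zero ?C X Y \<in> Hom ?C X Y"
  proof (rule rep_quiver_HomI)
    fix \<alpha> x assume a: "\<alpha> \<in> arcs G" "x \<in> carrier (space X (tail G \<alpha>))"
    note v = V(1)[OF a(1)] V(2)[OF a(1)]
    show "Hom_zero ?C X Y (head G \<alpha>) (amap X \<alpha> x) = amap Y \<alpha> (Hom_zero ?C X Y (tail G \<alpha>) x)"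
      using a v amX[OF a] lin_maps_zero[OF Yg[OF v(1)] Yg[OF v(2)] ObjD(3)[OF Y a(1)]] by simp
  qed (use lin_maps_const_zero[OF ObjD(2)[OF X] ObjD(2)[OF Y]] in simp_all)
  have neg: "(\<lambda>v\<in>verts G. \<lambda>x\<in>carrier (space X v). \<ominus>\<^bsub>space Y v\<^esub> f v x) \<in> Hom ?C X Y" if f: "f \<in> Hom ?C X Y" for f
  proof (rule rep_quiver_HomI)
    fix v assume v: "v \<in> verts G"
    show "(\<lambda>v\<in>verts G. \<lambda>x\<in>carrier (space X v). \<ominus>\<^bsub>space Y v\<^esub> f v x) v \<in> lin_maps class_ring (space X v) (space Y v)"
      using v lin_maps_uminus[OF ObjD(2)[OF X v] ObjD(2)[OF Y v] HomD(2)[OF f v]] by simp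
  next
    fix \<alpha> x assume a: "\<alpha> \<in> arcs G" "x \<in> carrier (space X (tail G \<alpha>))"
    note v = V(1)[OF a(1)] V(2)[OF a(1)]
    show "(\<lambda>v\<in>verts G. \<lambda>x\<in>carrier (space X v). \<ominus>\<^bsub>space Y v\<^esub> f v x) (head G \<alpha>) (amap X \<alpha> x) =
        amap Y \<alpha> ((\<lambda>v\<in>verts G. \<lambda>x\<in>carrier (space X v). \<ominus>\<^bsub>space Y v\<^esub> f v x) (tail G \<alpha>) x)"
      using a v amX[OF a] HomD(3)[OF f a] lin_maps_a_inv[OF Yg[OF v(1)] Yg[OF v(2)] ObjD(3)[OF Y a(1)] HH[OF f v(1) a(2)]]
      by simp
  qed simp
  show "comm_group \<lparr>carrier = Hom ?C X Y, mult = Hom_add ?C X Y, one = Hom_zero ?C X Y\<rparr>" (is "comm_group ?H")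
  proof (rule comm_groupI)
    fix f assume "f \<in> carrier ?H"
    then have f: "f \<in> Hom ?C X Y" by (simp only: partial_object.simps)
    have "Hom_add ?C X Y (\<lambda>v\<in>verts G. \<lambda>x\<in>carrier (space X v). \<ominus>\<^bsub>space Y v\<^esub> f v x) f = Hom_zero ?C X Y"
      unfolding rep_quiver_simps
      by (intro restrict_ext) (simp add: abelian_group.l_neg[OF Yg] HH[OF f])
    then show "\<exists>g\<in>carrier ?H. g \<otimes>\<^bsub>?H\<^esub> f = \<one>\<^bsub>?H\<^esub>"
      using neg[OF f] by (intro bexI[of _ "\<lambda>v\<in>verts G. \<lambda>x\<in>carrier (space X v). \<ominus>\<^bsub>space Y v\<^esub> f v x"])
        (simp_all only: partial_object.simps monoid.simps)
    have "Hom_add ?C X Y (Hom_zero ?C X Y) f = f"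
      unfolding rep_quiver_simps
      by (intro restrict_eq_of_extensional HomD(1)[OF f] lin_mapsD(4)[OF HomD(2)[OF f]])
        (simp_all add: abelian_monoid.l_zero[OF abelian_group.axioms(1)[OF Yg]] HH[OF f])
    then show "\<one>\<^bsub>?H\<^esub> \<otimes>\<^bsub>?H\<^esub> f = f" by (simp only: monoid.simps)
    fix g assume "g \<in> carrier ?H"
    then have g: "g \<in> Hom ?C X Y" by (simp only: partial_object.simps)
    show "f \<otimes>\<^bsub>?H\<^esub> g \<in> carrier ?H" using add[OF f g] by (simp only: partial_object.simps monoid.simps)
    have "Hom_add ?C X Y f g = Hom_add ?C X Y g f"
      unfolding rep_quiver_simps
      by (intro restrict_ext) (simp add: abelian_monoid.a_comm[OF abelian_group.axioms(1)[OF Yg]] HH[OF f] HH[OF g])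
    then show "f \<otimes>\<^bsub>?H\<^esub> g = g \<otimes>\<^bsub>?H\<^esub> f" by (simp only: monoid.simps)
    fix h assume "h \<in> carrier ?H"
    then have h: "h \<in> Hom ?C X Y" by (simp only: partial_object.simps)
    have "Hom_add ?C X Y (Hom_add ?C X Y f g) h = Hom_add ?C X Y f (Hom_add ?C X Y g h)"
      unfolding rep_quiver_simps
      by (intro restrict_ext) (simp add: abelian_monoid.a_assoc[OF abelian_group.axioms(1)[OF Yg]] HH[OF f] HH[OF g] HH[OF h])
    then show "f \<otimes>\<^bsub>?H\<^esub> g \<otimes>\<^bsub>?H\<^esub> h = f \<otimes>\<^bsub>?H\<^esub> (g \<otimes>\<^bsub>?H\<^esub> h)" by (simp only: monoid.simps)
  next
    show "\<one>\<^bsub>?H\<^esub> \<in> carrier ?H" using zero by (simp only: partial_object.simps monoid.simps)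
  qed
next
  note HomD = rep_quiver_HomD[of _ G]
  fix X Y Z f f' g assume f: "f \<in> Hom ?C X Y" "f' \<in> Hom ?C X Y" and g: "g \<in> Hom ?C Y Z"
  show "Comp ?C X Y Z g (Hom_add ?C X Y f f') = Hom_add ?C X Z (Comp ?C X Y Z g f) (Comp ?C X Y Z g f')"
    unfolding rep_quiver_simps
    by (intro restrict_ext) (auto simp: compose_def lin_mapsD(1)[OF HomD(2)[OF f(1)]] lin_mapsD(1)[OF HomD(2)[OF f(2)]]
      lin_mapsD(2)[OF HomD(2)[OF g]] intro!: restrict_ext)
next
  note HomD = rep_quiver_HomD[of _ G]
  fix X Y Z f g g' assume f: "f \<in> Hom ?C X Y"
  show "Comp ?C X Y Z (Hom_add ?C Y Z g g') f = Hom_add ?C X Z (Comp ?C X Y Z g f) (Comp ?C X Y Z g' f)"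
    unfolding rep_quiver_simps
    by (intro restrict_ext) (auto simp: compose_def lin_mapsD(1)[OF HomD(2)[OF f]] intro!: restrict_ext)
qed

text \<open>The inverses at the vertices commute with the arrow maps because \<open>f\<close> does.\<close>

lemma rep_quiver_isoI:
  assumes X: "X \<in> Obj (rep_quiver G)" and Y: "Y \<in> Obj (rep_quiver G)" and f: "f \<in> Hom (rep_quiver G) X Y"
    and bij: "\<And>v. v \<in> verts G \<Longrightarrow> bij_betw (f v) (carrier (space X v)) (carrier (space Y v))"
  shows "is_iso (rep_quiver G) X Y f"
proof -
  note V = tail_in_verts head_in_verts and XD = rep_quiver_ObjD[OF X] and YD = rep_quiver_ObjD[OF Y]
    and fD = rep_quiver_HomD[OF f]
  define g where "g = (\<lambda>v\<in>verts G. restrict (inv_into (carrier (space X v)) (f v)) (carrier (space Y v)))"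
  have g: "g v \<in> lin_maps class_ring (space Y v) (space X v)" if "v \<in> verts G" for v
    using lin_maps_inverse[OF XD(2) fD(2) bij] that by (simp add: g_def)
  have gf: "g v (f v x) = x" if "v \<in> verts G" "x \<in> carrier (space X v)" for v x
    using that bij[OF that(1)] lin_mapsD(1)[OF fD(2)[OF that(1)] that(2)]
    by (simp add: g_def bij_betw_def inv_into_f_f)
  have fg: "f v (g v y) = y" if "v \<in> verts G" "y \<in> carrier (space Y v)" for v y
    using that bij[OF that(1)] by (simp add: g_def bij_betw_def f_inv_into_f)
  have gH: "g \<in> Hom (rep_quiver G) Y X"
  proof (rule rep_quiver_HomI)
    show "g \<in> extensional (verts G)" by (simp add: g_def)
    fix \<alpha> y assume a: "\<alpha> \<in> arcs G" "y \<in> carrier (space Y (tail G \<alpha>))"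
    note v = V(1)[OF a(1)] V(2)[OF a(1)]
    have x: "g (tail G \<alpha>) y \<in> carrier (space X (tail G \<alpha>))" using lin_mapsD(1)[OF g[OF v(1)] a(2)] .
    have "f (head G \<alpha>) (amap X \<alpha> (g (tail G \<alpha>) y)) = amap Y \<alpha> y"
      using fD(3)[OF a(1) x] fg[OF v(1) a(2)] by simp
    then show "g (head G \<alpha>) (amap Y \<alpha> y) = amap X \<alpha> (g (tail G \<alpha>) y)"
      using gf[OF v(2) lin_mapsD(1)[OF XD(3)[OF a(1)] x]] by simp
  qed (rule g)
  show ?thesis
    unfolding is_iso_def
  proof (intro conjI f bexI[OF _ gH])
    show "Comp (rep_quiver G) X Y X g f = Idt (rep_quiver G) X"
      unfolding rep_quiver_simps by (intro restrict_ext) (auto simp: compose_def gf intro!: restrict_ext)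
    show "Comp (rep_quiver G) Y X Y f g = Idt (rep_quiver G) Y"
      unfolding rep_quiver_simps by (intro restrict_ext) (auto simp: compose_def fg intro!: restrict_ext)
  qed
qed

end

lemma full_subcategory_simps [simp]:
  "Obj (full_subcategory C P) = {X \<in> Obj C. P X}" "Hom (full_subcategory C P) = Hom C"
  "Idt (full_subcategory C P) = Idt C" "Comp (full_subcategory C P) = Comp C"
  "Hom_add (full_subcategory C' P) = Hom_add C'" "Hom_zero (full_subcategory C' P) = Hom_zero C'"
  by (simp_all add: full_subcategory_def)

lemma full_subcategory_preadditive:
  assumes "preadditive_category C"
  shows "preadditive_category (full_subcategory C P)"
proof -
  interpret preadditive_category C by fact
  show ?thesis
    by (intro preadditive_category.intro category.intro preadditive_category_axioms.intro)
      (simp_all add: Idt_in Comp_in Comp_Idt_left Comp_Idt_right Comp_assoc Hom_group Comp_add_right Comp_add_left)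
qed

lemma quiver_simps [simp]:
  "verts (quiver m r w) = insert Sink {Source i j | i j. i < m \<and> j < r i}"
  "arcs (quiver m r w) = {(i, j, k). i < m \<and> j < r i \<and> k < w i j}"
  "tail (quiver m r w) (i, j, k) = Source i j" "head (quiver m r w) \<alpha> = Sink"
  by (simp_all add: quiver_def split: prod.splits)

lemma quiver_wf: "wf_digraph (quiver m r w)"
  by unfold_locales (auto simp: quiver_def)

lemma balanced_reps_preadditive: "preadditive_category (balanced_reps m r w)"
  unfolding balanced_reps_def
  by (intro full_subcategory_preadditive wf_digraph.rep_quiver_preadditive quiver_wf)

section \<open>Direct products and matrix algebras\<close>

lemma dprod_simps [simp]:
  "carrier (dprod I V) = (\<Pi>\<^sub>E i\<in>I. carrier (V i))"
  "x \<otimes>\<^bsub>dprod I V\<^esub> y = (\<lambda>i\<in>I. x i \<otimes>\<^bsub>V i\<^esub> y i)" "\<one>\<^bsub>dprod I V\<^esub> = (\<lambda>i\<in>I. \<one>\<^bsub>V i\<^esub>)"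
  "\<zero>\<^bsub>dprod I V\<^esub> = (\<lambda>i\<in>I. \<zero>\<^bsub>V i\<^esub>)" "x \<oplus>\<^bsub>dprod I V\<^esub> y = (\<lambda>i\<in>I. x i \<oplus>\<^bsub>V i\<^esub> y i)"
  "c \<odot>\<^bsub>dprod I V\<^esub> x = (\<lambda>i\<in>I. c \<odot>\<^bsub>V i\<^esub> x i)"
  by (simp_all add: dprod_def)

lemma dprod_left_module:
  assumes R: "ring R" and V: "\<And>i. i \<in> I \<Longrightarrow> left_module R (V i)"
  shows "left_module R (dprod I V)"
proof -
  note C = left_module_closed[OF V] and G = left_module_abelian_group[OF V]
  note G' = abelian_group.axioms(1)[OF G]
  have "abelian_group (dprod I V)"
  proof (rule abelian_groupI)
    fix x assume "x \<in> carrier (dprod I V)"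
    then show "\<exists>y\<in>carrier (dprod I V). y \<oplus>\<^bsub>dprod I V\<^esub> x = \<zero>\<^bsub>dprod I V\<^esub>"
      by (intro bexI[of _ "\<lambda>i\<in>I. \<ominus>\<^bsub>V i\<^esub> x i"])
        (auto simp: abelian_group.l_neg[OF G] abelian_group.a_inv_closed[OF G] PiE_iff intro!: restrict_ext)
  qed (auto simp: C abelian_monoid.a_ac[OF G'] PiE_iff intro!: restrict_ext,
      auto simp: extensional_def abelian_monoid.l_zero[OF G'])
  then show ?thesis
    by (intro left_module.intro left_module_axioms.intro R)
      (auto simp: C left_module.act_add_left[OF V] left_module.act_add_right[OF V] left_module.act_mult[OF V]
        left_module.act_one[OF V] ring.ring_simprules[OF R] PiE_iff extensional_def intro!: restrict_ext)
qed

lemma module_mat_left_module: "left_module class_ring (module_mat TYPE('k::field) n m)"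
  by (intro left_module.intro left_module_axioms.intro class_ring.ring_axioms abelian_group_mat)
    (auto simp: module_mat_simps algebra_simps intro!: eq_matI)

lemma mat_algebras_left_module: "left_module class_ring (mat_algebras s d :: ('k::field, nat \<Rightarrow> 'k mat) module)"
  unfolding mat_algebras_def by (intro dprod_left_module class_ring.ring_axioms module_mat_left_module)

lemma mat_algebras_simps:
  "b \<in> carrier (mat_algebras s d) \<longleftrightarrow> b \<in> extensional {..<s} \<and> (\<forall>j<s. b j \<in> carrier_mat (d j) (d j))"
  "x \<otimes>\<^bsub>mat_algebras s d\<^esub> y = (\<lambda>j\<in>{..<s}. x j * y j)"
  "\<one>\<^bsub>mat_algebras s d\<^esub> = (\<lambda>j\<in>{..<s}. 1\<^sub>m (d j))"
  "\<zero>\<^bsub>mat_algebras s d\<^esub> = (\<lambda>j\<in>{..<s}. 0\<^sub>m (d j) (d j))"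
  "x \<oplus>\<^bsub>mat_algebras s d\<^esub> y = (\<lambda>j\<in>{..<s}. x j + y j)"
  "c \<odot>\<^bsub>mat_algebras s d\<^esub> x = (\<lambda>j\<in>{..<s}. c \<cdot>\<^sub>m x j)"
  by (auto simp: mat_algebras_def module_mat_simps PiE_iff)

lemma mat_algebras_eqI:
  assumes "x \<in> carrier (mat_algebras s d)" "y \<in> carrier (mat_algebras s d)"
    "\<And>j a c. \<lbrakk>j < s; a < d j; c < d j\<rbrakk> \<Longrightarrow> x j $$ (a, c) = y j $$ (a, c)"
  shows "x = y"
proof (rule extensionalityI[of _ "{..<s}"])
  fix j assume "j \<in> {..<s}"
  then have j: "j < s" by simp
  then have "x j \<in> carrier_mat (d j) (d j)" "y j \<in> carrier_mat (d j) (d j)"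
    using assms(1,2) by (simp_all add: mat_algebras_simps)
  then show "x j = y j" using assms(3)[OF j] by (intro eq_matI) auto
qed (use assms in \<open>simp_all add: mat_algebras_simps\<close>)

lemma mat_unit_simps:
  assumes "j < s"
  shows "mat_unit s d j' p q \<in> carrier (mat_algebras s d)"
    "a < d j \<Longrightarrow> c < d j \<Longrightarrow> mat_unit s d j' p q j $$ (a, c) = (if j = j' \<and> a = p \<and> c = q then 1 else 0)"
    "mat_unit s d j' p q j \<in> carrier_mat (d j) (d j)"
  using assms by (auto simp: mat_algebras_simps mat_unit_def)

lemma mat_unit_in: "mat_unit s d j p q \<in> carrier (mat_algebras s d)"
  by (auto simp: mat_algebras_simps mat_unit_def)

lemma mat_algebras_mult_closed:
  assumes "x \<in> carrier (mat_algebras s d)" "y \<in> carrier (mat_algebras s d)"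
  shows "x \<otimes>\<^bsub>mat_algebras s d\<^esub> y \<in> carrier (mat_algebras s d)"
  using assms by (auto simp: mat_algebras_simps)

lemma mat_algebras_mult_index:
  assumes "x \<in> carrier (mat_algebras s d)" "y \<in> carrier (mat_algebras s d)" "j < s" "a < d j" "c < d j"
  shows "(x \<otimes>\<^bsub>mat_algebras s d\<^esub> y) j $$ (a, c) = (\<Sum>k<d j. x j $$ (a, k) * y j $$ (k, c))"
proof -
  have "x j \<in> carrier_mat (d j) (d j)" "y j \<in> carrier_mat (d j) (d j)"
    using assms by (simp_all add: mat_algebras_simps)
  then show ?thesis using assms(3-5)
    by (simp add: mat_algebras_simps scalar_prod_def atLeast0LessThan)
qed

lemma mat_unit_mult:
  assumes "q < d j" "p' < d j'"
  shows "mat_unit s d j p q \<otimes>\<^bsub>mat_algebras s d\<^esub> mat_unit s d j' p' q' =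
    (if j = j' \<and> q = p' then mat_unit s d j p q' else \<zero>\<^bsub>mat_algebras s d\<^esub> :: nat \<Rightarrow> 'k::field mat)"
proof (rule mat_algebras_eqI)
  let ?A = "mat_algebras s d :: ('k, nat \<Rightarrow> 'k mat) module"
  show "mat_unit s d j p q \<otimes>\<^bsub>?A\<^esub> mat_unit s d j' p' q' \<in> carrier ?A"
    by (intro mat_algebras_mult_closed mat_unit_in)
  show "(if j = j' \<and> q = p' then mat_unit s d j p q' else \<zero>\<^bsub>?A\<^esub>) \<in> carrier ?A"
    by (simp add: mat_unit_in left_module_closed(2)[OF mat_algebras_left_module])
  fix l a c assume l: "l < s" "a < d l" "c < d l"
  \<comment> \<open>only the term \<open>k = q\<close> of the matrix product can be nonzero\<close>
  have "(\<Sum>k<d l. mat_unit s d j p q l $$ (a, k) * mat_unit s d j' p' q' l $$ (k, c)) =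
      (\<Sum>k<d l. if k = q then (if l = j \<and> a = p \<and> l = j' \<and> q = p' \<and> c = q' then 1 else 0) else (0::'k))"
    by (intro sum.cong) (auto simp: mat_unit_simps l)
  then show "(mat_unit s d j p q \<otimes>\<^bsub>?A\<^esub> mat_unit s d j' p' q') l $$ (a, c) =
      (if j = j' \<and> q = p' then mat_unit s d j p q' else \<zero>\<^bsub>?A\<^esub>) l $$ (a, c)"
    using l assms by (auto simp: mat_algebras_mult_index mat_unit_in mat_unit_simps mat_algebras_simps(4))
qed

lemma mat_algebras_finsum_index:
  fixes f :: "'i \<Rightarrow> nat \<Rightarrow> 'k::field mat"
  assumes "finite S" "\<And>i. i \<in> S \<Longrightarrow> f i \<in> carrier (mat_algebras s d)" "j < s" "a < d j" "c < d j"
  shows "(\<Oplus>\<^bsub>mat_algebras s d\<^esub>i\<in>S. f i) j $$ (a, c) = (\<Sum>i\<in>S. f i j $$ (a, c))"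
proof -
  interpret A: abelian_group "mat_algebras s d :: ('k, nat \<Rightarrow> 'k mat) module"
    by (rule left_module_abelian_group[OF mat_algebras_left_module])
  show ?thesis using assms(1,2)
  proof (induction S rule: finite_induct)
    case empty
    then show ?case using assms(3-5) by (simp add: mat_algebras_simps)
  next
    case (insert i S)
    have c: "f i \<in> carrier (mat_algebras s d)" "finsum (mat_algebras s d) f S \<in> carrier (mat_algebras s d)"
      using insert by (auto intro!: A.finsum_closed)
    then have cj: "f i j \<in> carrier_mat (d j) (d j)" "finsum (mat_algebras s d) f S j \<in> carrier_mat (d j) (d j)"
      using assms(3) by (simp_all add: mat_algebras_simps)
    have "finsum (mat_algebras s d) f (insert i S) = f i \<oplus>\<^bsub>mat_algebras s d\<^esub> finsum (mat_algebras s d) f S"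
      using insert by (intro A.finsum_insert) auto
    then have "finsum (mat_algebras s d) f (insert i S) j = f i j + finsum (mat_algebras s d) f S j"
      using assms(3) by (simp add: mat_algebras_simps)
    then show ?case using cj insert assms(3-5) by simp
  qed
qed

lemma mat_algebras_expand:
  fixes b :: "nat \<Rightarrow> 'k::field mat"
  assumes b: "b \<in> carrier (mat_algebras s d)"
  shows "b = finsum (mat_algebras s d) (\<lambda>(j, p, q). (b j $$ (p, q)) \<odot>\<^bsub>mat_algebras s d\<^esub> mat_unit s d j p q)
    (SIGMA j:{..<s}. {..<d j} \<times> {..<d j})" (is "b = finsum ?A ?f ?S")
proof -
  interpret A: abelian_group ?A by (rule left_module_abelian_group[OF mat_algebras_left_module])
  have c: "?f i \<in> carrier ?A" for i
    using left_module_closed(3)[OF mat_algebras_left_module _ mat_unit_in] by (auto split: prod.split)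
  show ?thesis
  proof (rule mat_algebras_eqI[OF b])
    show "finsum ?A ?f ?S \<in> carrier ?A" using c by (intro A.finsum_closed) auto
    fix l a e assume l: "l < s" "a < d l" "e < d l"
    have "finsum ?A ?f ?S l $$ (a, e) = (\<Sum>i\<in>?S. ?f i l $$ (a, e))"
      using l c by (intro mat_algebras_finsum_index) auto
    also have "\<dots> = (\<Sum>i\<in>?S. if i = (l, a, e) then b l $$ (a, e) else 0)"
    proof (intro sum.cong refl)
      fix i assume "i \<in> ?S"
      obtain j p q where i: "i = (j, p, q)" by (cases i)
      have "mat_unit s d j p q l \<in> (carrier_mat (d l) (d l) :: 'k mat set)" by (rule mat_unit_simps(3)[OF l(1)])
      then have "(b j $$ (p, q) \<cdot>\<^sub>m mat_unit s d j p q l) $$ (a, e) = b j $$ (p, q) * mat_unit s d j p q l $$ (a, e)"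
        using l by simp
      then show "?f i l $$ (a, e) = (if i = (l, a, e) then b l $$ (a, e) else 0)"
        using l i by (auto simp: mat_algebras_simps(6) mat_unit_simps)
    qed
    also have "\<dots> = b l $$ (a, e)" using l by simp
    finally show "b l $$ (a, e) = finsum ?A ?f ?S l $$ (a, e)" by simp
  qed
qed

lemma mat_algebras_one:
  "\<one>\<^bsub>mat_algebras s d\<^esub> = finsum (mat_algebras s d :: ('k::field, nat \<Rightarrow> 'k mat) module)
    (\<lambda>(j, p). mat_unit s d j p p) (SIGMA j:{..<s}. {..<d j})"
  (is "_ = finsum ?A ?f ?S")
proof -
  interpret A: abelian_group ?A by (rule left_module_abelian_group[OF mat_algebras_left_module])
  have c: "?f i \<in> carrier ?A" for i using mat_unit_in by (auto split: prod.split)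
  show ?thesis
  proof (rule mat_algebras_eqI)
    show "\<one>\<^bsub>?A\<^esub> \<in> carrier ?A" by (auto simp: mat_algebras_simps)
    show "finsum ?A ?f ?S \<in> carrier ?A" using c by (intro A.finsum_closed) auto
    fix l a e assume l: "l < s" "a < d l" "e < d l"
    have "finsum ?A ?f ?S l $$ (a, e) = (\<Sum>i\<in>?S. ?f i l $$ (a, e))"
      using l c by (intro mat_algebras_finsum_index) auto
    also have "\<dots> = (\<Sum>i\<in>?S. if i = (l, a) then (if a = e then 1 else 0) else 0)"
    proof (intro sum.cong refl)
      fix i assume "i \<in> ?S"
      obtain j p where i: "i = (j, p)" by (cases i)
      show "?f i l $$ (a, e) = (if i = (l, a) then (if a = e then 1 else 0) else 0)"
        unfolding i by (simp add: mat_unit_simps(2)[where d = d and j = l] l)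
    qed
    also have "\<dots> = (if a = e then 1 else 0)" using l by simp
    finally show "\<one>\<^bsub>?A\<^esub> l $$ (a, e) = finsum ?A ?f ?S l $$ (a, e)" using l by (simp add: mat_algebras_simps)
  qed
qed

section \<open>Matrix units in a free product\<close>

lemma alg_homD:
  assumes "h \<in> alg_hom K A B"
  shows "x \<in> carrier A \<Longrightarrow> h x \<in> carrier B"
    "\<lbrakk>x \<in> carrier A; y \<in> carrier A\<rbrakk> \<Longrightarrow> h (x \<oplus>\<^bsub>A\<^esub> y) = h x \<oplus>\<^bsub>B\<^esub> h y"
    "\<lbrakk>x \<in> carrier A; y \<in> carrier A\<rbrakk> \<Longrightarrow> h (x \<otimes>\<^bsub>A\<^esub> y) = h x \<otimes>\<^bsub>B\<^esub> h y"
    "h \<one>\<^bsub>A\<^esub> = \<one>\<^bsub>B\<^esub>" "\<lbrakk>c \<in> carrier K; x \<in> carrier A\<rbrakk> \<Longrightarrow> h (c \<odot>\<^bsub>A\<^esub> x) = c \<odot>\<^bsub>B\<^esub> h x"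
  using assms by (auto simp: alg_hom_def Ring.ring_hom_def LinearCombinations.module_hom_def)

lemma alg_homI:
  assumes "\<And>x. x \<in> carrier A \<Longrightarrow> h x \<in> carrier B"
    "\<And>x y. \<lbrakk>x \<in> carrier A; y \<in> carrier A\<rbrakk> \<Longrightarrow> h (x \<oplus>\<^bsub>A\<^esub> y) = h x \<oplus>\<^bsub>B\<^esub> h y"
    "\<And>x y. \<lbrakk>x \<in> carrier A; y \<in> carrier A\<rbrakk> \<Longrightarrow> h (x \<otimes>\<^bsub>A\<^esub> y) = h x \<otimes>\<^bsub>B\<^esub> h y"
    "h \<one>\<^bsub>A\<^esub> = \<one>\<^bsub>B\<^esub>" "\<And>c x. \<lbrakk>c \<in> carrier K; x \<in> carrier A\<rbrakk> \<Longrightarrow> h (c \<odot>\<^bsub>A\<^esub> x) = c \<odot>\<^bsub>B\<^esub> h x"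
  shows "h \<in> alg_hom K A B"
  using assms by (auto simp: alg_hom_def Ring.ring_hom_def LinearCombinations.module_hom_def)

lemma alg_hom_compose:
  assumes "f \<in> alg_hom K A B" "g \<in> alg_hom K B C"
  shows "(\<lambda>x. g (f x)) \<in> alg_hom K A C"
  by (rule alg_homI) (simp_all add: alg_homD[OF assms(1)] alg_homD[OF assms(2)])

lemma alg_iso_inverse:
  assumes A: "assoc_algebra K A" and f: "f \<in> alg_iso K A B"
  shows "inv_into (carrier A) f \<in> alg_hom K B A"
proof -
  interpret A: assoc_algebra K A by (rule A)
  have fh: "f \<in> alg_hom K A B" and bij: "bij_betw f (carrier A) (carrier B)" using f by (auto simp: alg_iso_def)
  note fD = alg_homD[OF fh]
  let ?g = "inv_into (carrier A) f"
  have g: "?g (f x) = x" if "x \<in> carrier A" for x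
    using bij that by (simp add: bij_betw_def inv_into_f_f)
  have surj: "\<exists>x\<in>carrier A. y = f x" if "y \<in> carrier B" for y
    using bij that by (auto simp: bij_betw_def)
  show ?thesis
  proof (rule alg_homI)
    show "?g \<one>\<^bsub>B\<^esub> = \<one>\<^bsub>A\<^esub>" using g[of "\<one>\<^bsub>A\<^esub>"] by (simp add: fD)
    fix y assume y: "y \<in> carrier B"
    then obtain x where x: "x \<in> carrier A" "y = f x" using surj by blast
    then show "?g y \<in> carrier A" by (simp add: g)
    show "?g (c \<odot>\<^bsub>B\<^esub> y) = c \<odot>\<^bsub>A\<^esub> ?g y" if "c \<in> carrier K" for c
      using x that by (simp add: g fD(5)[symmetric])
    fix y' assume "y' \<in> carrier B"
    then obtain x' where x': "x' \<in> carrier A" "y' = f x'" using surj by blast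
    show "?g (y \<oplus>\<^bsub>B\<^esub> y') = ?g y \<oplus>\<^bsub>A\<^esub> ?g y'" using x x' by (simp add: g fD(2)[symmetric])
    show "?g (y \<otimes>\<^bsub>B\<^esub> y') = ?g y \<otimes>\<^bsub>A\<^esub> ?g y'" using x x' by (simp add: g fD(3)[symmetric])
  qed
qed

lemma alg_hom_zero:
  assumes "abelian_group A" "abelian_group B" "h \<in> alg_hom K A B"
  shows "h \<zero>\<^bsub>A\<^esub> = \<zero>\<^bsub>B\<^esub>"
proof -
  interpret A: abelian_group A by fact
  interpret B: abelian_group B by fact
  show ?thesis
    using alg_homD(2)[OF assms(3), of "\<zero>\<^bsub>A\<^esub>" "\<zero>\<^bsub>A\<^esub>"] alg_homD(1)[OF assms(3), of "\<zero>\<^bsub>A\<^esub>"]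
      B.add.l_cancel_one by simp
qed

lemma alg_hom_finsum:
  assumes "abelian_group A" "abelian_group B" "h \<in> alg_hom K A B" "finite S"
    "\<And>s. s \<in> S \<Longrightarrow> g s \<in> carrier A"
  shows "h (\<Oplus>\<^bsub>A\<^esub>s\<in>S. g s) = (\<Oplus>\<^bsub>B\<^esub>s\<in>S. h (g s))"
proof -
  interpret A: abelian_group A by fact
  interpret B: abelian_group B by fact
  show ?thesis using assms(4,5)
    by (induction S rule: finite_induct)
      (simp_all add: alg_hom_zero[OF assms(1-3)] alg_homD[OF assms(3)] A.finsum_closed A.finsum_insert
        B.finsum_insert Pi_def)
qed

text \<open>An element of the free product is the class of a combination of words, a word is a product of
  letters, and the class of a letter lies in the image of a factor; hence these images generate.\<close>

lemma free_product_induct [consumes 2, case_names incl one scale add mult]: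
  fixes A :: "'i \<Rightarrow> ('k::field, 'a) module"
  assumes A: "\<And>i. i \<in> I \<Longrightarrow> assoc_algebra class_ring (A i)" and x: "x \<in> carrier (free_product I A)"
    and incl: "\<And>i a. i \<in> I \<Longrightarrow> a \<in> carrier (A i) \<Longrightarrow> T (free_product_incl I A i a)"
    and one: "T \<one>\<^bsub>free_product I A\<^esub>"
    and scale: "\<And>c x. x \<in> carrier (free_product I A) \<Longrightarrow> T x \<Longrightarrow> T (c \<odot>\<^bsub>free_product I A\<^esub> x)"
    and add: "\<And>x y. \<lbrakk>x \<in> carrier (free_product I A); y \<in> carrier (free_product I A); T x; T y\<rbrakk>
      \<Longrightarrow> T (x \<oplus>\<^bsub>free_product I A\<^esub> y)"
    and mult: "\<And>x y. \<lbrakk>x \<in> carrier (free_product I A); y \<in> carrier (free_product I A); T x; T y\<rbrakk>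
      \<Longrightarrow> T (x \<otimes>\<^bsub>free_product I A\<^esub> y)"
  shows "T x"
proof -
  let ?L = "letters_algebra I A" and ?J = "free_product_ideal I A" and ?P = "free_product I A"
  let ?S = "SIGMA i:I. carrier (A i)"
  interpret L: assoc_algebra class_ring ?L by (rule free_algebra_assoc_algebra)
  interpret J: ideal ?J ?L by (rule free_product_ideal[OF A])
  let ?pi = "\<lambda>u. ?J +>\<^bsub>?L\<^esub> u"
  have pr: "?pi \<in> alg_hom class_ring ?L ?P"
    unfolding free_product_def by (rule quot_algebra_proj) unfold_locales
  note piD = alg_homD[OF pr]
  have one_monom: "(\<one>\<^bsub>?L\<^esub> :: ('i \<times> 'a) list \<Rightarrow> 'k) = word_monom 1 []"
    by (simp add: free_algebra_simps word_monom_def)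
  have monom1: "T (?pi (word_monom 1 u))" if "u \<in> lists ?S" for u
    using that
  proof (induction u)
    case Nil
    show ?case using one piD(4) unfolding one_monom by simp
  next
    case (Cons s u)
    have l: "(word_monom 1 [s] :: ('i \<times> 'a) list \<Rightarrow> 'k) = letter s" by (simp add: letter_def word_monom_def)
    have eq: "(word_monom 1 (s # u) :: ('i \<times> 'a) list \<Rightarrow> 'k) = letter s \<otimes>\<^bsub>?L\<^esub> word_monom 1 u"
      using word_monom_mult[where c = "1::'k" and u = "[s]" and S = ?S and d = 1 and v = u] l by simp
    have lc: "letter s \<in> carrier ?L" using Cons by (intro free_algebra_letter) auto
    have uc: "word_monom 1 u \<in> carrier ?L" using Cons by (intro word_monom_closed) auto
    have "T (?pi (letter s))"
      using incl[of "fst s" "snd s"] Cons by (auto simp: free_product_incl_def)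
    then show ?case unfolding eq using Cons lc uc mult piD(1) piD(3)[OF lc uc] by auto
  qed
  have monom: "T (?pi (word_monom c u))" if "u \<in> lists ?S" for c u
  proof -
    have "(word_monom c u :: ('i \<times> 'a) list \<Rightarrow> 'k) = c \<odot>\<^bsub>?L\<^esub> word_monom 1 u"
      by (auto simp: free_algebra_simps word_monom_def)
    then show ?thesis
      using scale[OF _ monom1[OF that], of c] piD(5)[of c "word_monom 1 u"] piD(1)
        word_monom_closed[OF that, of "1 :: 'k"] by simp
  qed
  have "T (?pi u)" if "u \<in> carrier ?L" for u
    using that
  proof (induction u rule: free_algebra_induct)
    case zero
    have "(\<zero>\<^bsub>?L\<^esub> :: ('i \<times> 'a) list \<Rightarrow> 'k) = word_monom 0 []" by (auto simp: free_algebra_simps word_monom_def)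
    then show ?case using monom[of "[]" 0] by simp
  next
    case (add c u f)
    then show ?case
      using piD(2)[of "word_monom c u" f] piD(1) word_monom_closed[of u ?S c] monom[of u c]
        assms(6)[of "?pi (word_monom c u)" "?pi f"] by simp
  qed
  moreover obtain u where "u \<in> carrier ?L" "x = ?pi u"
    using x unfolding free_product_def by (rule quot_algebra_coset)
  ultimately show ?thesis by simp
qed

text \<open>The matrix units of all factors, as elements \<open>e i j p q\<close> of the free product \<open>P\<close>.\<close>

locale free_product_of_matrix_algebras =
  fixes m :: nat and r :: "nat \<Rightarrow> nat" and w :: "nat \<Rightarrow> nat \<Rightarrow> nat"
    and A :: "nat \<Rightarrow> ('k::field, 'a) module" and \<phi> :: "nat \<Rightarrow> 'a \<Rightarrow> nat \<Rightarrow> 'k mat"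
  assumes factor_algebra: "i < m \<Longrightarrow> assoc_algebra class_ring (A i)"
    and width_pos: "\<lbrakk>i < m; j < r i\<rbrakk> \<Longrightarrow> w i j \<ge> 1"
    and factor_iso: "i < m \<Longrightarrow> \<phi> i \<in> alg_iso class_ring (A i) (mat_algebras (r i) (w i))"
begin

abbreviation "P \<equiv> free_product {..<m} A"
abbreviation "e \<equiv> unit_elt m r w A \<phi>"

text \<open>The blocks into which the \<open>i\<close>-th factor decomposes a module.\<close>

definition "indices i = (SIGMA j:{..<r i}. {..<w i j})"

lemma finite_indices [simp]: "finite (indices i)" by (simp add: indices_def)

lemma in_indices [simp]: "(j, k) \<in> indices i \<longleftrightarrow> j < r i \<and> k < w i j" by (auto simp: indices_def)

lemma P_algebra: "assoc_algebra class_ring P"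
  by (rule free_product_assoc_algebra) (simp add: factor_algebra)

sublocale P: assoc_algebra class_ring P by (rule P_algebra)

text \<open>The homomorphism from the product of matrix algebras to the free product that carries the
  matrix units to \<open>e i\<close>.\<close>

definition "\<theta> i b = free_product_incl {..<m} A i (inv_into (carrier (A i)) (\<phi> i) b)"

lemma \<theta>_hom:
  assumes "i < m"
  shows "\<theta> i \<in> alg_hom class_ring (mat_algebras (r i) (w i)) P"
  unfolding \<theta>_def
  by (rule alg_hom_compose[where B = "A i" and g = "free_product_incl {..<m} A i"],
      rule alg_iso_inverse[OF factor_algebra[OF assms] factor_iso[OF assms]],
      rule free_product_incl_hom) (use assms in \<open>simp_all add: factor_algebra\<close>)

lemma e_eq: "e i j p q = \<theta> i (mat_unit (r i) (w i) j p q)"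
  by (simp add: unit_elt_def \<theta>_def)

lemma e_in: "i < m \<Longrightarrow> e i j p q \<in> carrier P"
  unfolding e_eq by (rule alg_homD(1)[OF \<theta>_hom mat_unit_in])

lemma \<theta>_zero:
  assumes "i < m"
  shows "\<theta> i \<zero>\<^bsub>mat_algebras (r i) (w i)\<^esub> = \<zero>\<^bsub>P\<^esub>"
  by (rule alg_hom_zero[OF left_module_abelian_group[OF mat_algebras_left_module] P.abelian_group_axioms
    \<theta>_hom[OF assms]])

lemma e_mult:
  assumes "i < m" "q < w i j" "p' < w i j'"
  shows "e i j p q \<otimes>\<^bsub>P\<^esub> e i j' p' q' = (if j = j' \<and> q = p' then e i j p q' else \<zero>\<^bsub>P\<^esub>)"
  unfolding e_eq alg_homD(3)[OF \<theta>_hom[OF assms(1)] mat_unit_in mat_unit_in, symmetric]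
    mat_unit_mult[where d = "w i", OF assms(2,3)] by (simp add: \<theta>_zero[OF assms(1)])

lemma e_sum:
  assumes "i < m"
  shows "finsum P (\<lambda>(j, k). e i j k k) (indices i) = \<one>\<^bsub>P\<^esub>"
proof -
  have "\<one>\<^bsub>P\<^esub> = \<theta> i \<one>\<^bsub>mat_algebras (r i) (w i)\<^esub>" by (rule alg_homD(4)[OF \<theta>_hom[OF assms], symmetric])
  also have "\<dots> = (\<Oplus>\<^bsub>P\<^esub>s\<in>indices i. \<theta> i ((\<lambda>(j, k). mat_unit (r i) (w i) j k k) s))"
    unfolding mat_algebras_one indices_def[symmetric]
    by (rule alg_hom_finsum[OF left_module_abelian_group[OF mat_algebras_left_module] P.abelian_group_axioms
      \<theta>_hom[OF assms]]) (auto simp: mat_unit_in)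
  finally show ?thesis by (simp add: e_eq prod.case_distrib)
qed

text \<open>Each factor is spanned by its matrix units, and the factors generate.\<close>

lemma P_induct [consumes 1, case_names unit one scale add mult]:
  assumes x: "x \<in> carrier P"
    and unit: "\<And>i j p q. \<lbrakk>i < m; j < r i; p < w i j; q < w i j\<rbrakk> \<Longrightarrow> T (e i j p q)"
    and one: "T \<one>\<^bsub>P\<^esub>"
    and scale: "\<And>c x. x \<in> carrier P \<Longrightarrow> T x \<Longrightarrow> T (c \<odot>\<^bsub>P\<^esub> x)"
    and add: "\<And>x y. \<lbrakk>x \<in> carrier P; y \<in> carrier P; T x; T y\<rbrakk> \<Longrightarrow> T (x \<oplus>\<^bsub>P\<^esub> y)"
    and mult: "\<And>x y. \<lbrakk>x \<in> carrier P; y \<in> carrier P; T x; T y\<rbrakk> \<Longrightarrow> T (x \<otimes>\<^bsub>P\<^esub> y)"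
  shows "T x"
proof (rule free_product_induct[OF _ x])
  fix i a assume incl: "i \<in> {..<m}" "a \<in> carrier (A i)"
  then have i: "i < m" by simp
  let ?B = "mat_algebras (r i) (w i) :: ('k, nat \<Rightarrow> 'k mat) module"
  let ?S = "SIGMA j:{..<r i}. {..<w i j} \<times> {..<w i j}"
  have bij: "bij_betw (\<phi> i) (carrier (A i)) (carrier ?B)" and h: "\<phi> i \<in> alg_hom class_ring (A i) ?B"
    using factor_iso[OF i] by (auto simp: alg_iso_def)
  define b where "b = \<phi> i a"
  have b: "b \<in> carrier ?B" using alg_homD(1)[OF h incl(2)] by (simp add: b_def)
  have ab: "free_product_incl {..<m} A i a = \<theta> i b"
    using bij incl(2) by (simp add: \<theta>_def b_def bij_betw_def inv_into_f_f)
  have sm: "c \<odot>\<^bsub>P\<^esub> x \<in> carrier P" if "x \<in> carrier P" for c x using P.smult_closed[of c x] that by simp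
  have z: "T \<zero>\<^bsub>P\<^esub>"
    using scale[OF P.one_closed one, of 0] P.smult_l_null[OF P.one_closed] by simp
  let ?f = "\<lambda>(j, p, q). (b j $$ (p, q)) \<odot>\<^bsub>P\<^esub> e i j p q"
  have "\<theta> i b = (\<Oplus>\<^bsub>P\<^esub>s\<in>?S. \<theta> i ((\<lambda>(j, p, q). (b j $$ (p, q)) \<odot>\<^bsub>?B\<^esub> mat_unit (r i) (w i) j p q) s))"
    by (subst mat_algebras_expand[OF b], rule alg_hom_finsum[OF left_module_abelian_group[OF mat_algebras_left_module]
      P.abelian_group_axioms \<theta>_hom[OF i]])
      (auto intro!: left_module_closed(3)[OF mat_algebras_left_module] mat_unit_in)
  also have "\<dots> = (\<Oplus>\<^bsub>P\<^esub>s\<in>?S. ?f s)"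
    by (rule P.finsum_cong') (auto simp: e_eq[symmetric] alg_homD(5)[OF \<theta>_hom[OF i] _ mat_unit_in] e_in[OF i] sm)
  finally have eq: "\<theta> i b = (\<Oplus>\<^bsub>P\<^esub>s\<in>?S. ?f s)" .
  have "T (\<Oplus>\<^bsub>P\<^esub>s\<in>S. ?f s)" if "finite S" "S \<subseteq> ?S" for S
    using that
  proof (induction S rule: finite_induct)
    case empty
    show ?case using z by simp
  next
    case (insert s S)
    have c: "?f s \<in> carrier P" for s by (auto split: prod.split intro!: sm e_in[OF i])
    have Ts: "T (?f s)" using insert(4) by (auto intro!: scale unit i e_in[OF i])
    have TS: "T (finsum P ?f S)" using insert by blast
    have cS: "finsum P ?f S \<in> carrier P" using c by (intro P.finsum_closed) auto
    have "finsum P ?f (insert s S) = ?f s \<oplus>\<^bsub>P\<^esub> finsum P ?f S"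
      using insert(1,2) c by (intro P.finsum_insert) auto
    then show ?case using add[OF c cS Ts TS] by (simp only:)
  qed
  then show "T (free_product_incl {..<m} A i a)" unfolding ab eq by simp
qed (use factor_algebra one scale add mult in auto)

end

section \<open>The functor \<open>F\<close>\<close>

lemma Psi_dom_left_module:
  assumes X: "X \<in> Obj (rep_quiver (quiver m r w))" and i: "i < m"
  shows "left_module class_ring (Psi_dom r w X i)"
  unfolding Psi_dom_def
  by (rule dprod_left_module[OF class_ring.ring_axioms]) (use i rep_quiver_ObjD(2)[OF X] in auto)

lemma Psi_dom_simps:
  "y \<in> carrier (Psi_dom r w X i) \<longleftrightarrow> y \<in> extensional (SIGMA j:{..<r i}. {..<w i j}) \<and>
    (\<forall>j<r i. \<forall>k<w i j. y (j, k) \<in> carrier (space X (Source i j)))"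
  "y \<oplus>\<^bsub>Psi_dom r w X i\<^esub> z = (\<lambda>(j, k)\<in>(SIGMA j:{..<r i}. {..<w i j}). y (j, k) \<oplus>\<^bsub>space X (Source i j)\<^esub> z (j, k))"
  "c \<odot>\<^bsub>Psi_dom r w X i\<^esub> y = (\<lambda>(j, k)\<in>(SIGMA j:{..<r i}. {..<w i j}). c \<odot>\<^bsub>space X (Source i j)\<^esub> y (j, k))"
  unfolding Psi_dom_def dprod_simps by (force simp: PiE_iff, auto intro!: restrict_ext)

lemma Psi_summand_closed:
  assumes X: "X \<in> Obj (rep_quiver (quiver m r w))" and i: "i < m"
    and y: "y \<in> carrier (Psi_dom r w X i)" and jk: "jk \<in> (SIGMA j:{..<r i}. {..<w i j})"
  shows "amap X (i, jk) (y jk) \<in> carrier (space X Sink)"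
proof -
  obtain j k where jk': "jk = (j, k)" "j < r i" "k < w i j" using jk by auto
  have "amap X (i, j, k) \<in> lin_maps class_ring (space X (Source i j)) (space X Sink)"
    using rep_quiver_ObjD(3)[OF X, of "(i, j, k)"] jk' i by simp
  then show ?thesis using y jk' by (simp add: Psi_dom_simps(1) lin_mapsD(1))
qed

text \<open>\<open>Psi\<close> is a sum of the linear maps \<open>amap X (i, j, k)\<close>, applied to the coordinates.\<close>

lemma Psi_lin_map:
  assumes X: "X \<in> Obj (rep_quiver (quiver m r w))" and i: "i < m"
  shows "Psi r w X i \<in> lin_maps class_ring (Psi_dom r w X i) (space X Sink)"
proof -
  let ?I = "SIGMA j:{..<r i}. {..<w i j}" and ?D = "Psi_dom r w X i"
  have S: "left_module class_ring (space X Sink)" using rep_quiver_ObjD(2)[OF X] by simp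
  then interpret S: vectorspace class_ring "space X Sink" by (rule left_module_class_ring_vectorspace)
  note D = left_module_closed[OF Psi_dom_left_module[OF X i]] and cl = Psi_summand_closed[OF X i]
  have am: "amap X (i, j, k) \<in> lin_maps class_ring (space X (Source i j)) (space X Sink)"
    if "j < r i" "k < w i j" for j k using rep_quiver_ObjD(3)[OF X, of "(i, j, k)"] that i by simp
  show ?thesis
  proof (rule lin_mapsI)
    fix y assume y: "y \<in> carrier ?D"
    show "Psi r w X i y \<in> carrier (space X Sink)"
      using y cl[OF y] by (auto simp: Psi_def intro!: S.M.finsum_closed)
    fix z assume z: "z \<in> carrier ?D"
    have "Psi r w X i (y \<oplus>\<^bsub>?D\<^esub> z) =
        (\<Oplus>\<^bsub>space X Sink\<^esub>jk\<in>?I. amap X (i, jk) (y jk) \<oplus>\<^bsub>space X Sink\<^esub> amap X (i, jk) (z jk))"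
      unfolding Psi_def restrict_apply if_P[OF D(1)[OF y z]]
    proof (rule S.M.finsum_cong')
      fix jk assume jk: "jk \<in> ?I"
      then obtain j k where "jk = (j, k)" "j < r i" "k < w i j" by auto
      then show "amap X (i, jk) ((y \<oplus>\<^bsub>?D\<^esub> z) jk) = amap X (i, jk) (y jk) \<oplus>\<^bsub>space X Sink\<^esub> amap X (i, jk) (z jk)"
        using y z lin_mapsD(2)[OF am] by (simp add: Psi_dom_simps)
    qed (use cl[OF y] cl[OF z] in auto)
    also have "\<dots> = Psi r w X i y \<oplus>\<^bsub>space X Sink\<^esub> Psi r w X i z"
      using y z cl[OF y] cl[OF z] by (simp add: Psi_def S.M.finsum_addf Pi_def)
    finally show "Psi r w X i (y \<oplus>\<^bsub>?D\<^esub> z) = Psi r w X i y \<oplus>\<^bsub>space X Sink\<^esub> Psi r w X i z" .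
  next
    fix c :: 'a and y assume c: "c \<in> carrier class_ring" and y: "y \<in> carrier ?D"
    have "Psi r w X i (c \<odot>\<^bsub>?D\<^esub> y) =
        (\<Oplus>\<^bsub>space X Sink\<^esub>jk\<in>?I. c \<odot>\<^bsub>space X Sink\<^esub> amap X (i, jk) (y jk))"
      unfolding Psi_def restrict_apply if_P[OF D(3)[OF c y]]
    proof (rule S.M.finsum_cong')
      fix jk assume jk: "jk \<in> ?I"
      then obtain j k where "jk = (j, k)" "j < r i" "k < w i j" by auto
      then show "amap X (i, jk) ((c \<odot>\<^bsub>?D\<^esub> y) jk) = c \<odot>\<^bsub>space X Sink\<^esub> amap X (i, jk) (y jk)"
        using y lin_mapsD(3)[OF am, of _ _ c] by (simp add: Psi_dom_simps)
    qed (use cl[OF y] left_module_closed(3)[OF S c] in auto)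
    also have "\<dots> = c \<odot>\<^bsub>space X Sink\<^esub> Psi r w X i y"
      using y cl[OF y] S.finsum_smult[OF c, of "\<lambda>jk. amap X (i, jk) (y jk)" ?I] by (simp add: Psi_def Pi_def)
    finally show "Psi r w X i (c \<odot>\<^bsub>?D\<^esub> y) = c \<odot>\<^bsub>space X Sink\<^esub> Psi r w X i y" .
  qed (simp add: Psi_def)
qed

lemma balanced_iff:
  assumes X: "X \<in> Obj (rep_quiver (quiver m r w))"
  shows "balanced m r w X \<longleftrightarrow>
    (\<forall>i<m. bij_betw (Psi r w X i) (carrier (Psi_dom r w X i)) (carrier (space X Sink)))"
  unfolding balanced_def using invertible_lin_map_iff[OF Psi_dom_left_module[OF X]] Psi_lin_map[OF X] by blast

lemma left_module_finsum_act:
  assumes M: "left_module R M" and S: "finite S" "\<And>s. s \<in> S \<Longrightarrow> a s \<in> carrier R" and x: "x \<in> carrier M"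
  shows "(\<Oplus>\<^bsub>R\<^esub>s\<in>S. a s) \<odot>\<^bsub>M\<^esub> x = (\<Oplus>\<^bsub>M\<^esub>s\<in>S. a s \<odot>\<^bsub>M\<^esub> x)"
proof -
  interpret R: ring R by (rule left_module.axioms(1)[OF M])
  interpret M: abelian_group M by (rule left_module_abelian_group[OF M])
  show ?thesis using S
    by (induction S rule: finite_induct)
      (simp_all add: left_module_zero_act[OF M x] R.finsum_insert M.finsum_insert R.finsum_closed
        left_module.act_add_left[OF M] left_module_closed(3)[OF M] x Pi_def)
qed

lemma left_module_act_finsum:
  assumes M: "left_module R M" and S: "finite S" "\<And>s. s \<in> S \<Longrightarrow> f s \<in> carrier M" and a: "a \<in> carrier R"
  shows "a \<odot>\<^bsub>M\<^esub> (\<Oplus>\<^bsub>M\<^esub>s\<in>S. f s) = (\<Oplus>\<^bsub>M\<^esub>s\<in>S. a \<odot>\<^bsub>M\<^esub> f s)"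
proof -
  interpret M: abelian_group M by (rule left_module_abelian_group[OF M])
  show ?thesis using S
    by (induction S rule: finite_induct)
      (simp_all add: left_module_act_zero[OF M a] M.finsum_insert M.finsum_closed
        left_module.act_add_right[OF M] left_module_closed(3)[OF M] a Pi_def)
qed

lemma finsum_single:
  assumes "abelian_group M" "finite S" "s \<in> S" "f s \<in> carrier M" "\<And>t. t \<in> S \<Longrightarrow> t \<noteq> s \<Longrightarrow> f t = \<zero>\<^bsub>M\<^esub>"
  shows "(\<Oplus>\<^bsub>M\<^esub>t\<in>S. f t) = f s"
proof -
  interpret M: abelian_group M by fact
  have "(\<Oplus>\<^bsub>M\<^esub>t\<in>S. f t) = (\<Oplus>\<^bsub>M\<^esub>t\<in>S. if s = t then f t else \<zero>\<^bsub>M\<^esub>)"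
    using assms by (intro M.finsum_cong') auto
  also have "\<dots> = (\<Oplus>\<^bsub>M\<^esub>t\<in>S. if s = t then f s else \<zero>\<^bsub>M\<^esub>)"
    using assms by (intro M.finsum_cong') auto
  also have "\<dots> = f s" using M.finsum_singleton[OF assms(3,2), of "\<lambda>_. f s"] assms(4) by simp
  finally show ?thesis .
qed

lemma finsum_underlying_space:
  fixes P :: "('k::field, 'a) module"
  assumes P: "assoc_algebra class_ring P" and M: "left_module P M"
    and S: "finite S" "\<And>s. s \<in> S \<Longrightarrow> f s \<in> carrier M"
  shows "finsum (underlying_space P M) f S = finsum M f S"
proof -
  interpret M: abelian_group M by (rule left_module_abelian_group[OF M])
  interpret U: abelian_group "underlying_space P M"
    by (rule left_module_abelian_group[OF underlying_space_left_module[OF P M]])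
  show ?thesis using S
    by (induction S rule: finite_induct) (simp_all add: M.finsum_insert U.finsum_insert Pi_def)
qed

context free_product_of_matrix_algebras
begin

abbreviation "F \<equiv> functor_F m r w A \<phi>"
abbreviation "Q \<equiv> quiver m r w"

lemma F_simps [simp]:
  "space (fobj F M) Sink = underlying_space P M"
  "space (fobj F M) (Source i j) = (underlying_space P M)\<lparr>carrier := (\<lambda>x. e i j 0 0 \<odot>\<^bsub>M\<^esub> x) ` carrier M\<rparr>"
  "amap (fobj F M) (i, j, k) = (\<lambda>x\<in>(\<lambda>x. e i j 0 0 \<odot>\<^bsub>M\<^esub> x) ` carrier M. e i j k 0 \<odot>\<^bsub>M\<^esub> x)"
  "farr F M N f = (\<lambda>v\<in>verts Q. restrict f (carrier (space (fobj F M) v)))"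
  by (simp_all add: functor_F_def Let_def)

lemma scalar_eq:
  assumes "a \<in> carrier P"
  shows "c \<odot>\<^bsub>P\<^esub> a = (c \<odot>\<^bsub>P\<^esub> \<one>\<^bsub>P\<^esub>) \<otimes>\<^bsub>P\<^esub> a" "c \<odot>\<^bsub>P\<^esub> a = a \<otimes>\<^bsub>P\<^esub> (c \<odot>\<^bsub>P\<^esub> \<one>\<^bsub>P\<^esub>)"
  using assms P.smult_mult_left[of c "\<one>\<^bsub>P\<^esub>" a] P.smult_mult_right[of c a "\<one>\<^bsub>P\<^esub>"] by simp_all

lemma w_pos: "i < m \<Longrightarrow> j < r i \<Longrightarrow> 0 < w i j"
  using width_pos[of i j] by simp

context
  fixes M :: "(((nat \<times> 'a) list \<Rightarrow> 'k) set, 'v) module"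
  assumes M: "left_module P M"
begin

interpretation M: abelian_group M by (rule left_module_abelian_group[OF M])

lemma e_act_closed: "i < m \<Longrightarrow> x \<in> carrier M \<Longrightarrow> e i j p q \<odot>\<^bsub>M\<^esub> x \<in> carrier M"
  by (rule left_module_closed(3)[OF M e_in])

lemma e_act_e:
  assumes "i < m" "q < w i j" "p' < w i j'" "x \<in> carrier M"
  shows "e i j p q \<odot>\<^bsub>M\<^esub> (e i j' p' q' \<odot>\<^bsub>M\<^esub> x) = (if j = j' \<and> q = p' then e i j p q' \<odot>\<^bsub>M\<^esub> x else \<zero>\<^bsub>M\<^esub>)"
  unfolding left_module.act_mult[OF M e_in[OF assms(1)] e_in[OF assms(1)] assms(4), symmetric]
    e_mult[OF assms(1-3)] by (simp add: left_module_zero_act[OF M assms(4)])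

lemma scalar_act_commute:
  assumes "a \<in> carrier P" "x \<in> carrier M"
  shows "(c \<odot>\<^bsub>P\<^esub> \<one>\<^bsub>P\<^esub>) \<odot>\<^bsub>M\<^esub> (a \<odot>\<^bsub>M\<^esub> x) = a \<odot>\<^bsub>M\<^esub> ((c \<odot>\<^bsub>P\<^esub> \<one>\<^bsub>P\<^esub>) \<odot>\<^bsub>M\<^esub> x)"
  using left_module.act_mult[OF M scalar_in_algebra[OF P_algebra, of c] assms]
    left_module.act_mult[OF M assms(1) scalar_in_algebra[OF P_algebra, of c] assms(2)]
    scalar_eq[OF assms(1), of c] by metis

text \<open>The diagonal units sum to \<open>1\<close>, and \<open>e i j k k\<close> factors through \<open>e i j 0 0 M\<close> as \<open>e i j k 0\<close> after
  \<open>e i j 0 k\<close>.\<close>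

lemma corner_decomposition:
  assumes i: "i < m" and x: "x \<in> carrier M"
  shows "x = finsum M (\<lambda>(j, k). e i j k 0 \<odot>\<^bsub>M\<^esub> (e i j 0 k \<odot>\<^bsub>M\<^esub> x)) (indices i)"
proof -
  have "x = \<one>\<^bsub>P\<^esub> \<odot>\<^bsub>M\<^esub> x" by (rule left_module.act_one[OF M x, symmetric])
  also have "\<dots> = finsum P (\<lambda>(j, k). e i j k k) (indices i) \<odot>\<^bsub>M\<^esub> x" by (simp only: e_sum[OF i])
  also have "\<dots> = finsum M (\<lambda>s. (\<lambda>(j, k). e i j k k) s \<odot>\<^bsub>M\<^esub> x) (indices i)"
    by (rule left_module_finsum_act[OF M _ _ x]) (auto simp: e_in[OF i])
  also have "\<dots> = finsum M (\<lambda>(j, k). e i j k 0 \<odot>\<^bsub>M\<^esub> (e i j 0 k \<odot>\<^bsub>M\<^esub> x)) (indices i)"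
    by (rule M.finsum_cong') (auto simp: e_act_e[OF i] w_pos[OF i] x e_act_closed[OF i])
  finally show ?thesis .
qed

text \<open>The fixed space of the idempotent \<open>e i j 0 0\<close>.\<close>

abbreviation "corner i j \<equiv> (\<lambda>x. e i j 0 0 \<odot>\<^bsub>M\<^esub> x) ` carrier M"

lemma corner_iff:
  assumes "i < m" "j < r i"
  shows "x \<in> corner i j \<longleftrightarrow> x \<in> carrier M \<and> e i j 0 0 \<odot>\<^bsub>M\<^esub> x = x"
  using assms w_pos[OF assms] e_act_e[OF assms(1), of 0 j 0 j _ 0 0] e_act_closed[OF assms(1)] by force

lemma corner_e: "\<lbrakk>i < m; j < r i; q < w i j; x \<in> carrier M\<rbrakk> \<Longrightarrow> e i j 0 q \<odot>\<^bsub>M\<^esub> x \<in> corner i j"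
  by (simp add: corner_iff e_act_closed e_act_e w_pos)

text \<open>Scalars commute with the action of the algebra.\<close>

lemma corner_submodule:
  assumes "i < m" "j < r i"
  shows "submodule class_ring (corner i j) (underlying_space P M)"
  by (rule submoduleI[OF underlying_space_vectorspace[OF P_algebra M]])
    (use assms in \<open>auto simp: corner_iff left_module_closed[OF M] left_module_act_zero[OF M] e_in
      left_module.act_add_right[OF M] scalar_in_algebra[OF P_algebra] scalar_act_commute[OF e_in, symmetric]\<close>)

lemma corner_closed:
  assumes "i < m" "j < r i" "x \<in> corner i j"
  shows "x \<in> carrier M" "y \<in> corner i j \<Longrightarrow> x \<oplus>\<^bsub>M\<^esub> y \<in> corner i j"
    "(c \<odot>\<^bsub>P\<^esub> \<one>\<^bsub>P\<^esub>) \<odot>\<^bsub>M\<^esub> x \<in> corner i j"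
proof -
  interpret N: submodule class_ring "corner i j" "underlying_space P M" by (rule corner_submodule[OF assms(1,2)])
  show "x \<in> carrier M" using N.subset assms(3) by auto
  show "y \<in> corner i j \<Longrightarrow> x \<oplus>\<^bsub>M\<^esub> y \<in> corner i j" using N.m_closed[OF assms(3)] by simp
  show "(c \<odot>\<^bsub>P\<^esub> \<one>\<^bsub>P\<^esub>) \<odot>\<^bsub>M\<^esub> x \<in> corner i j" using N.smult_closed[OF _ assms(3), of c] by simp
qed

lemma F_rep:
  assumes fd: "fd_space (underlying_space P M)"
  shows "fobj F M \<in> Obj (rep_quiver Q)"
proof -
  have "fd_space (space (fobj F M) (Source i j))" if "i < m" "j < r i" for i j
    using fd_space_subspace[OF fd corner_submodule[OF that]] by simp
  moreover have "amap (fobj F M) (i, j, k) \<in> lin_maps class_ring (space (fobj F M) (Source i j)) (space (fobj F M) Sink)"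
    if "i < m" "j < r i" "k < w i j" for i j k
  proof -
    note cl = corner_closed[OF that(1,2)]
    show ?thesis
    proof (rule lin_mapsI)
      fix x assume "x \<in> carrier (space (fobj F M) (Source i j))"
      then have x: "x \<in> corner i j" by simp
      note x = x cl(1)[OF x]
      show "amap (fobj F M) (i, j, k) x \<in> carrier (space (fobj F M) Sink)"
        using x that e_act_closed by simp
      show "amap (fobj F M) (i, j, k) (c \<odot>\<^bsub>space (fobj F M) (Source i j)\<^esub> x) =
          c \<odot>\<^bsub>space (fobj F M) Sink\<^esub> amap (fobj F M) (i, j, k) x" for c
        using x cl(3)[OF x(1)] scalar_act_commute[OF e_in[OF that(1)] x(2)] by simp
      fix y assume "y \<in> carrier (space (fobj F M) (Source i j))"
      then have y: "y \<in> corner i j" by simp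
      note y = y cl(1)[OF y]
      show "amap (fobj F M) (i, j, k) (x \<oplus>\<^bsub>space (fobj F M) (Source i j)\<^esub> y) =
          amap (fobj F M) (i, j, k) x \<oplus>\<^bsub>space (fobj F M) Sink\<^esub> amap (fobj F M) (i, j, k) y"
        using x y cl(2)[OF x(1) y(1)] left_module.act_add_right[OF M e_in[OF that(1)] x(2) y(2)] by simp
    qed simp
  qed
  ultimately show ?thesis using fd by auto
qed

text \<open>The inverse of \<open>Psi\<close> sends \<open>x\<close> to the family of the \<open>e i j 0 k x\<close>: one composite is the identity by
  \<open>corner_decomposition\<close>, the other because \<open>e i j 0 k\<close> kills the images of all arrows with
  first index \<open>i\<close> but \<open>(i, j, k)\<close>.\<close>

lemma F_balanced:
  assumes fd: "fd_space (underlying_space P M)"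
  shows "balanced m r w (fobj F M)"
  unfolding balanced_iff[OF F_rep[OF fd]]
proof (intro allI impI)
  fix i assume i: "i < m"
  let ?D = "Psi_dom r w (fobj F M) i" and ?\<Psi> = "Psi r w (fobj F M) i"
  have D: "y \<in> carrier ?D \<longleftrightarrow> y \<in> extensional (indices i) \<and> (\<forall>j<r i. \<forall>k<w i j. y (j, k) \<in> corner i j)" for y
    by (simp add: Psi_dom_simps indices_def)
  have \<Psi>: "?\<Psi> y = finsum M (\<lambda>(j, k). e i j k 0 \<odot>\<^bsub>M\<^esub> y (j, k)) (indices i)" if y: "y \<in> carrier ?D" for y
  proof -
    have "?\<Psi> y = finsum (underlying_space P M) (\<lambda>jk. amap (fobj F M) (i, jk) (y jk)) (indices i)"
      using y by (simp add: Psi_def indices_def)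
    also have "\<dots> = finsum M (\<lambda>jk. amap (fobj F M) (i, jk) (y jk)) (indices i)"
      by (rule finsum_underlying_space[OF P_algebra M]) (use Psi_summand_closed[OF F_rep[OF fd] i y] in \<open>auto simp: indices_def\<close>)
    also have "\<dots> = finsum M (\<lambda>(j, k). e i j k 0 \<odot>\<^bsub>M\<^esub> y (j, k)) (indices i)"
      by (rule M.finsum_cong') (use y in \<open>auto simp: D corner_iff i e_act_closed\<close>)
    finally show ?thesis .
  qed
  show "bij_betw ?\<Psi> (carrier ?D) (carrier (space (fobj F M) Sink))"
  proof (rule bij_betwI[where g = "\<lambda>x. \<lambda>(j, k)\<in>indices i. e i j 0 k \<odot>\<^bsub>M\<^esub> x"])
    show "?\<Psi> \<in> carrier ?D \<rightarrow> carrier (space (fobj F M) Sink)"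
      using lin_mapsD(1)[OF Psi_lin_map[OF F_rep[OF fd] i]] by blast
    have g: "(\<lambda>(j, k)\<in>indices i. e i j 0 k \<odot>\<^bsub>M\<^esub> x) \<in> carrier ?D" if "x \<in> carrier M" for x
      using that by (simp add: D corner_e i)
    then show "(\<lambda>x. \<lambda>(j, k)\<in>indices i. e i j 0 k \<odot>\<^bsub>M\<^esub> x) \<in> carrier (space (fobj F M) Sink) \<rightarrow> carrier ?D" by simp
    show "?\<Psi> (\<lambda>(j, k)\<in>indices i. e i j 0 k \<odot>\<^bsub>M\<^esub> x) = x" if "x \<in> carrier (space (fobj F M) Sink)" for x
    proof -
      have x: "x \<in> carrier M" using that by simp
      have "?\<Psi> (\<lambda>(j, k)\<in>indices i. e i j 0 k \<odot>\<^bsub>M\<^esub> x) =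
          finsum M (\<lambda>(j, k). e i j k 0 \<odot>\<^bsub>M\<^esub> (e i j 0 k \<odot>\<^bsub>M\<^esub> x)) (indices i)"
        unfolding \<Psi>[OF g[OF x]] by (rule M.finsum_cong') (auto simp: x i e_act_closed)
      then show ?thesis using corner_decomposition[OF i x] by simp
    qed
    fix y assume y: "y \<in> carrier ?D"
    have yM: "y (j, k) \<in> carrier M" "e i j 0 0 \<odot>\<^bsub>M\<^esub> y (j, k) = y (j, k)" if "j < r i" "k < w i j" for j k
      using y that by (auto simp: D corner_iff i)
    show "(\<lambda>(j, k)\<in>indices i. e i j 0 k \<odot>\<^bsub>M\<^esub> ?\<Psi> y) = y"
    proof (rule restrict_eq_of_extensional)
      show "y \<in> extensional (indices i)" using y by (simp add: D)
      fix jk assume "jk \<in> indices i"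
      then obtain j k where jk: "jk = (j, k)" "j < r i" "k < w i j" by (cases jk) auto
      have "e i j 0 k \<odot>\<^bsub>M\<^esub> ?\<Psi> y =
          finsum M (\<lambda>s. e i j 0 k \<odot>\<^bsub>M\<^esub> (\<lambda>(j, k). e i j k 0 \<odot>\<^bsub>M\<^esub> y (j, k)) s) (indices i)"
        unfolding \<Psi>[OF y] by (rule left_module_act_finsum[OF M]) (auto simp: yM e_act_closed e_in i)
      also have "\<dots> = e i j 0 k \<odot>\<^bsub>M\<^esub> (\<lambda>(j, k). e i j k 0 \<odot>\<^bsub>M\<^esub> y (j, k)) (j, k)"
        by (rule finsum_single[OF M.abelian_group_axioms]) (use jk in \<open>auto simp: i yM e_act_closed e_act_e split: if_splits\<close>)
      also have "\<dots> = y (j, k)" using jk by (simp add: i yM e_act_e)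
      finally show "(case jk of (j, k) \<Rightarrow> e i j 0 k \<odot>\<^bsub>M\<^esub> ?\<Psi> y) = y jk" by (simp add: jk)
    qed
  qed
qed

end

lemma F_obj:
  fixes M :: "(((nat \<times> 'a) list \<Rightarrow> 'k) set, 'v) module"
  assumes "M \<in> Obj (rep_algebra P)"
  shows "fobj F M \<in> Obj (balanced_reps m r w)"
  using F_rep[of M] F_balanced[of M] assms unfolding balanced_reps_def full_subcategory_simps by auto

lemma F_arr:
  assumes M: "left_module P M" and N: "left_module P N" and f: "f \<in> lin_maps P M N"
  shows "farr F M N f \<in> Hom (rep_quiver Q) (fobj F M) (fobj F N)"
proof (rule rep_quiver_HomI)
  show "farr F M N f \<in> extensional (verts Q)" by simp
  note fD = lin_mapsD[OF f]
  have fc: "f x \<in> (\<lambda>x. e i j 0 0 \<odot>\<^bsub>N\<^esub> x) ` carrier N" if "i < m" "x \<in> (\<lambda>x. e i j 0 0 \<odot>\<^bsub>M\<^esub> x) ` carrier M" for i j x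
    using that by (auto simp: fD(1) fD(3)[OF e_in])
  fix v assume v: "v \<in> verts Q"
  show "farr F M N f v \<in> lin_maps class_ring (space (fobj F M) v) (space (fobj F N) v)"
  proof (cases v)
    case Sink
    have "restrict f (carrier M) = f" using fD(4) by (simp add: extensional_restrict)
    then show ?thesis using Sink lin_maps_underlying[OF P_algebra f] by simp
  next
    case (Source i j)
    with v have ij: "i < m" "j < r i" by auto
    note cl = corner_closed[OF M ij]
    show ?thesis
      unfolding Source
    proof (rule lin_mapsI)
      fix x assume "x \<in> carrier (space (fobj F M) (Source i j))"
      then have x: "x \<in> (\<lambda>x. e i j 0 0 \<odot>\<^bsub>M\<^esub> x) ` carrier M" by simp
      show "farr F M N f (Source i j) x \<in> carrier (space (fobj F N) (Source i j))"
        using x fc[OF ij(1) x] ij by simp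
      show "farr F M N f (Source i j) (c \<odot>\<^bsub>space (fobj F M) (Source i j)\<^esub> x) =
          c \<odot>\<^bsub>space (fobj F N) (Source i j)\<^esub> farr F M N f (Source i j) x" for c
        using x cl(1,3)[OF x] ij fD(3)[OF scalar_in_algebra[OF P_algebra]] by simp
      fix y assume "y \<in> carrier (space (fobj F M) (Source i j))"
      then have y: "y \<in> (\<lambda>x. e i j 0 0 \<odot>\<^bsub>M\<^esub> x) ` carrier M" by simp
      show "farr F M N f (Source i j) (x \<oplus>\<^bsub>space (fobj F M) (Source i j)\<^esub> y) =
          farr F M N f (Source i j) x \<oplus>\<^bsub>space (fobj F N) (Source i j)\<^esub> farr F M N f (Source i j) y"
        using x y cl(2)[OF x y] cl(1)[OF x] cl(1)[OF y] ij fD(2) by simp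
    qed (use ij in simp)
  qed
next
  note fD = lin_mapsD[OF f]
  fix \<alpha> x assume a: "\<alpha> \<in> arcs Q" "x \<in> carrier (space (fobj F M) (tail Q \<alpha>))"
  then obtain i j k where ijk: "\<alpha> = (i, j, k)" "i < m" "j < r i" "k < w i j" by auto
  have x: "x \<in> (\<lambda>x. e i j 0 0 \<odot>\<^bsub>M\<^esub> x) ` carrier M" "x \<in> carrier M" using a ijk e_act_closed[OF M] by auto
  have "f x \<in> (\<lambda>x. e i j 0 0 \<odot>\<^bsub>N\<^esub> x) ` carrier N" using x ijk by (auto simp: fD(1) fD(3)[OF e_in])
  then show "farr F M N f (head Q \<alpha>) (amap (fobj F M) \<alpha> x) = amap (fobj F N) \<alpha> (farr F M N f (tail Q \<alpha>) x)"
    using x ijk by (simp add: e_act_closed[OF M] fD(3)[OF e_in])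
qed

end

section \<open>Full faithfulness of \<open>F\<close>\<close>

context free_product_of_matrix_algebras
begin

lemma rep_algebra_category: "category (rep_algebra P)"
  by (rule preadditive_category.axioms(1)[OF rep_algebra_preadditive])

lemma balanced_reps_category: "category (balanced_reps m r w)"
  by (rule preadditive_category.axioms(1)[OF balanced_reps_preadditive])

lemma balanced_reps_simps [simp]:
  "Obj (balanced_reps m r w) = {X \<in> Obj (rep_quiver Q). balanced m r w X}"
  "Hom (balanced_reps m r w) = Hom (rep_quiver Q)" "Idt (balanced_reps m r w) = Idt (rep_quiver Q)"
  "Comp (balanced_reps m r w) = Comp (rep_quiver Q)" "Hom_add (balanced_reps m r w) = Hom_add (rep_quiver Q)"
  "Hom_zero (balanced_reps m r w) = Hom_zero (rep_quiver Q)"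
  unfolding balanced_reps_def full_subcategory_simps by simp_all

lemma F_space_subset:
  assumes "left_module P M" "v \<in> verts Q" "x \<in> carrier (space (fobj F M) v)"
  shows "x \<in> carrier M"
  using assms e_act_closed[OF assms(1)] by auto

lemma F_arr_apply:
  assumes "v \<in> verts Q" "x \<in> carrier (space (fobj F M) v)"
  shows "farr F M N f v x = f x"
  using assms by (simp only: F_simps restrict_apply if_True)

lemma F_functor:
  "is_functor (rep_algebra P :: ((((nat \<times> 'a) list \<Rightarrow> 'k) set, 'v) module, 'v \<Rightarrow> 'v) preadditive_category)
    (balanced_reps m r w) F" (is "is_functor ?C ?D F")
  unfolding is_functor_def
proof (intro conjI ballI rep_algebra_category balanced_reps_category F_obj)
  fix M N f assume M: "M \<in> Obj ?C" and N: "N \<in> Obj ?C" and f: "f \<in> Hom ?C M N"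
  then show "farr F M N f \<in> Hom ?D (fobj F M) (fobj F N)"
    using F_arr[of M N f] unfolding balanced_reps_simps by simp
  fix L g assume L: "L \<in> Obj ?C" and g: "g \<in> Hom ?C N L"
  have M': "left_module P M" and f': "f \<in> lin_maps P M N" using M f by simp_all
  have f_in: "farr F M N f v x \<in> carrier (space (fobj F N) v)"
    if "v \<in> verts Q" "x \<in> carrier (space (fobj F M) v)" for v x
    using lin_mapsD(1)[OF rep_quiver_HomD(2)[OF F_arr[of M N f] that(1)] that(2)] M N f by simp
  show "farr F M L (Comp ?C M N L g f) =
      Comp ?D (fobj F M) (fobj F N) (fobj F L) (farr F N L g) (farr F M N f)"
    unfolding balanced_reps_simps rep_quiver_simps rep_algebra_simps
  proof (subst F_simps(4), intro restrict_ext)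
    fix v assume "v \<in> verts Q"
    then show "restrict (compose (carrier M) g f) (carrier (space (fobj F M) v)) =
        compose (carrier (space (fobj F M) v)) (farr F N L g v) (farr F M N f v)"
      unfolding compose_def by (intro restrict_ext)
        (use f_in F_space_subset[OF M'] in \<open>simp add: F_arr_apply del: F_simps(4) quiver_simps\<close>)
  qed
next
  fix M assume M: "M \<in> Obj ?C"
  then show "farr F M M (Idt ?C M) = Idt ?D (fobj F M)"
    unfolding balanced_reps_simps rep_quiver_simps
    by (subst F_simps(4), intro restrict_ext)
      (use F_space_subset[of M] in \<open>auto simp del: F_simps(4) quiver_simps intro!: restrict_ext\<close>)
qed

lemma F_additive:
  "additive_functor (rep_algebra P :: ((((nat \<times> 'a) list \<Rightarrow> 'k) set, 'v) module, 'v \<Rightarrow> 'v) preadditive_category)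
    (balanced_reps m r w) F" (is "additive_functor ?C ?D F")
  unfolding additive_functor_def
proof (intro ballI)
  fix M N f g assume M: "M \<in> Obj ?C" and N: "N \<in> Obj ?C"
  have M': "left_module P M" using M by simp
  have add: "x \<oplus>\<^bsub>space (fobj F N) v\<^esub> y = x \<oplus>\<^bsub>N\<^esub> y" for x y v by (cases v) simp_all
  show "farr F M N (Hom_add ?C M N f g) = Hom_add ?D (fobj F M) (fobj F N) (farr F M N f) (farr F M N g)"
    unfolding balanced_reps_simps rep_quiver_simps
    by (subst F_simps(4), intro restrict_ext)
      (use F_space_subset[OF M'] in \<open>simp add: F_arr_apply add del: F_simps(4) quiver_simps\<close>)
qed

text \<open>The arrow \<open>(i, j, 0)\<close> is the inclusion of \<open>e i j 0 0 M\<close>, so the compatibility of \<open>g\<close> with it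
  shows that \<open>g (Source i j)\<close> is a restriction of \<open>f = g Sink\<close>. Compatibility with the other arrows
  then says that \<open>f\<close> commutes with every \<open>e i j k 0\<close> on \<open>e i j 0 0 M\<close>; by the decomposition of \<open>M\<close> it
  commutes with the \<open>e i j 0 k\<close>, and so with all matrix units, which generate \<open>P\<close>.\<close>

lemma F_full:
  assumes M: "left_module P M" and N: "left_module P N"
    and g: "g \<in> Hom (rep_quiver Q) (fobj F M) (fobj F N)"
  shows "g Sink \<in> lin_maps P M N" "farr F M N (g Sink) = g"
proof -
  interpret M: abelian_group M by (rule left_module_abelian_group[OF M])
  interpret N: abelian_group N by (rule left_module_abelian_group[OF N])
  define f where "f = g Sink"
  note gD = rep_quiver_HomD[OF g]
  have f: "f \<in> lin_maps class_ring (underlying_space P M) (underlying_space P N)"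
    using gD(2)[of Sink] by (simp add: f_def)
  note fD = lin_mapsD[OF f, simplified]
  have src: "g (Source i j) x = f x" "f x \<in> carrier N" "e i j 0 0 \<odot>\<^bsub>N\<^esub> f x = f x"
      "k < w i j \<Longrightarrow> f (e i j k 0 \<odot>\<^bsub>M\<^esub> x) = e i j k 0 \<odot>\<^bsub>N\<^esub> f x"
    if ij: "i < m" "j < r i" and x: "x \<in> carrier M" "e i j 0 0 \<odot>\<^bsub>M\<^esub> x = x" for i j x k
  proof -
    have xc: "x \<in> (\<lambda>x. e i j 0 0 \<odot>\<^bsub>M\<^esub> x) ` carrier M" using corner_iff[OF M ij] x by simp
    have gl: "g (Source i j) \<in> lin_maps class_ring (space (fobj F M) (Source i j)) (space (fobj F N) (Source i j))"
      using gD(2)[of "Source i j"] ij by simp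
    have "g (Source i j) x \<in> (\<lambda>x. e i j 0 0 \<odot>\<^bsub>N\<^esub> x) ` carrier N"
      using lin_mapsD(1)[OF gl, of x] xc by simp
    then have gx: "g (Source i j) x \<in> (\<lambda>x. e i j 0 0 \<odot>\<^bsub>N\<^esub> x) ` carrier N" "g (Source i j) x \<in> carrier N"
        "e i j 0 0 \<odot>\<^bsub>N\<^esub> g (Source i j) x = g (Source i j) x"
      using corner_iff[OF N ij] by simp_all
    have k: "f (e i j k 0 \<odot>\<^bsub>M\<^esub> x) = e i j k 0 \<odot>\<^bsub>N\<^esub> g (Source i j) x" if "k < w i j" for k
      using gD(3)[of "(i, j, k)" x] ij that xc gx(1) by (simp add: f_def)
    show 1: "g (Source i j) x = f x" using k[OF w_pos[OF ij]] x gx by simp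
    show "f x \<in> carrier N" "e i j 0 0 \<odot>\<^bsub>N\<^esub> f x = f x" using gx unfolding 1 by simp_all
    show "k < w i j \<Longrightarrow> f (e i j k 0 \<odot>\<^bsub>M\<^esub> x) = e i j k 0 \<odot>\<^bsub>N\<^esub> f x" using k unfolding 1 by simp
  qed
  have proj: "f (e i j 0 q \<odot>\<^bsub>M\<^esub> x) = e i j 0 q \<odot>\<^bsub>N\<^esub> f x"
    if ij: "i < m" "j < r i" "q < w i j" and x: "x \<in> carrier M" for i j q x
  proof -
    have y: "e i j' 0 k \<odot>\<^bsub>M\<^esub> x \<in> carrier M" "e i j' 0 0 \<odot>\<^bsub>M\<^esub> (e i j' 0 k \<odot>\<^bsub>M\<^esub> x) = e i j' 0 k \<odot>\<^bsub>M\<^esub> x"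
      if "j' < r i" "k < w i j'" for j' k
      using that ij x by (simp_all add: e_act_closed[OF M] e_act_e[OF M] w_pos)
    note s = src[OF ij(1) _ y]
    have "f x = f (finsum M (\<lambda>(j, k). e i j k 0 \<odot>\<^bsub>M\<^esub> (e i j 0 k \<odot>\<^bsub>M\<^esub> x)) (indices i))"
      by (simp only: corner_decomposition[OF M ij(1) x, symmetric])
    also have "\<dots> = f (finsum (underlying_space P M) (\<lambda>(j, k). e i j k 0 \<odot>\<^bsub>M\<^esub> (e i j 0 k \<odot>\<^bsub>M\<^esub> x)) (indices i))"
      by (subst finsum_underlying_space[OF P_algebra M]) (auto simp: e_act_closed[OF M] ij x)
    also have "\<dots> = finsum (underlying_space P N) (\<lambda>t. f ((\<lambda>(j, k). e i j k 0 \<odot>\<^bsub>M\<^esub> (e i j 0 k \<odot>\<^bsub>M\<^esub> x)) t)) (indices i)"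
      by (rule lin_maps_finsum[OF left_module_abelian_group[OF underlying_space_left_module[OF P_algebra M]]
        left_module_abelian_group[OF underlying_space_left_module[OF P_algebra N]] f])
        (auto simp: e_act_closed[OF M] ij x)
    also have "\<dots> = finsum N (\<lambda>t. f ((\<lambda>(j, k). e i j k 0 \<odot>\<^bsub>M\<^esub> (e i j 0 k \<odot>\<^bsub>M\<^esub> x)) t)) (indices i)"
      by (rule finsum_underlying_space[OF P_algebra N]) (auto intro!: fD(1) simp: e_act_closed[OF M] ij x)
    also have "\<dots> = finsum N (\<lambda>(j, k). e i j k 0 \<odot>\<^bsub>N\<^esub> f (e i j 0 k \<odot>\<^bsub>M\<^esub> x)) (indices i)"
      by (rule N.finsum_cong') (auto simp: s e_act_closed[OF N] ij)
    finally have fx: "f x = finsum N (\<lambda>(j, k). e i j k 0 \<odot>\<^bsub>N\<^esub> f (e i j 0 k \<odot>\<^bsub>M\<^esub> x)) (indices i)" .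
    have "e i j 0 q \<odot>\<^bsub>N\<^esub> f x =
        finsum N (\<lambda>t. e i j 0 q \<odot>\<^bsub>N\<^esub> (\<lambda>(j, k). e i j k 0 \<odot>\<^bsub>N\<^esub> f (e i j 0 k \<odot>\<^bsub>M\<^esub> x)) t) (indices i)"
      by (subst fx, rule left_module_act_finsum[OF N]) (auto simp: s e_act_closed[OF N] e_in ij)
    \<comment> \<open>the product of \<open>e i j 0 q\<close> with \<open>e i j' k 0\<close> vanishes unless \<open>(j', k) = (j, q)\<close>\<close>
    also have "\<dots> = e i j 0 q \<odot>\<^bsub>N\<^esub> (\<lambda>(j, k). e i j k 0 \<odot>\<^bsub>N\<^esub> f (e i j 0 k \<odot>\<^bsub>M\<^esub> x)) (j, q)"
      by (rule finsum_single[OF N.abelian_group_axioms])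
        (use ij in \<open>auto simp: s e_act_closed[OF N] e_act_e[OF N] split: if_splits\<close>)
    also have "\<dots> = f (e i j 0 q \<odot>\<^bsub>M\<^esub> x)" using ij by (simp add: s e_act_e[OF N])
    finally show ?thesis by simp
  qed
  have T_unit: "f (e i j p q \<odot>\<^bsub>M\<^esub> x) = e i j p q \<odot>\<^bsub>N\<^esub> f x"
    if ij: "i < m" "j < r i" "p < w i j" "q < w i j" and x: "x \<in> carrier M" for i j p q x
  proof -
    have y: "e i j 0 q \<odot>\<^bsub>M\<^esub> x \<in> carrier M" "e i j 0 0 \<odot>\<^bsub>M\<^esub> (e i j 0 q \<odot>\<^bsub>M\<^esub> x) = e i j 0 q \<odot>\<^bsub>M\<^esub> x"
      using ij x by (simp_all add: e_act_closed[OF M] e_act_e[OF M] w_pos)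
    have "f (e i j p q \<odot>\<^bsub>M\<^esub> x) = f (e i j p 0 \<odot>\<^bsub>M\<^esub> (e i j 0 q \<odot>\<^bsub>M\<^esub> x))"
      using ij x by (simp add: e_act_e[OF M] w_pos)
    also have "\<dots> = e i j p 0 \<odot>\<^bsub>N\<^esub> (e i j 0 q \<odot>\<^bsub>N\<^esub> f x)"
      using src(4)[OF ij(1,2) y ij(3)] proj[OF ij(1,2,4) x] by simp
    also have "\<dots> = e i j p q \<odot>\<^bsub>N\<^esub> f x"
      using ij fD(1)[OF x] by (simp add: e_act_e[OF N] w_pos)
    finally show ?thesis .
  qed
  have lin: "\<forall>x\<in>carrier M. f (a \<odot>\<^bsub>M\<^esub> x) = a \<odot>\<^bsub>N\<^esub> f x" if "a \<in> carrier P" for a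
    using that
  proof (induction a rule: P_induct)
    case (unit i j p q)
    then show ?case using T_unit by blast
  next
    case one
    then show ?case by (simp add: left_module.act_one[OF M] left_module.act_one[OF N] fD(1))
  next
    case (scale c a)
    have "(c \<odot>\<^bsub>P\<^esub> a) \<odot>\<^bsub>M\<^esub> x = (c \<odot>\<^bsub>P\<^esub> \<one>\<^bsub>P\<^esub>) \<odot>\<^bsub>M\<^esub> (a \<odot>\<^bsub>M\<^esub> x)" if "x \<in> carrier M" for x
      using left_module.act_mult[OF M scalar_in_algebra[OF P_algebra] scale(1) that] scalar_eq(1)[OF scale(1)] by simp
    moreover have "(c \<odot>\<^bsub>P\<^esub> a) \<odot>\<^bsub>N\<^esub> x = (c \<odot>\<^bsub>P\<^esub> \<one>\<^bsub>P\<^esub>) \<odot>\<^bsub>N\<^esub> (a \<odot>\<^bsub>N\<^esub> x)" if "x \<in> carrier N" for x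
      using left_module.act_mult[OF N scalar_in_algebra[OF P_algebra] scale(1) that] scalar_eq(1)[OF scale(1)] by simp
    ultimately show ?case
      using scale(2) left_module_closed(3)[OF M scale(1)] by (simp add: fD(1,3))
  next
    case (add a b)
    then show ?case
      by (simp add: left_module.act_add_left[OF M] left_module.act_add_left[OF N] fD(1,2) left_module_closed(3)[OF M])
  next
    case (mult a b)
    then show ?case
      by (simp add: left_module.act_mult[OF M] left_module.act_mult[OF N] fD(1) left_module_closed(3)[OF M])
  qed
  show fP: "g Sink \<in> lin_maps P M N"
    unfolding f_def[symmetric] by (rule lin_mapsI) (use fD lin in auto)
  show "farr F M N (g Sink) = g"
    unfolding f_def[symmetric] F_simps(4)
  proof (rule restrict_eq_of_extensional[OF gD(1)])
    fix v assume v: "v \<in> verts Q"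
    show "restrict f (carrier (space (fobj F M) v)) = g v"
    proof (rule restrict_eq_of_extensional[OF lin_mapsD(4)[OF gD(2)[OF v]]])
      fix x assume x: "x \<in> carrier (space (fobj F M) v)"
      show "f x = g v x"
      proof (cases v)
        case Sink
        then show ?thesis by (simp add: f_def)
      next
        case (Source i j)
        with v have ij: "i < m" "j < r i" by auto
        then show ?thesis using x corner_iff[OF M ij, of x] src(1)[OF ij, of x] Source by simp
      qed
    qed
  qed
qed

lemma F_fully_faithful:
  "fully_faithful (rep_algebra P :: ((((nat \<times> 'a) list \<Rightarrow> 'k) set, 'v) module, 'v \<Rightarrow> 'v) preadditive_category)
    (balanced_reps m r w) F" (is "fully_faithful ?C ?D F")
  unfolding fully_faithful_def
proof (intro ballI)
  fix M N assume MN: "M \<in> Obj ?C" "N \<in> Obj ?C"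
  then have M: "left_module P M" and N: "left_module P N" by simp_all
  show "bij_betw (farr F M N) (Hom ?C M N) (Hom ?D (fobj F M) (fobj F N))"
    unfolding balanced_reps_simps
  proof (rule bij_betwI[where g = "\<lambda>g. g Sink"])
    show "farr F M N \<in> Hom ?C M N \<rightarrow> Hom (rep_quiver Q) (fobj F M) (fobj F N)"
      using F_arr[OF M N] by (simp only: rep_algebra_simps Pi_I)
    show "(\<lambda>g. g Sink) \<in> Hom (rep_quiver Q) (fobj F M) (fobj F N) \<rightarrow> Hom ?C M N"
      using F_full(1)[OF M N] by (simp only: rep_algebra_simps Pi_I)
    show "farr F M N f Sink = f" if "f \<in> Hom ?C M N" for f
    proof -
      have "f \<in> extensional (carrier M)" using lin_mapsD(4) that by auto
      then show ?thesis by (simp add: extensional_restrict)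
    qed
    show "farr F M N (g Sink) = g" if "g \<in> Hom (rep_quiver Q) (fobj F M) (fobj F N)" for g
      by (rule F_full(2)[OF M N that])
  qed
qed

end

section \<open>Essential surjectivity\<close>

definition end_algebra :: "('k::field, 'v) module \<Rightarrow> ('k, 'v \<Rightarrow> 'v) module" where
  "end_algebra V = \<lparr>carrier = lin_maps class_ring V V, mult = compose (carrier V),
    one = (\<lambda>x\<in>carrier V. x), zero = (\<lambda>x\<in>carrier V. \<zero>\<^bsub>V\<^esub>),
    add = (\<lambda>f g. \<lambda>x\<in>carrier V. f x \<oplus>\<^bsub>V\<^esub> g x), smult = (\<lambda>c f. \<lambda>x\<in>carrier V. c \<odot>\<^bsub>V\<^esub> f x)\<rparr>"

lemma end_algebra_simps [simp]:
  "carrier (end_algebra V) = lin_maps class_ring V V" "f \<otimes>\<^bsub>end_algebra V\<^esub> g = compose (carrier V) f g"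
  "\<one>\<^bsub>end_algebra V\<^esub> = (\<lambda>x\<in>carrier V. x)" "\<zero>\<^bsub>end_algebra V\<^esub> = (\<lambda>x\<in>carrier V. \<zero>\<^bsub>V\<^esub>)"
  "f \<oplus>\<^bsub>end_algebra V\<^esub> g = (\<lambda>x\<in>carrier V. f x \<oplus>\<^bsub>V\<^esub> g x)"
  "c \<odot>\<^bsub>end_algebra V\<^esub> f = (\<lambda>x\<in>carrier V. c \<odot>\<^bsub>V\<^esub> f x)"
  by (simp_all add: end_algebra_def)

lemma lin_maps_scale:
  fixes V :: "('k::field, 'v) module"
  assumes V: "left_module class_ring V" and f: "f \<in> lin_maps class_ring V V"
  shows "(\<lambda>x\<in>carrier V. c \<odot>\<^bsub>V\<^esub> f x) \<in> lin_maps class_ring V V"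
proof -
  interpret V: vectorspace class_ring V by (rule left_module_class_ring_vectorspace[OF V])
  note C = left_module_closed[OF V] and fD = lin_mapsD[OF f]
  have "c \<odot>\<^bsub>V\<^esub> (d \<odot>\<^bsub>V\<^esub> x) = d \<odot>\<^bsub>V\<^esub> (c \<odot>\<^bsub>V\<^esub> x)" if "x \<in> carrier V" for d x
    using V.smult_assoc1[of c d x] V.smult_assoc1[of d c x] that by (simp add: mult.commute)
  then show ?thesis
    using left_module.act_add_right[OF V] by (intro lin_mapsI) (simp_all add: C fD(1,2,3))
qed

lemma end_algebra_assoc_algebra:
  fixes V :: "('k::field, 'v) module"
  assumes V: "left_module class_ring V"
  shows "assoc_algebra class_ring (end_algebra V)"
proof -
  let ?E = "end_algebra V"
  interpret V: abelian_group V by (rule left_module_abelian_group[OF V])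
  note C = left_module_closed[OF V]
  have L: "f x \<in> carrier V" "f \<in> extensional (carrier V)" if "f \<in> lin_maps class_ring V V" "x \<in> carrier V" for f x
    using lin_mapsD[OF that(1)] that(2) by auto
  have ab: "abelian_group ?E"
  proof (rule abelian_groupI)
    fix f assume "f \<in> carrier ?E"
    then have f: "f \<in> lin_maps class_ring V V" by simp
    have "(\<lambda>x\<in>carrier V. \<ominus>\<^bsub>V\<^esub> f x) \<oplus>\<^bsub>?E\<^esub> f = \<zero>\<^bsub>?E\<^esub>"
      unfolding end_algebra_simps by (rule restrict_ext) (simp add: lin_mapsD(1)[OF f] V.l_neg)
    then show "\<exists>g\<in>carrier ?E. g \<oplus>\<^bsub>?E\<^esub> f = \<zero>\<^bsub>?E\<^esub>"
      using lin_maps_uminus[OF V V f] unfolding end_algebra_simps(1) by (rule bexI)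
    show "\<zero>\<^bsub>?E\<^esub> \<oplus>\<^bsub>?E\<^esub> f = f"
      using lin_mapsD(1,4)[OF f] by (intro extensionalityI[of _ "carrier V" f]) simp_all
  qed (auto simp: lin_maps_add[OF V V] lin_maps_const_zero[OF V V] L V.a_ac intro!: restrict_ext)
  have mon: "Group.monoid ?E"
    by (rule Group.monoidI)
      (simp_all add: lin_maps_compose[OF V] lin_maps_id[OF V] compose_lin_maps_id[of _ class_ring] compose_lin_maps_assoc[of _ class_ring V V])
  have ring: "ring ?E"
    by (rule ringI[OF ab mon]) (auto simp: compose_def L lin_mapsD(2) intro!: restrict_ext)
  have rules: "(a + b) \<odot>\<^bsub>V\<^esub> x = a \<odot>\<^bsub>V\<^esub> x \<oplus>\<^bsub>V\<^esub> b \<odot>\<^bsub>V\<^esub> x"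
    "a \<odot>\<^bsub>V\<^esub> (x \<oplus>\<^bsub>V\<^esub> y) = a \<odot>\<^bsub>V\<^esub> x \<oplus>\<^bsub>V\<^esub> a \<odot>\<^bsub>V\<^esub> y"
    "(a * b) \<odot>\<^bsub>V\<^esub> x = a \<odot>\<^bsub>V\<^esub> (b \<odot>\<^bsub>V\<^esub> x)" "1 \<odot>\<^bsub>V\<^esub> x = x"
    if "x \<in> carrier V" "y \<in> carrier V" for a b x y
    using left_module.act_add_left[OF V _ _ that(1), of a b] left_module.act_add_right[OF V _ that, of a]
      left_module.act_mult[OF V _ _ that(1), of a b] left_module.act_one[OF V that(1)] by simp_all
  have "Module.module class_ring ?E"
  proof (rule moduleI[OF class_cring.cring_axioms ab])
    show "c \<odot>\<^bsub>?E\<^esub> f \<in> carrier ?E" if "f \<in> carrier ?E" for c f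
      using lin_maps_scale[OF V] that by simp
    show "\<one>\<^bsub>class_ring\<^esub> \<odot>\<^bsub>?E\<^esub> f = f" if "f \<in> carrier ?E" for f
    proof -
      have f: "f \<in> lin_maps class_ring V V" using that by simp
      show ?thesis
        unfolding end_algebra_simps
        by (rule restrict_eq_of_extensional[OF lin_mapsD(4)[OF f]]) (simp add: rules(4) lin_mapsD(1)[OF f])
    qed
  qed (simp_all add: L rules cong: restrict_cong)
  then show ?thesis
    by (intro assoc_algebra.intro assoc_algebra_axioms.intro ring)
      (auto simp: compose_def L lin_mapsD(3) C intro!: restrict_ext)
qed

lemma end_algebra_conjugate:
  fixes V :: "('k::field, 'v) module" and W :: "('k, 'w) module"
  assumes V: "left_module class_ring V" and f: "f \<in> lin_maps class_ring V W"
    and bij: "bij_betw f (carrier V) (carrier W)" and W: "left_module class_ring W"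
  shows "(\<lambda>u. \<lambda>x\<in>carrier W. f (u (inv_into (carrier V) f x))) \<in> alg_hom class_ring (end_algebra V) (end_algebra W)"
    (is "?c \<in> _")
proof -
  let ?g = "restrict (inv_into (carrier V) f) (carrier W)"
  note g = lin_maps_inverse[OF V f bij]
  have gc: "inv_into (carrier V) f x \<in> carrier V" "f (inv_into (carrier V) f x) = x" if "x \<in> carrier W" for x
    using lin_mapsD(1)[OF g that] bij that by (simp_all add: bij_betw_def f_inv_into_f)
  have gf: "inv_into (carrier V) f (f x) = x" if "x \<in> carrier V" for x
    using bij that by (simp add: bij_betw_def inv_into_f_f)
  have c: "?c u = compose (carrier W) f (compose (carrier W) u ?g)" for u
    by (auto simp: compose_def intro!: restrict_ext)
  note fD = lin_mapsD[OF f]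
  show ?thesis
  proof (rule alg_homI)
    fix u assume "u \<in> carrier (end_algebra V)"
    then have u: "u \<in> lin_maps class_ring V V" by simp
    show "?c u \<in> carrier (end_algebra W)"
      unfolding c end_algebra_simps by (rule lin_maps_compose[OF W lin_maps_compose[OF W g u] f])
    show "?c (a \<odot>\<^bsub>end_algebra V\<^esub> u) = a \<odot>\<^bsub>end_algebra W\<^esub> ?c u" if "a \<in> carrier class_ring" for a
      using fD(3)[OF that] lin_mapsD(1)[OF u] by (auto simp: gc intro!: restrict_ext)
    fix v assume "v \<in> carrier (end_algebra V)"
    then have v: "v \<in> lin_maps class_ring V V" by simp
    show "?c (u \<oplus>\<^bsub>end_algebra V\<^esub> v) = ?c u \<oplus>\<^bsub>end_algebra W\<^esub> ?c v"
      using lin_mapsD(1)[OF u] lin_mapsD(1)[OF v] by (auto simp: gc fD(2) intro!: restrict_ext)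
    show "?c (u \<otimes>\<^bsub>end_algebra V\<^esub> v) = ?c u \<otimes>\<^bsub>end_algebra W\<^esub> ?c v"
      using lin_mapsD(1)[OF u] lin_mapsD(1)[OF v] by (auto simp: gc gf fD(1) compose_def intro!: restrict_ext)
  qed (auto simp: gc intro!: restrict_ext)
qed

text \<open>For each \<open>j\<close>, the matrix \<open>b j\<close> is applied to a column whose entries are vectors of \<open>V j\<close>.\<close>

definition mat_act :: "nat \<Rightarrow> (nat \<Rightarrow> nat) \<Rightarrow> (nat \<Rightarrow> ('k::field, 'v) module) \<Rightarrow> (nat \<Rightarrow> 'k mat) \<Rightarrow>
    (nat \<times> nat \<Rightarrow> 'v) \<Rightarrow> nat \<times> nat \<Rightarrow> 'v" where
  "mat_act s d V b = (\<lambda>y\<in>carrier (dprod (SIGMA j:{..<s}. {..<d j}) (\<lambda>(j, k). V j)).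
    \<lambda>(j, p)\<in>(SIGMA j:{..<s}. {..<d j}). finsum (V j) (\<lambda>q. b j $$ (p, q) \<odot>\<^bsub>V j\<^esub> y (j, q)) {..<d j})"

text \<open>Compatibility with products is the associativity of matrix times matrix times vector, that is, the
  exchange of two sums.\<close>

lemma mat_act_hom:
  fixes V :: "nat \<Rightarrow> ('k::field, 'v) module"
  assumes V: "\<And>j. j < s \<Longrightarrow> left_module class_ring (V j)"
  shows "mat_act s d V \<in> alg_hom class_ring (mat_algebras s d)
    (end_algebra (dprod (SIGMA j:{..<s}. {..<d j}) (\<lambda>(j, k). V j)))"
proof -
  let ?I = "SIGMA j:{..<s}. {..<d j}" and ?A = "mat_algebras s d :: ('k, nat \<Rightarrow> 'k mat) module"
  let ?D = "dprod ?I (\<lambda>(j, k). V j)"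
  have D: "left_module class_ring ?D"
    by (rule dprod_left_module[OF class_ring.ring_axioms]) (auto simp: V)
  note CD = left_module_closed[OF D]
  have ab: "abelian_group (V j)" if "j < s" for j using V[OF that] by (rule left_module_abelian_group)
  have fc: "finsum (V j) f {..<d j} \<in> carrier (V j)" if "j < s" "\<And>q. q < d j \<Longrightarrow> f q \<in> carrier (V j)" for j f
  proof -
    interpret abelian_group "V j" by (rule ab) fact
    show ?thesis using that(2) by (intro finsum_closed) auto
  qed
  have y: "y (j, q) \<in> carrier (V j)" if "y \<in> carrier ?D" "j < s" "q < d j" for y j q
    using that by (auto simp: PiE_iff)
  have sc: "c \<odot>\<^bsub>V j\<^esub> x \<in> carrier (V j)" if "j < s" "x \<in> carrier (V j)" for c j x
    using left_module_closed(3)[OF V[OF that(1)] _ that(2)] by simp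
  have act: "mat_act s d V b y = (\<lambda>(j, p)\<in>?I. finsum (V j) (\<lambda>q. b j $$ (p, q) \<odot>\<^bsub>V j\<^esub> y (j, q)) {..<d j})"
    if "y \<in> carrier ?D" for b y using that by (simp only: mat_act_def restrict_apply if_True)
  have act_c: "mat_act s d V b y \<in> carrier ?D" if yD: "y \<in> carrier ?D" for b y
    unfolding act[OF yD] by (auto simp: fc sc y[OF yD])
  have act_at: "mat_act s d V b y (j, p) = finsum (V j) (\<lambda>q. b j $$ (p, q) \<odot>\<^bsub>V j\<^esub> y (j, q)) {..<d j}"
    if "y \<in> carrier ?D" "j < s" "p < d j" for b y j p using that by (simp add: act)
  have eqI: "u = v" if "u \<in> carrier ?D" "v \<in> carrier ?D" "\<And>j p. j < s \<Longrightarrow> p < d j \<Longrightarrow> u (j, p) = v (j, p)" for u v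
    using that(1,2) unfolding dprod_simps by (rule PiE_ext) (use that(3) in auto)
  have cong: "finsum (V j) f {..<d j} = finsum (V j) g {..<d j}"
    if "j < s" "\<And>q. q < d j \<Longrightarrow> f q = g q" "\<And>q. q < d j \<Longrightarrow> g q \<in> carrier (V j)" for j f g
  proof -
    interpret abelian_group "V j" by (rule ab) fact
    show ?thesis using that by (intro finsum_cong') auto
  qed
  have addf: "finsum (V j) (\<lambda>q. f q \<oplus>\<^bsub>V j\<^esub> g q) {..<d j} = finsum (V j) f {..<d j} \<oplus>\<^bsub>V j\<^esub> finsum (V j) g {..<d j}"
    if "j < s" "\<And>q. q < d j \<Longrightarrow> f q \<in> carrier (V j)" "\<And>q. q < d j \<Longrightarrow> g q \<in> carrier (V j)" for j f g
  proof -
    interpret abelian_group "V j" by (rule ab) fact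
    show ?thesis using that by (intro finsum_addf) auto
  qed
  have scf: "c \<odot>\<^bsub>V j\<^esub> finsum (V j) f {..<d j} = finsum (V j) (\<lambda>q. c \<odot>\<^bsub>V j\<^esub> f q) {..<d j}"
    if "j < s" "\<And>q. q < d j \<Longrightarrow> f q \<in> carrier (V j)" for j c f
    using left_module_act_finsum[OF V[OF that(1)], of "{..<d j}" f c] that(2) by simp
  have scl: "(\<Sum>k<n. c k) \<odot>\<^bsub>V j\<^esub> x = finsum (V j) (\<lambda>k. c k \<odot>\<^bsub>V j\<^esub> x) {..<n}"
    if "j < s" "x \<in> carrier (V j)" for j x c and n :: nat
    using left_module_finsum_act[OF V[OF that(1)], of "{..<n}" c x] that(2) by (simp add: class_ring_simps)
  have rules: "(a + b) \<odot>\<^bsub>V j\<^esub> x = a \<odot>\<^bsub>V j\<^esub> x \<oplus>\<^bsub>V j\<^esub> b \<odot>\<^bsub>V j\<^esub> x"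
    "z \<in> carrier (V j) \<Longrightarrow> a \<odot>\<^bsub>V j\<^esub> (x \<oplus>\<^bsub>V j\<^esub> z) = a \<odot>\<^bsub>V j\<^esub> x \<oplus>\<^bsub>V j\<^esub> a \<odot>\<^bsub>V j\<^esub> z"
    "a \<odot>\<^bsub>V j\<^esub> (b \<odot>\<^bsub>V j\<^esub> x) = (a * b) \<odot>\<^bsub>V j\<^esub> x" "1 \<odot>\<^bsub>V j\<^esub> x = x" "0 \<odot>\<^bsub>V j\<^esub> x = \<zero>\<^bsub>V j\<^esub>"
    if "j < s" "x \<in> carrier (V j)" for a b j x z
    using left_module.act_add_left[OF V[OF that(1)] _ _ that(2), of a b]
      left_module.act_add_right[OF V[OF that(1)] _ that(2), of a z]
      left_module.act_mult[OF V[OF that(1)] _ _ that(2), of a b] left_module.act_one[OF V[OF that(1)] that(2)]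
      left_module_zero_act[OF V[OF that(1)] that(2)] by simp_all
  have lin: "mat_act s d V b \<in> lin_maps class_ring ?D ?D" for b
  proof (rule lin_mapsI)
    show "mat_act s d V b \<in> extensional (carrier ?D)" unfolding mat_act_def by (rule restrict_extensional)
    fix u assume u: "u \<in> carrier ?D"
    show "mat_act s d V b u \<in> carrier ?D" by (rule act_c[OF u])
    show "mat_act s d V b (c \<odot>\<^bsub>?D\<^esub> u) = c \<odot>\<^bsub>?D\<^esub> mat_act s d V b u" if c: "c \<in> carrier class_ring" for c
    proof (rule eqI)
      fix j p assume j: "j < s" "p < d j"
      have "finsum (V j) (\<lambda>q. b j $$ (p, q) \<odot>\<^bsub>V j\<^esub> (c \<odot>\<^bsub>?D\<^esub> u) (j, q)) {..<d j} =
          finsum (V j) (\<lambda>q. c \<odot>\<^bsub>V j\<^esub> (b j $$ (p, q) \<odot>\<^bsub>V j\<^esub> u (j, q))) {..<d j}"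
        by (rule cong) (use j y[OF u] in \<open>auto simp: rules(3) sc mult.commute\<close>)
      then show "mat_act s d V b (c \<odot>\<^bsub>?D\<^esub> u) (j, p) = (c \<odot>\<^bsub>?D\<^esub> mat_act s d V b u) (j, p)"
        using j y[OF u] act_at[OF CD(3)[OF c u] j] act_at[OF u j] by (simp add: scf sc)
    qed (use act_c[OF u] act_c[OF CD(3)[OF c u]] CD(3)[OF c] in blast)+
    fix v assume v: "v \<in> carrier ?D"
    show "mat_act s d V b (u \<oplus>\<^bsub>?D\<^esub> v) = mat_act s d V b u \<oplus>\<^bsub>?D\<^esub> mat_act s d V b v"
    proof (rule eqI)
      fix j p assume j: "j < s" "p < d j"
      have "finsum (V j) (\<lambda>q. b j $$ (p, q) \<odot>\<^bsub>V j\<^esub> (u \<oplus>\<^bsub>?D\<^esub> v) (j, q)) {..<d j} =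
          finsum (V j) (\<lambda>q. b j $$ (p, q) \<odot>\<^bsub>V j\<^esub> u (j, q) \<oplus>\<^bsub>V j\<^esub> b j $$ (p, q) \<odot>\<^bsub>V j\<^esub> v (j, q)) {..<d j}"
        by (rule cong) (use j y[OF u] y[OF v] in \<open>auto simp: rules(2) sc left_module_closed[OF V]\<close>)
      then show "mat_act s d V b (u \<oplus>\<^bsub>?D\<^esub> v) (j, p) = (mat_act s d V b u \<oplus>\<^bsub>?D\<^esub> mat_act s d V b v) (j, p)"
        using j y[OF u] y[OF v] act_at[OF CD(1)[OF u v] j] act_at[OF u j] act_at[OF v j] by (simp add: addf sc)
    qed (use act_c[OF u] act_c[OF v] act_c[OF CD(1)[OF u v]] CD(1) in blast)+
  qed
  have hom_eqI: "f = g" if "f \<in> lin_maps class_ring ?D ?D" "g \<in> lin_maps class_ring ?D ?D"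
    "\<And>u j p. u \<in> carrier ?D \<Longrightarrow> j < s \<Longrightarrow> p < d j \<Longrightarrow> f u (j, p) = g u (j, p)" for f g
  proof (rule lin_maps_eqI[OF that(1,2)])
    fix u assume u: "u \<in> carrier ?D"
    show "f u = g u"
      by (rule eqI[OF lin_mapsD(1)[OF that(1) u] lin_mapsD(1)[OF that(2) u] that(3)[OF u]])
  qed
  note E = end_algebra_assoc_algebra[OF D]
  interpret E: assoc_algebra class_ring "end_algebra ?D" by (rule E)
  have Ec: "f \<oplus>\<^bsub>end_algebra ?D\<^esub> g \<in> lin_maps class_ring ?D ?D" "f \<otimes>\<^bsub>end_algebra ?D\<^esub> g \<in> lin_maps class_ring ?D ?D"
     "c \<odot>\<^bsub>end_algebra ?D\<^esub> f \<in> lin_maps class_ring ?D ?D"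
    if "f \<in> lin_maps class_ring ?D ?D" "g \<in> lin_maps class_ring ?D ?D" for f g c
    using E.a_closed[of f g] E.m_closed[of f g] E.smult_closed[of c f] that unfolding end_algebra_simps(1) by simp_all
  show ?thesis
  proof (rule alg_homI)
    fix a assume a: "a \<in> carrier ?A"
    show "mat_act s d V a \<in> carrier (end_algebra ?D)" using lin by (simp only: end_algebra_simps)
    show "mat_act s d V (c \<odot>\<^bsub>?A\<^esub> a) = c \<odot>\<^bsub>end_algebra ?D\<^esub> mat_act s d V a" if "c \<in> carrier class_ring" for c
    proof (rule hom_eqI[OF lin Ec(3)[OF lin lin]])
      fix u j p assume u: "u \<in> carrier ?D" and j: "j < s" "p < d j"
      have aj: "a j \<in> carrier_mat (d j) (d j)" using a j by (simp add: mat_algebras_simps)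
      have "finsum (V j) (\<lambda>q. (c \<odot>\<^bsub>?A\<^esub> a) j $$ (p, q) \<odot>\<^bsub>V j\<^esub> u (j, q)) {..<d j} =
          finsum (V j) (\<lambda>q. c \<odot>\<^bsub>V j\<^esub> (a j $$ (p, q) \<odot>\<^bsub>V j\<^esub> u (j, q))) {..<d j}"
        by (rule cong) (use j aj y[OF u] in \<open>auto simp: mat_algebras_simps rules(3) sc\<close>)
      then show "mat_act s d V (c \<odot>\<^bsub>?A\<^esub> a) u (j, p) = (c \<odot>\<^bsub>end_algebra ?D\<^esub> mat_act s d V a) u (j, p)"
        using j u y[OF u] act_at[OF u j] by (simp add: scf sc del: dprod_simps(1))
    qed
    fix b assume b: "b \<in> carrier ?A"
    show "mat_act s d V (a \<oplus>\<^bsub>?A\<^esub> b) = mat_act s d V a \<oplus>\<^bsub>end_algebra ?D\<^esub> mat_act s d V b"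
    proof (rule hom_eqI[OF lin Ec(1)[OF lin lin]])
      fix u j p assume u: "u \<in> carrier ?D" and j: "j < s" "p < d j"
      have aj: "a j \<in> carrier_mat (d j) (d j)" "b j \<in> carrier_mat (d j) (d j)"
        using a b j by (simp_all add: mat_algebras_simps)
      have "finsum (V j) (\<lambda>q. (a \<oplus>\<^bsub>?A\<^esub> b) j $$ (p, q) \<odot>\<^bsub>V j\<^esub> u (j, q)) {..<d j} =
          finsum (V j) (\<lambda>q. a j $$ (p, q) \<odot>\<^bsub>V j\<^esub> u (j, q) \<oplus>\<^bsub>V j\<^esub> b j $$ (p, q) \<odot>\<^bsub>V j\<^esub> u (j, q)) {..<d j}"
        by (rule cong) (use j aj y[OF u] in \<open>auto simp: mat_algebras_simps rules(1) sc left_module_closed[OF V]\<close>)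
      then show "mat_act s d V (a \<oplus>\<^bsub>?A\<^esub> b) u (j, p) = (mat_act s d V a \<oplus>\<^bsub>end_algebra ?D\<^esub> mat_act s d V b) u (j, p)"
        using j u y[OF u] act_at[OF u j] by (simp add: addf sc del: dprod_simps(1))
    qed
    show "mat_act s d V (a \<otimes>\<^bsub>?A\<^esub> b) = mat_act s d V a \<otimes>\<^bsub>end_algebra ?D\<^esub> mat_act s d V b"
    proof (rule hom_eqI[OF lin Ec(2)[OF lin lin]])
      fix u j p assume u: "u \<in> carrier ?D" and j: "j < s" "p < d j"
      interpret Vj: abelian_group "V j" by (rule ab[OF j(1)])
      note uj = y[OF u j(1)]
      have "mat_act s d V (a \<otimes>\<^bsub>?A\<^esub> b) u (j, p) =
          finsum (V j) (\<lambda>q. (\<Sum>k<d j. a j $$ (p, k) * b j $$ (k, q)) \<odot>\<^bsub>V j\<^esub> u (j, q)) {..<d j}"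
        unfolding act_at[OF u j] by (rule cong[OF j(1)]) (use j uj sc in \<open>simp_all add: mat_algebras_mult_index[OF a b]\<close>)
      also have "\<dots> = finsum (V j) (\<lambda>q. finsum (V j) (\<lambda>k. (a j $$ (p, k) * b j $$ (k, q)) \<odot>\<^bsub>V j\<^esub> u (j, q)) {..<d j}) {..<d j}"
        by (rule cong[OF j(1)]) (use j uj in \<open>simp_all add: scl fc sc\<close>)
      also have "\<dots> = finsum (V j) (\<lambda>k. finsum (V j) (\<lambda>q. (a j $$ (p, k) * b j $$ (k, q)) \<odot>\<^bsub>V j\<^esub> u (j, q)) {..<d j}) {..<d j}"
        by (rule Vj.add.finprod_finprod_swap) (use j uj in \<open>simp_all add: sc\<close>)
      also have "\<dots> = finsum (V j) (\<lambda>k. a j $$ (p, k) \<odot>\<^bsub>V j\<^esub> mat_act s d V b u (j, k)) {..<d j}"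
      proof (rule cong[OF j(1)])
        fix k assume k: "k < d j"
        have "finsum (V j) (\<lambda>q. (a j $$ (p, k) * b j $$ (k, q)) \<odot>\<^bsub>V j\<^esub> u (j, q)) {..<d j} =
            finsum (V j) (\<lambda>q. a j $$ (p, k) \<odot>\<^bsub>V j\<^esub> (b j $$ (k, q) \<odot>\<^bsub>V j\<^esub> u (j, q))) {..<d j}"
          by (rule cong[OF j(1)]) (use j uj in \<open>simp_all add: sc rules(3)\<close>)
        also have "\<dots> = a j $$ (p, k) \<odot>\<^bsub>V j\<^esub> mat_act s d V b u (j, k)"
          unfolding act_at[OF u j(1) k] by (rule scf[OF j(1), symmetric]) (use j uj in \<open>simp add: sc\<close>)
        finally show "finsum (V j) (\<lambda>q. (a j $$ (p, k) * b j $$ (k, q)) \<odot>\<^bsub>V j\<^esub> u (j, q)) {..<d j} =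
            a j $$ (p, k) \<odot>\<^bsub>V j\<^esub> mat_act s d V b u (j, k)" .
        show "a j $$ (p, k) \<odot>\<^bsub>V j\<^esub> mat_act s d V b u (j, k) \<in> carrier (V j)"
          by (rule sc[OF j(1) y[OF act_c[OF u] j(1) k]])
      qed
      also have "\<dots> = mat_act s d V a (mat_act s d V b u) (j, p)"
        by (rule act_at[OF act_c[OF u] j, symmetric])
      also have "\<dots> = (mat_act s d V a \<otimes>\<^bsub>end_algebra ?D\<^esub> mat_act s d V b) u (j, p)"
        using u by (simp only: end_algebra_simps compose_eq)
      finally show "mat_act s d V (a \<otimes>\<^bsub>?A\<^esub> b) u (j, p) = (mat_act s d V a \<otimes>\<^bsub>end_algebra ?D\<^esub> mat_act s d V b) u (j, p)" .
    qed
  next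
    show "mat_act s d V \<one>\<^bsub>?A\<^esub> = \<one>\<^bsub>end_algebra ?D\<^esub>"
    proof (rule hom_eqI[OF lin])
      show "\<one>\<^bsub>end_algebra ?D\<^esub> \<in> lin_maps class_ring ?D ?D" unfolding end_algebra_simps by (rule lin_maps_id[OF D])
      fix u j p assume u: "u \<in> carrier ?D" and j: "j < s" "p < d j"
      have "mat_act s d V \<one>\<^bsub>?A\<^esub> u (j, p) = \<one>\<^bsub>?A\<^esub> j $$ (p, p) \<odot>\<^bsub>V j\<^esub> u (j, p)"
        unfolding act_at[OF u j]
        by (rule finsum_single[OF ab[OF j(1)]]) (use j y[OF u] in \<open>auto simp: sc mat_algebras_simps rules(5)\<close>)
      then show "mat_act s d V \<one>\<^bsub>?A\<^esub> u (j, p) = \<one>\<^bsub>end_algebra ?D\<^esub> u (j, p)"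
        using j u y[OF u j] by (simp add: mat_algebras_simps rules(4) del: dprod_simps(1))
    qed
  qed
qed

lemma mat_act_unit:
  fixes V :: "nat \<Rightarrow> ('k::field, 'v) module"
  assumes V: "\<And>j. j < s \<Longrightarrow> left_module class_ring (V j)"
    and y: "y \<in> carrier (dprod (SIGMA j:{..<s}. {..<d j}) (\<lambda>(j, k). V j))"
    and j: "j < s" "p < d j" "q < d j"
  shows "mat_act s d V (mat_unit s d j p q) y =
    (\<lambda>(j', k)\<in>(SIGMA j:{..<s}. {..<d j}). if j' = j \<and> k = p then y (j, q) else \<zero>\<^bsub>V j'\<^esub>)"
proof -
  have yc: "y (j', k) \<in> carrier (V j')" if "j' < s" "k < d j'" for j' k using y that by (auto simp: PiE_iff)
  have "finsum (V j') (\<lambda>q'. mat_unit s d j p q j' $$ (p', q') \<odot>\<^bsub>V j'\<^esub> y (j', q')) {..<d j'} =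
      (if j' = j \<and> p' = p then y (j, q) else \<zero>\<^bsub>V j'\<^esub>)" if j': "j' < s" "p' < d j'" for j' p'
  proof -
    interpret Vj: abelian_group "V j'" by (rule left_module_abelian_group[OF V[OF j'(1)]])
    have "finsum (V j') (\<lambda>q'. mat_unit s d j p q j' $$ (p', q') \<odot>\<^bsub>V j'\<^esub> y (j', q')) {..<d j'} =
        finsum (V j') (\<lambda>q'. if q = q' then (if j' = j \<and> p' = p then y (j, q) else \<zero>\<^bsub>V j'\<^esub>) else \<zero>\<^bsub>V j'\<^esub>) {..<d j'}"
    proof (rule Vj.finsum_cong')
      show "(\<lambda>q'. if q = q' then (if j' = j \<and> p' = p then y (j, q) else \<zero>\<^bsub>V j'\<^esub>) else \<zero>\<^bsub>V j'\<^esub>) \<in> {..<d j'} \<rightarrow> carrier (V j')"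
        using yc j by auto
      fix q' assume "q' \<in> {..<d j'}"
      then have q': "q' < d j'" by simp
      show "mat_unit s d j p q j' $$ (p', q') \<odot>\<^bsub>V j'\<^esub> y (j', q') =
          (if q = q' then (if j' = j \<and> p' = p then y (j, q) else \<zero>\<^bsub>V j'\<^esub>) else \<zero>\<^bsub>V j'\<^esub>)"
        using j' q' yc[OF j'(1) q'] left_module_zero_act[OF V[OF j'(1)] yc[OF j'(1) q']]
          left_module.act_one[OF V[OF j'(1)] yc[OF j'(1) q']]
        by (auto simp: mat_unit_simps(2)[where d = d])
    qed simp
    also have "\<dots> = (if j' = j \<and> p' = p then y (j, q) else \<zero>\<^bsub>V j'\<^esub>)"
    proof (cases "j' = j \<and> p' = p")
      case True
      then show ?thesis
        using finsum_single[OF Vj.abelian_group_axioms, of "{..<d j'}" q "\<lambda>q'. if q = q' then y (j, q) else \<zero>\<^bsub>V j'\<^esub>"] j yc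
        by simp
    next
      case False
      then have "(if j' = j \<and> p' = p then y (j, q) else \<zero>\<^bsub>V j'\<^esub>) = \<zero>\<^bsub>V j'\<^esub>" by auto
      then show ?thesis by (simp only: if_cancel Vj.finsum_zero)
    qed
    finally show ?thesis .
  qed
  then show ?thesis using y unfolding mat_act_def by (auto intro!: restrict_ext simp del: dprod_simps(1))
qed

text \<open>A module structure on \<open>V\<close> is a homomorphism to its endomorphism algebra.\<close>

definition module_of_hom :: "('a \<Rightarrow> 'v \<Rightarrow> 'v) \<Rightarrow> ('k, 'v) module \<Rightarrow> ('a, 'v) module" where
  "module_of_hom H V = \<lparr>carrier = carrier V, mult = undefined, one = undefined, zero = \<zero>\<^bsub>V\<^esub>,
    add = add V, smult = H\<rparr>"

lemma module_of_hom_simps [simp]: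
  "carrier (module_of_hom H V) = carrier V" "\<zero>\<^bsub>module_of_hom H V\<^esub> = \<zero>\<^bsub>V\<^esub>"
  "x \<oplus>\<^bsub>module_of_hom H V\<^esub> y = x \<oplus>\<^bsub>V\<^esub> y" "a \<odot>\<^bsub>module_of_hom H V\<^esub> x = H a x"
  by (simp_all add: module_of_hom_def)

lemma module_of_hom:
  fixes V :: "('k::field, 'v) module" and P :: "('k, 'a) module"
  assumes P: "assoc_algebra class_ring P" and V: "fd_space V"
    and H: "H \<in> alg_hom class_ring P (end_algebra V)"
  shows "module_of_hom H V \<in> Obj (rep_algebra P)" "x \<in> carrier V \<Longrightarrow> H (c \<odot>\<^bsub>P\<^esub> \<one>\<^bsub>P\<^esub>) x = c \<odot>\<^bsub>V\<^esub> x"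
proof -
  interpret P: assoc_algebra class_ring P by (rule P)
  note Vm = fd_space_left_module[OF V]
  interpret V: abelian_group V by (rule left_module_abelian_group[OF Vm])
  note HD = alg_homD[OF H]
  have HL: "H a \<in> lin_maps class_ring V V" if "a \<in> carrier P" for a using HD(1)[OF that] by simp
  have ab: "abelian_group (module_of_hom H V)"
  proof (rule abelian_groupI)
    fix x assume "x \<in> carrier (module_of_hom H V)"
    then show "\<exists>y\<in>carrier (module_of_hom H V). y \<oplus>\<^bsub>module_of_hom H V\<^esub> x = \<zero>\<^bsub>module_of_hom H V\<^esub>"
      by (intro bexI[of _ "\<ominus>\<^bsub>V\<^esub> x"]) (simp_all add: V.l_neg)
  qed (simp_all add: V.a_ac)
  have M: "left_module P (module_of_hom H V)"
    by (intro left_module.intro left_module_axioms.intro P.ring_axioms ab)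
      (simp_all add: lin_mapsD(1,2)[OF HL] HD(2,3,4) compose_eq)
  have scal: "H (c \<odot>\<^bsub>P\<^esub> \<one>\<^bsub>P\<^esub>) x = c \<odot>\<^bsub>V\<^esub> x" if "x \<in> carrier V" for c x
    using HD(5)[of c "\<one>\<^bsub>P\<^esub>"] that by (simp add: HD(4))
  then show "x \<in> carrier V \<Longrightarrow> H (c \<odot>\<^bsub>P\<^esub> \<one>\<^bsub>P\<^esub>) x = c \<odot>\<^bsub>V\<^esub> x" .
  have "fd_space (underlying_space P (module_of_hom H V))"
  proof (rule fd_space_surjective_image[OF V underlying_space_vectorspace[OF P M]])
    show "(\<lambda>x. x) \<in> LinearCombinations.module_hom class_ring V (underlying_space P (module_of_hom H V))"
      by (auto simp: LinearCombinations.module_hom_def scal)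
  qed simp
  then show "module_of_hom H V \<in> Obj (rep_algebra P)" using M by simp
qed

context free_product_of_matrix_algebras
begin

context
  fixes X :: "('k, vertex, nat \<times> nat \<times> nat, 'v) quiver_rep"
  assumes X: "X \<in> Obj (rep_quiver Q)" and bal: "balanced m r w X"
begin

abbreviation "V0 \<equiv> space X Sink"
abbreviation "V i j \<equiv> space X (Source i j)"

lemma V0_left_module: "left_module class_ring V0"
  using rep_quiver_ObjD(2)[OF X] by simp

lemma V_left_module: "i < m \<Longrightarrow> j < r i \<Longrightarrow> left_module class_ring (V i j)"
  using rep_quiver_ObjD(2)[OF X] by simp

lemma amap_lin_map:
  "\<lbrakk>i < m; j < r i; k < w i j\<rbrakk> \<Longrightarrow> amap X (i, j, k) \<in> lin_maps class_ring (V i j) V0"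
  using rep_quiver_ObjD(3)[OF X, of "(i, j, k)"] by simp

lemma Psi_bij: "i < m \<Longrightarrow> bij_betw (Psi r w X i) (carrier (Psi_dom r w X i)) (carrier V0)"
  using bal unfolding balanced_iff[OF X] by blast

lemma Psi_dom_eq: "Psi_dom r w X i = dprod (SIGMA j:{..<r i}. {..<w i j}) (\<lambda>(j, k). V i j)"
  by (simp add: Psi_dom_def)

text \<open>The action of the \<open>i\<close>-th factor on \<open>V0\<close>: by matrices on the direct sum that \<open>Psi\<close>
  identifies with \<open>V0\<close>.\<close>

definition "factor_action i b = (\<lambda>x\<in>carrier V0.
  Psi r w X i (mat_act (r i) (w i) (V i) b (inv_into (carrier (Psi_dom r w X i)) (Psi r w X i) x)))"

lemma factor_action_hom:
  assumes i: "i < m"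
  shows "factor_action i \<in> alg_hom class_ring (mat_algebras (r i) (w i)) (end_algebra V0)"
  unfolding factor_action_def
  by (rule alg_hom_compose[OF _ end_algebra_conjugate[OF Psi_dom_left_module[OF X i] Psi_lin_map[OF X i]
    Psi_bij[OF i] V0_left_module]]) (unfold Psi_dom_eq, rule mat_act_hom, rule V_left_module[OF i])

text \<open>The inclusion of the summand with index \<open>(j, k)\<close> into the domain of \<open>Psi\<close>.\<close>

definition "single i j k z = (\<lambda>(j', k')\<in>(SIGMA j:{..<r i}. {..<w i j}).
  if j' = j \<and> k' = k then z else \<zero>\<^bsub>V i j'\<^esub>)"

lemma single_in:
  assumes "i < m" "j < r i" "k < w i j" "z \<in> carrier (V i j)"
  shows "single i j k z \<in> carrier (Psi_dom r w X i)"
  using assms left_module_closed(2)[OF V_left_module[OF assms(1)]] by (auto simp: Psi_dom_simps single_def)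

lemma Psi_single:
  assumes i: "i < m" and j: "j < r i" "k < w i j" and z: "z \<in> carrier (V i j)"
  shows "Psi r w X i (single i j k z) = amap X (i, j, k) z"
proof -
  let ?I = "SIGMA j:{..<r i}. {..<w i j}"
  have ab: "abelian_group V0" by (rule left_module_abelian_group[OF V0_left_module])
  have "Psi r w X i (single i j k z) = finsum V0 (\<lambda>jk. amap X (i, jk) (single i j k z jk)) ?I"
    using single_in[OF assms] by (simp add: Psi_def)
  also have "\<dots> = amap X (i, j, k) (single i j k z (j, k))"
  proof (rule finsum_single[OF ab])
    show "finite ?I" by simp
    show "(j, k) \<in> ?I" using j by simp
    show "amap X (i, j, k) (single i j k z (j, k)) \<in> carrier V0"
      using lin_mapsD(1)[OF amap_lin_map[OF i j] z] j by (simp add: single_def)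
    fix t assume "t \<in> ?I" "t \<noteq> (j, k)"
    then obtain j' k' where t: "t = (j', k')" "j' < r i" "k' < w i j'" "\<not> (j' = j \<and> k' = k)" by auto
    have "amap X (i, j', k') \<zero>\<^bsub>V i j'\<^esub> = \<zero>\<^bsub>V0\<^esub>"
      by (rule lin_maps_zero[OF left_module_abelian_group[OF V_left_module[OF i t(2)]] ab amap_lin_map[OF i t(2,3)]])
    then show "amap X (i, t) (single i j k z t) = \<zero>\<^bsub>V0\<^esub>" using t by (auto simp: single_def)
  qed
  also have "\<dots> = amap X (i, j, k) z" using j by (simp add: single_def)
  finally show ?thesis .
qed

lemma factor_action_unit:
  assumes i: "i < m" and j: "j < r i" "p < w i j" "q < w i j" and y: "y \<in> carrier (Psi_dom r w X i)"
  shows "factor_action i (mat_unit (r i) (w i) j p q) (Psi r w X i y) = amap X (i, j, p) (y (j, q))"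
proof -
  have "inv_into (carrier (Psi_dom r w X i)) (Psi r w X i) (Psi r w X i y) = y"
    using Psi_bij[OF i] y by (simp add: bij_betw_def inv_into_f_f)
  moreover have "mat_act (r i) (w i) (V i) (mat_unit (r i) (w i) j p q) y = single i j p (y (j, q))"
    unfolding single_def by (rule mat_act_unit[OF V_left_module[OF i] y[unfolded Psi_dom_eq] j])
  moreover have "y (j, q) \<in> carrier (V i j)" using y j by (simp add: Psi_dom_simps)
  ultimately show ?thesis
    using lin_mapsD(1)[OF Psi_lin_map[OF X i] y] Psi_single[OF i j(1,2)] by (simp add: factor_action_def)
qed

text \<open>The actions of the factors glue to an action \<open>H\<close> of the free product on \<open>V0\<close>. Transported through
  \<open>Psi\<close>, the unit \<open>e i j p q\<close> sends \<open>amap X (i, j, q) z\<close> to \<open>amap X (i, j, p) z\<close> and kills the other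
  summands. Hence \<open>amap X (i, j, 0)\<close> identifies \<open>V i j\<close> with \<open>e i j 0 0 V0\<close>, and these identifications,
  with the identity at the sink, are compatible with the arrows.\<close>

lemma balanced_isomorphic_F:
  "\<exists>M\<in>Obj (rep_algebra P). \<exists>s. is_iso (rep_quiver Q) (fobj F M) X s"
proof -
  have "\<exists>!H. H \<in> alg_hom class_ring P (end_algebra V0) \<inter> extensional (carrier P) \<and>
    (\<forall>i\<in>{..<m}. \<forall>a\<in>carrier (A i). H (free_product_incl {..<m} A i a) = factor_action i (\<phi> i a))"
  proof (rule free_product_universal)
    fix i assume "i \<in> {..<m}"
    then have i: "i < m" by simp
    show "assoc_algebra class_ring (A i)" by (rule factor_algebra[OF i])
    show "(\<lambda>a. factor_action i (\<phi> i a)) \<in> alg_hom class_ring (A i) (end_algebra V0)"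
      by (rule alg_hom_compose[OF _ factor_action_hom[OF i]]) (use factor_iso[OF i] in \<open>simp add: alg_iso_def\<close>)
  qed (rule end_algebra_assoc_algebra[OF V0_left_module])
  then obtain H where H: "H \<in> alg_hom class_ring P (end_algebra V0)"
    and Hincl: "\<And>i a. i < m \<Longrightarrow> a \<in> carrier (A i) \<Longrightarrow> H (free_product_incl {..<m} A i a) = factor_action i (\<phi> i a)"
    by (elim ex1E) auto
  have fd0: "fd_space V0" using rep_quiver_ObjD(1)[OF X] by simp
  let ?M = "module_of_hom H V0"
  note M = module_of_hom[OF P_algebra fd0 H]
  have M': "left_module P ?M" "fd_space (underlying_space P ?M)" using M(1) by simp_all
  have He: "H (e i j p q) (Psi r w X i y) = amap X (i, j, p) (y (j, q))"
    if i: "i < m" and j: "j < r i" "p < w i j" "q < w i j" and y: "y \<in> carrier (Psi_dom r w X i)" for i j p q y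
  proof -
    let ?u = "mat_unit (r i) (w i) j p q :: nat \<Rightarrow> 'k mat"
    have u: "?u \<in> \<phi> i ` carrier (A i)"
      using factor_iso[OF i] mat_unit_in by (auto simp: alg_iso_def bij_betw_def)
    have "H (e i j p q) = factor_action i ?u"
      unfolding unit_elt_def using Hincl[OF i inv_into_into[OF u]] f_inv_into_f[OF u] by simp
    then show ?thesis using factor_action_unit[OF i j y] by simp
  qed
  have He_amap: "H (e i j p q) (amap X (i, j, q) z) = amap X (i, j, p) z"
    if i: "i < m" and j: "j < r i" "p < w i j" "q < w i j" and z: "z \<in> carrier (V i j)" for i j p q z
    using He[OF i j single_in[OF i j(1,3) z]] Psi_single[OF i j(1,3) z] j by (simp add: single_def)
  have corner: "(\<lambda>x. H (e i j 0 0) x) ` carrier V0 = amap X (i, j, 0) ` carrier (V i j)"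
    if i: "i < m" and j: "j < r i" for i j
  proof safe
    fix x assume "x \<in> carrier V0"
    then obtain y where y: "y \<in> carrier (Psi_dom r w X i)" "x = Psi r w X i y"
      using Psi_bij[OF i] by (auto simp: bij_betw_def)
    then have "H (e i j 0 0) x = amap X (i, j, 0) (y (j, 0))" using He[OF i j w_pos[OF i j] w_pos[OF i j]] by simp
    moreover have "y (j, 0) \<in> carrier (V i j)" using y j w_pos[OF i j] by (simp add: Psi_dom_simps)
    ultimately show "H (e i j 0 0) x \<in> amap X (i, j, 0) ` carrier (V i j)" by blast
  next
    fix z assume z: "z \<in> carrier (V i j)"
    then show "amap X (i, j, 0) z \<in> (\<lambda>x. H (e i j 0 0) x) ` carrier V0"
      using He_amap[OF i j w_pos[OF i j] w_pos[OF i j] z] lin_mapsD(1)[OF amap_lin_map[OF i j w_pos[OF i j]] z]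
      by (metis image_eqI)
  qed
  have inj: "inj_on (amap X (i, j, 0)) (carrier (V i j))" if i: "i < m" and j: "j < r i" for i j
  proof (rule inj_onI)
    fix z z' assume z: "z \<in> carrier (V i j)" "z' \<in> carrier (V i j)" and eq: "amap X (i, j, 0) z = amap X (i, j, 0) z'"
    note w0 = w_pos[OF i j]
    have "single i j 0 z = single i j 0 z'"
      by (rule inj_onD[OF bij_betw_imp_inj_on[OF Psi_bij[OF i]] _ single_in[OF i j w0 z(1)] single_in[OF i j w0 z(2)]])
        (simp add: Psi_single[OF i j w0] z eq)
    then have "single i j 0 z (j, 0) = single i j 0 z' (j, 0)" by simp
    then show "z = z'" using j w0 by (simp add: single_def)
  qed
  define s where "s = (\<lambda>v\<in>verts Q. case v of Sink \<Rightarrow> (\<lambda>x\<in>carrier V0. x) | Source i j \<Rightarrow> amap X (i, j, 0))"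
  have s: "s Sink = (\<lambda>x\<in>carrier V0. x)" "i < m \<Longrightarrow> j < r i \<Longrightarrow> s (Source i j) = amap X (i, j, 0)" for i j
    by (simp_all add: s_def)
  have FM: "space (fobj F ?M) (Source i j) = (underlying_space P ?M)\<lparr>carrier := amap X (i, j, 0) ` carrier (V i j)\<rparr>"
    if "i < m" "j < r i" for i j using corner[OF that] by simp
  have sH: "s \<in> Hom (rep_quiver Q) X (fobj F ?M)"
  proof (rule rep_quiver_HomI)
    show "s \<in> extensional (verts Q)" unfolding s_def by (rule restrict_extensional)
    fix v assume v: "v \<in> verts Q"
    show "s v \<in> lin_maps class_ring (space X v) (space (fobj F ?M) v)"
    proof (cases v)
      case Sink
      show ?thesis unfolding Sink s F_simps
        by (rule lin_mapsI) (simp_all add: left_module_closed[OF V0_left_module] M(2))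
    next
      case (Source i j)
      with v have ij: "i < m" "j < r i" by auto
      note aD = lin_mapsD[OF amap_lin_map[OF ij w_pos[OF ij]]]
      show ?thesis unfolding Source s(2)[OF ij] FM[OF ij]
        by (rule lin_mapsI) (simp_all add: aD M(2))
    qed
  next
    fix \<alpha> x assume a: "\<alpha> \<in> arcs Q" "x \<in> carrier (space X (tail Q \<alpha>))"
    then obtain i j k where ijk: "\<alpha> = (i, j, k)" "i < m" "j < r i" "k < w i j" by auto
    have x: "x \<in> carrier (V i j)" using a ijk by simp
    have c: "amap X (i, j, 0) x \<in> (\<lambda>x. H (e i j 0 0) x) ` carrier V0"
      unfolding corner[OF ijk(2,3)] using x by (rule imageI)
    have "amap (fobj F ?M) \<alpha> (s (tail Q \<alpha>) x) = H (e i j k 0) (amap X (i, j, 0) x)"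
      using c by (simp add: ijk s(2))
    then show "s (head Q \<alpha>) (amap X \<alpha> x) = amap (fobj F ?M) \<alpha> (s (tail Q \<alpha>) x)"
      using He_amap[OF ijk(2,3,4) w_pos[OF ijk(2,3)] x] lin_mapsD(1)[OF amap_lin_map[OF ijk(2-4)] x]
      by (simp add: ijk(1) s(1))
  qed
  have "is_iso (rep_quiver Q) X (fobj F ?M) s"
  proof (rule wf_digraph.rep_quiver_isoI[OF quiver_wf X F_rep[OF M'] sH])
    fix v assume v: "v \<in> verts Q"
    show "bij_betw (s v) (carrier (space X v)) (carrier (space (fobj F ?M) v))"
    proof (cases v)
      case Sink
      then show ?thesis by (simp add: s(1) bij_betw_def inj_on_def)
    next
      case (Source i j)
      with v have ij: "i < m" "j < r i" by auto
      show ?thesis unfolding Source s(2)[OF ij] FM[OF ij] using inj[OF ij] by (simp add: bij_betw_def)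
    qed
  qed
  then obtain t where "is_iso (rep_quiver Q) (fobj F ?M) X t" by (rule is_iso_inverse)
  then show ?thesis using M(1) by blast
qed

end

lemma F_essentially_surjective:
  "essentially_surjective (rep_algebra P :: ((((nat \<times> 'a) list \<Rightarrow> 'k) set, 'v) module, 'v \<Rightarrow> 'v) preadditive_category)
    (balanced_reps m r w) F"
  unfolding essentially_surjective_def
proof
  fix X :: "('k, vertex, nat \<times> nat \<times> nat, 'v) quiver_rep"
  assume "X \<in> Obj (balanced_reps m r w)"
  then have X: "X \<in> Obj (rep_quiver Q)" "balanced m r w X" unfolding balanced_reps_simps by simp_all
  have "is_iso (balanced_reps m r w) Y Z s = is_iso (rep_quiver Q) Y Z s"
    for Y Z :: "('k, vertex, nat \<times> nat \<times> nat, 'v) quiver_rep" and s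
    unfolding is_iso_def balanced_reps_simps ..
  then show "\<exists>M\<in>Obj (rep_algebra P). \<exists>s. is_iso (balanced_reps m r w) (fobj F M) X s"
    using balanced_isomorphic_F[OF X] by simp
qed

end

section \<open>The equivalence\<close>

theorem proposition2p6:
  fixes m :: nat and r :: "nat \<Rightarrow> nat" and w :: "nat \<Rightarrow> nat \<Rightarrow> nat"
    and A :: "nat \<Rightarrow> ('k::alg_closed_field, 'a) module"
    and \<phi> :: "nat \<Rightarrow> 'a \<Rightarrow> nat \<Rightarrow> 'k mat"
    and emb :: "'k \<Rightarrow> 'v"
  assumes "m \<ge> 1"
    and "\<And>i. i < m \<Longrightarrow> assoc_algebra class_ring (A i)"
    and "\<And>i. i < m \<Longrightarrow> fd_space (A i)"
    and "\<And>i. i < m \<Longrightarrow> semisimple_ring (A i)"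
    and "\<And>i. i < m \<Longrightarrow> vectorspace.dim class_ring (A i) \<noteq> 1"
    and "\<And>i j. \<lbrakk>i < m; j < r i\<rbrakk> \<Longrightarrow> w i j \<ge> 1"
    and "\<And>i. i < m \<Longrightarrow> \<phi> i \<in> alg_iso class_ring (A i) (mat_algebras (r i) (w i))"
    and "inj emb"
  shows "equivalence_of_categories
      (rep_algebra (free_product {..<m} A))
      (balanced_reps m r w :: (('k, vertex, nat \<times> nat \<times> nat, 'v) quiver_rep,
        vertex \<Rightarrow> 'v \<Rightarrow> 'v) preadditive_category)
      (functor_F m r w A \<phi>)
    \<and> abelian_category
      (balanced_reps m r w :: (('k, vertex, nat \<times> nat \<times> nat, 'v) quiver_rep,
        vertex \<Rightarrow> 'v \<Rightarrow> 'v) preadditive_category)"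
proof -
  interpret free_product_of_matrix_algebras m r w A \<phi>
    by (rule free_product_of_matrix_algebras.intro) (rule assms(2,6,7); assumption)+
  show ?thesis
  proof
    show "equivalence_of_categories (rep_algebra P)
        (balanced_reps m r w :: (('k, vertex, nat \<times> nat \<times> nat, 'v) quiver_rep,
          vertex \<Rightarrow> 'v \<Rightarrow> 'v) preadditive_category) F"
      by (rule fully_faithful_essentially_surjective_equivalence[OF F_functor F_fully_faithful
        F_essentially_surjective])
    show "abelian_category (balanced_reps m r w :: (('k, vertex, nat \<times> nat \<times> nat, 'v) quiver_rep,
          vertex \<Rightarrow> 'v \<Rightarrow> 'v) preadditive_category)"
      by (rule abelian_category_transfer[OF F_functor F_fully_faithful F_essentially_surjective F_additive
        rep_algebra_abelian[OF P_algebra infinite_UNIV_alg_closed_field \<open>inj emb\<close>] balanced_reps_preadditive])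
  qed
qed

end
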